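(* Let $K\in\mathbb{R}$ and let $D$ be a convex compact domain in $\mathbb{X}_K$ whose boundary is a geodesic polygon with edges $a_1,\dots,a_n$, with $|a_i|$ the length of $a_i$. Let $f\in C^1(\mathbb{R};\mathbb{R})$. Then $$\int_{\mathcal{G}^K_{D}}(f\circ\rho_K)\,\mathrm{d}\mu_K=\int_{\mathcal{G}^K_{D}}(f'\circ\rho_K)\,\sin_K(\rho_K)\,\cot\alpha_1\cot\alpha_2\,\mathrm{d}\mu_K+\sum_{i=1}^n\int_0^{|a_i|}f(x)\,\mathrm{d}x.$$
   Context: $\mathbb{X}_K$ is the maximally symmetric, simply connected, 2-dimensional Riemannian manifold of constant sectional curvature $K$ (sphere of radius $1/\sqrt K$ if $K>0$, Euclidean plane if $K=0$, rescaled hyperbolic plane if $K<0$). The function $\sin_K$ is $\sin_K(x)=\frac{1}{\sqrt K}\sin(\sqrt K x)$ if $K>0$, $\sin_K(x)=x$ if $K=0$, $\sin_K(x)=\frac{1}{\sqrt{-K}}\sinh(\sqrt{-K}x)$ if $K<0$. $\mathcal{G}^K$ is the set of unoriented complete geodesics of $\mathbb{X}_K$ (great circles if $K>0$), and $\mu_K$ is the isometry-invariant measure on $\mathcal{G}^K$ normalized so that, locally, near a geodesic crossing a given geodesic segment, $\mathrm{d}\mu_K=\sin\alpha\,\mathrm{d}l\,\mathrm{d}\alpha$, where $l$ is the arclength position of the crossing point and $\alpha\in(0,\pi)$ the crossing angle. $\mathcal{G}^K_D\subset\mathcal{G}^K$ is the set of geodesics intersecting $D$; for $\gamma\in\mathcal{G}^K_D$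 the chord is $\gamma\cap D$ and $\rho_K(\gamma)$ is its length. $\alpha_1(\gamma),\alpha_2(\gamma)$ are the two angles between the boundary $\partial D$ and the chord of $\gamma$, at the two endpoints of the chord, lying on the same side of $\gamma$ (the product $\cot\alpha_1\cot\alpha_2$ does not depend on the choice of side). $\mathrm{d}x$ is the length element on $\mathbb{R}$. *)

theory Defs
  imports "HOL-Analysis.Analysis"
begin

section \<open>The surface of constant curvature \<open>K\<close>\<close>

text \<open>
  All three geometries are modelled in \<open>\<real> \<times> \<real>\<^sup>2\<close>, on the quadric \<open>x\<^sub>0\<^sup>2 + K |x|\<^sup>2 = 1\<close>
  (with \<open>x\<^sub>0 > 0\<close> if \<open>K \<le> 0\<close>), with the metric induced by \<open>|dx|\<^sup>2 + dx\<^sub>0\<^sup>2 / K\<close>.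
  For \<open>K \<noteq> 0\<close>, the substitution \<open>y\<^sub>0 = x\<^sub>0 / sqrt |K|\<close> turns this into the round sphere
  \<open>y\<^sub>0\<^sup>2 + |x|\<^sup>2 = 1/K\<close> with the metric of Euclidean space, resp. the upper sheet of the hyperboloid
  \<open>y\<^sub>0\<^sup>2 - |x|\<^sup>2 = 1/|K|\<close> with the metric of Minkowski space. For \<open>K = 0\<close> it is the plane \<open>x\<^sub>0 = 1\<close>;
  its tangent vectors have \<open>dx\<^sub>0 = 0\<close>, so that the term \<open>dx\<^sub>0\<^sup>2 / K\<close> vanishes.
\<close>

type_synonym pt = "real \<times> real \<times> real"

definition sinK :: "real \<Rightarrow> real \<Rightarrow> real" where
  "sinK K x = (if K > 0 then sin (sqrt K * x) / sqrt K
               else if K = 0 then x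
               else sinh (sqrt (- K) * x) / sqrt (- K))"

definition cosK :: "real \<Rightarrow> real \<Rightarrow> real" where
  "cosK K x = (if K > 0 then cos (sqrt K * x)
               else if K = 0 then 1
               else cosh (sqrt (- K) * x))"

definition quad :: "real \<Rightarrow> pt \<Rightarrow> pt \<Rightarrow> real" where
  "quad K p q = fst p * fst q + K * (snd p \<bullet> snd q)"

definition surface :: "real \<Rightarrow> pt set" where
  "surface K = {p. quad K p p = 1 \<and> (K \<le> 0 \<longrightarrow> fst p > 0)}"

definition riem :: "real \<Rightarrow> pt \<Rightarrow> pt \<Rightarrow> real" where
  "riem K v w = snd v \<bullet> snd w + fst v * fst w / K"

text \<open>The unit tangent bundle; \<open>quad K p v = 0\<close> says that \<open>v\<close> is tangent to the quadric at \<open>p\<close>.\<close>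

definition unit_tangent :: "real \<Rightarrow> (pt \<times> pt) set" where
  "unit_tangent K = {(p, v). p \<in> surface K \<and> quad K p v = 0 \<and> riem K v v = 1}"

text \<open>The unit speed geodesic with initial point \<open>p\<close> and initial velocity \<open>v\<close>, and its velocity.\<close>

definition geo :: "real \<Rightarrow> pt \<Rightarrow> pt \<Rightarrow> real \<Rightarrow> pt" where
  "geo K p v t = cosK K t *\<^sub>R p + sinK K t *\<^sub>R v"

definition geo_vel :: "real \<Rightarrow> pt \<Rightarrow> pt \<Rightarrow> real \<Rightarrow> pt" where
  "geo_vel K p v t = (- K * sinK K t) *\<^sub>R p + cosK K t *\<^sub>R v"

lemma cosK_sinK: "(cosK K t)\<^sup>2 + K * (sinK K t)\<^sup>2 = 1"
proof -
  have "(cosh x)\<^sup>2 - (sinh x)\<^sup>2 = 1" for x :: real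
    by (simp add: cosh_square_eq)
  then show ?thesis
    by (auto simp: cosK_def sinK_def power_divide)
qed

lemma cosK_pos: "K \<le> 0 \<Longrightarrow> cosK K t > 0"
  by (auto simp: cosK_def)

lemma cosK_deriv: "(cosK K has_real_derivative - K * sinK K t) (at t)"
  and sinK_deriv: "(sinK K has_real_derivative cosK K t) (at t)"
proof -
  define k where "k = sqrt \<bar>K\<bar>"
  have k: "k * k = \<bar>K\<bar>" "K \<noteq> 0 \<Longrightarrow> k > 0" by (simp_all add: k_def)
  consider "K = 0" | "K > 0" | "K < 0" by linarith
  then have "(cosK K has_real_derivative - K * sinK K t) (at t) \<and>
             (sinK K has_real_derivative cosK K t) (at t)"
  proof cases
    case 1
    then show ?thesis unfolding cosK_def[abs_def] sinK_def[abs_def] by simp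
  next
    case 2
    have "((\<lambda>x. cos (k * x)) has_real_derivative - (k * k) * (sin (k * t) / k)) (at t)"
      "((\<lambda>x. sin (k * x) / k) has_real_derivative cos (k * t)) (at t)"
      using k(2) 2 by (auto intro!: derivative_eq_intros)
    moreover have "cosK K = (\<lambda>x. cos (k * x))" "sinK K = (\<lambda>x. sin (k * x) / k)"
      using \<open>K > 0\<close> by (auto simp: cosK_def sinK_def k_def)
    moreover have "k * k = K" using k(1) 2 by linarith
    ultimately show ?thesis by simp
  next
    case 3
    have "((\<lambda>x. cosh (k * x)) has_real_derivative k * k * (sinh (k * t) / k)) (at t)"
      "((\<lambda>x. sinh (k * x) / k) has_real_derivative cosh (k * t)) (at t)"
      using k(2) 3 by (auto intro!: derivative_eq_intros)
    moreover have "cosK K = (\<lambda>x. cosh (k * x))" "sinK K = (\<lambda>x. sinh (k * x) / k)"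
      using \<open>K < 0\<close> by (auto simp: cosK_def sinK_def k_def)
    moreover have "k * k = - K" using k(1) 3 by linarith
    ultimately show ?thesis by simp
  qed
  then show "(cosK K has_real_derivative - K * sinK K t) (at t)"
    "(sinK K has_real_derivative cosK K t) (at t)" by auto
qed

lemma geo_has_vector_derivative: "(geo K p v has_vector_derivative geo_vel K p v t) (at t)"
  unfolding geo_def[abs_def] geo_vel_def
  using cosK_deriv[of K t] sinK_deriv[of K t]
  by (auto intro!: derivative_eq_intros)

lemma geo_unit_tangent:
  assumes "(p, v) \<in> unit_tangent K"
  shows "(geo K p v t, geo_vel K p v t) \<in> unit_tangent K"
proof -
  let ?c = "cosK K t" and ?s = "sinK K t"
  obtain p0 x v0 w where pv: "p = (p0, x)" "v = (v0, w)"
    by (cases p, cases v) blast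
  have pp: "p0 * p0 + K * (x \<bullet> x) = 1" and pos: "K \<le> 0 \<Longrightarrow> p0 > 0"
    and tang: "p0 * v0 + K * (x \<bullet> w) = 0" and unit: "w \<bullet> w + v0 * v0 / K = 1"
    using assms by (auto simp: pv unit_tangent_def surface_def quad_def riem_def)
  have cs: "?c * ?c + K * (?s * ?s) = 1"
    using cosK_sinK[of K t] by (simp add: power2_eq_square)
  have vv: "v0 * v0 + K * (w \<bullet> w) = K"
  proof (cases "K = 0")
    case True
    then show ?thesis using tang pos by simp
  next
    case False
    then show ?thesis using unit by (simp add: field_simps)
  qed
  have on_quad: "quad K (geo K p v t) (geo K p v t) = 1"
  proof -
    have "quad K (geo K p v t) (geo K p v t) =
        ?c * ?c * (p0 * p0 + K * (x \<bullet> x)) + 2 * (?c * ?s) * (p0 * v0 + K * (x \<bullet> w))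
        + ?s * ?s * (v0 * v0 + K * (w \<bullet> w))"
      by (simp add: quad_def geo_def pv inner_add inner_commute algebra_simps)
    then show ?thesis using cs by (simp add: pp tang vv algebra_simps)
  qed
  have tangent: "quad K (geo K p v t) (geo_vel K p v t) = 0"
  proof -
    have "quad K (geo K p v t) (geo_vel K p v t) =
        - K * (?c * ?s) * (p0 * p0 + K * (x \<bullet> x))
        + (?c * ?c - K * (?s * ?s)) * (p0 * v0 + K * (x \<bullet> w))
        + ?c * ?s * (v0 * v0 + K * (w \<bullet> w))"
      by (simp add: quad_def geo_def geo_vel_def pv inner_add inner_diff inner_commute algebra_simps)
    then show ?thesis by (simp add: pp tang vv)
  qed
  have speed: "riem K (geo_vel K p v t) (geo_vel K p v t) = 1"
  proof (cases "K = 0")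
    case True
    then show ?thesis using unit by (simp add: riem_def geo_vel_def pv cosK_def)
  next
    case False
    have "K * riem K (geo_vel K p v t) (geo_vel K p v t) =
        K * K * (?s * ?s) * (p0 * p0 + K * (x \<bullet> x))
        - 2 * K * (?c * ?s) * (p0 * v0 + K * (x \<bullet> w))
        + ?c * ?c * (v0 * v0 + K * (w \<bullet> w))"
      using False
      by (simp add: riem_def geo_vel_def pv inner_add inner_diff inner_commute field_simps)
    also have "\<dots> = K * (?c * ?c + K * (?s * ?s))"
      by (simp add: pp tang vv algebra_simps)
    finally show ?thesis using False cs by simp
  qed
  have "fst (geo K p v t) > 0" if "K \<le> 0"
  proof (cases "K = 0")
    case True
    then show ?thesis using tang pos by (simp add: geo_def pv cosK_def)
  next
    case False
    then have K: "K < 0" using that by simp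
    have "(x \<bullet> w)\<^sup>2 \<le> (x \<bullet> x) * (w \<bullet> w)"
      by (rule Cauchy_Schwarz_ineq)
    then have "K * K * (x \<bullet> w)\<^sup>2 \<le> (K * K) * ((x \<bullet> x) * (w \<bullet> w))"
      by (intro mult_left_mono) auto
    then have "(K * (x \<bullet> w))\<^sup>2 \<le> (K * (x \<bullet> x)) * (K * (w \<bullet> w))"
      by (simp add: power2_eq_square mult_ac)
    moreover have "K * (x \<bullet> w) = - (p0 * v0)" "K * (x \<bullet> x) = 1 - p0 * p0"
      "K * (w \<bullet> w) = K - v0 * v0"
      using pp tang vv by linarith+
    ultimately have "(p0 * v0)\<^sup>2 \<le> (1 - p0 * p0) * (K - v0 * v0)"
      by simp
    then have "v0\<^sup>2 \<le> - K * (p0\<^sup>2 - 1)"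
      by (simp add: power2_eq_square algebra_simps)
    then have "?s\<^sup>2 * v0\<^sup>2 \<le> ?s\<^sup>2 * (- K * (p0\<^sup>2 - 1))"
      by (intro mult_left_mono) auto
    also have "\<dots> = (?c\<^sup>2 - 1) * (p0\<^sup>2 - 1)"
      using cs by (simp add: power2_eq_square algebra_simps) algebra
    also have "\<dots> < (?c * p0)\<^sup>2"
    proof -
      have "?c\<^sup>2 \<ge> 1"
        using cosK_sinK[of K t] K mult_nonpos_nonneg[of K "?s\<^sup>2"] by simp
      moreover have "p0\<^sup>2 > 0" using pos[OF that] by (intro zero_less_power)
      ultimately have "1 < ?c\<^sup>2 + p0\<^sup>2" by linarith
      then show ?thesis by (simp add: power_mult_distrib left_diff_distrib right_diff_distrib)
    qed
    finally have "\<bar>?s * v0\<bar>\<^sup>2 < (?c * p0)\<^sup>2"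
      by (simp add: power_mult_distrib)
    then have "\<bar>?s * v0\<bar> < ?c * p0"
      by (rule power2_less_imp_less) (use cosK_pos[OF that, of t] pos[OF that] in simp)
    then show ?thesis by (simp add: geo_def pv)
  qed
  then show ?thesis
    using on_quad tangent speed by (simp add: unit_tangent_def surface_def)
qed

definition surface_dist :: "real \<Rightarrow> pt \<Rightarrow> pt \<Rightarrow> real" where
  "surface_dist K p q = Inf {t. 0 \<le> t \<and> (\<exists>v. (p, v) \<in> unit_tangent K \<and> geo K p v t = q)}"

definition surface_isometry :: "real \<Rightarrow> (pt \<Rightarrow> pt) \<Rightarrow> bool" where
  "surface_isometry K g \<longleftrightarrow> bij_betw g (surface K) (surface K) \<and>
     (\<forall>p\<in>surface K. \<forall>q\<in>surface K. surface_dist K (g p) (g q) = surface_dist K p q)"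

definition angle :: "real \<Rightarrow> pt \<Rightarrow> pt \<Rightarrow> real" where
  "angle K u w = arccos (riem K u w)"


section \<open>The space of unoriented geodesics and its invariant measure\<close>

definition geodesic :: "real \<Rightarrow> pt \<Rightarrow> pt \<Rightarrow> pt set" where
  "geodesic K p v = range (geo K p v)"

definition geodesics :: "real \<Rightarrow> pt set set" where
  "geodesics K = {geodesic K p v | p v. (p, v) \<in> unit_tangent K}"

text \<open>
  An orthonormal frame \<open>v, n\<close> at \<open>p\<close>. The vector \<open>n\<close>, held constant in the ambient space, is a unit
  normal field along the whole geodesic \<open>geo K p v\<close>.
\<close>

definition orthonormal_frame :: "real \<Rightarrow> pt \<Rightarrow> pt \<Rightarrow> pt \<Rightarrow> bool" where
  "orthonormal_frame K p v n \<longleftrightarrow>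
     (p, v) \<in> unit_tangent K \<and> (p, n) \<in> unit_tangent K \<and> riem K v n = 0"

text \<open>The geodesic which crosses \<open>geo K p v\<close> at arclength position \<open>l\<close> and with angle \<open>a\<close>.\<close>

definition crossing :: "real \<Rightarrow> pt \<Rightarrow> pt \<Rightarrow> pt \<Rightarrow> real \<times> real \<Rightarrow> pt set" where
  "crossing K p v n = (\<lambda>(l, a). geodesic K (geo K p v l) (cos a *\<^sub>R geo_vel K p v l + sin a *\<^sub>R n))"

text \<open>
  The space of geodesics is a quotient of the unit tangent bundle and carries the corresponding
  quotient \<open>\<sigma>\<close>-algebra. The last clause is the normalization \<open>d\<mu> = sin a dl da\<close>, in every region
  where the pair \<open>(l, a)\<close> is a coordinate system.
\<close>

definition invariant_measure :: "real \<Rightarrow> pt set measure \<Rightarrow> bool" where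
  "invariant_measure K \<mu> \<longleftrightarrow>
     space \<mu> = geodesics K \<and>
     sets \<mu> = {A. A \<subseteq> geodesics K \<and>
                  {(p, v). (p, v) \<in> unit_tangent K \<and> geodesic K p v \<in> A} \<in> sets borel} \<and>
     (\<forall>g A. surface_isometry K g \<and> A \<in> sets \<mu> \<longrightarrow> emeasure \<mu> ((`) g ` A) = emeasure \<mu> A) \<and>
     (\<forall>p v n B. orthonormal_frame K p v n \<and> B \<in> sets borel \<and> B \<subseteq> UNIV \<times> {0<..<pi} \<and>
                inj_on (crossing K p v n) B \<longrightarrow>
        emeasure \<mu> (crossing K p v n ` B) = (\<integral>\<^sup>+(l, a)\<in>B. ennreal (sin a) \<partial>lborel))"


section \<open>Convex polygonal domains\<close>

text \<open>
  For \<open>K > 0\<close> this notion of convexity does not exclude pairs of antipodal points, so that lunes are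
  covered as well.
\<close>

definition geodesically_convex :: "real \<Rightarrow> pt set \<Rightarrow> bool" where
  "geodesically_convex K D \<longleftrightarrow>
     (\<forall>p\<in>D. \<forall>q\<in>D. \<exists>v. (p, v) \<in> unit_tangent K \<and> geo K p v (surface_dist K p q) = q \<and>
                        geo K p v ` {0..surface_dist K p q} \<subseteq> D)"

definition bdry :: "real \<Rightarrow> pt set \<Rightarrow> pt set" where
  "bdry K D = (top_of_set (surface K)) frontier_of D"

definition convex_compact_domain :: "real \<Rightarrow> pt set \<Rightarrow> bool" where
  "convex_compact_domain K D \<longleftrightarrow>
     D \<noteq> {} \<and> D \<subseteq> surface K \<and> compact D \<and> geodesically_convex K D \<and>
     D = (top_of_set (surface K)) closure_of ((top_of_set (surface K)) interior_of D)"

text \<open>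
  A simple closed geodesic polygon with \<open>n\<close> edges. The \<open>i\<close>-th edge starts at \<open>P i\<close> in the direction
  \<open>V i\<close> and has length \<open>L i\<close>; the direction changes at every vertex, i.e. the edges are maximal.
\<close>

definition geodesic_polygon ::
  "real \<Rightarrow> nat \<Rightarrow> (nat \<Rightarrow> pt) \<Rightarrow> (nat \<Rightarrow> pt) \<Rightarrow> (nat \<Rightarrow> real) \<Rightarrow> bool" where
  "geodesic_polygon K n P V L \<longleftrightarrow>
     0 < n \<and>
     (\<forall>i<n. (P i, V i) \<in> unit_tangent K \<and> 0 < L i \<and>
            geo K (P i) (V i) (L i) = P (Suc i mod n) \<and>
            geo_vel K (P i) (V i) (L i) \<noteq> V (Suc i mod n)) \<and>
     (\<forall>i<n. \<forall>j<n. \<forall>s\<in>{0..<L i}. \<forall>t\<in>{0..<L j}.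
        geo K (P i) (V i) s = geo K (P j) (V j) t \<longrightarrow> i = j \<and> s = t)"

definition edge :: "real \<Rightarrow> (nat \<Rightarrow> pt) \<Rightarrow> (nat \<Rightarrow> pt) \<Rightarrow> (nat \<Rightarrow> real) \<Rightarrow> nat \<Rightarrow> pt set" where
  "edge K P V L i = geo K (P i) (V i) ` {0..L i}"


section \<open>Chords\<close>

definition geodesics_meeting :: "real \<Rightarrow> pt set \<Rightarrow> pt set set" where
  "geodesics_meeting K D = {\<gamma> \<in> geodesics K. \<gamma> \<inter> D \<noteq> {}}"

text \<open>The chord \<open>\<gamma> \<inter> D\<close> is the segment of length \<open>r\<close> which starts at \<open>p\<close> in the direction \<open>v\<close>.\<close>

definition is_chord :: "real \<Rightarrow> pt set \<Rightarrow> pt set \<Rightarrow> pt \<Rightarrow> pt \<Rightarrow> real \<Rightarrow> bool" where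
  "is_chord K D \<gamma> p v r \<longleftrightarrow>
     (p, v) \<in> unit_tangent K \<and> \<gamma> = geodesic K p v \<and> 0 \<le> r \<and> \<gamma> \<inter> D = geo K p v ` {0..r}"

definition chord_length :: "real \<Rightarrow> pt set \<Rightarrow> pt set \<Rightarrow> real" where
  "chord_length K D \<gamma> = (THE r. \<exists>p v. is_chord K D \<gamma> p v r)"

text \<open>For a polygon \<open>D\<close>, no vertex has a tangent in the following sense.\<close>

definition bdry_tangent :: "real \<Rightarrow> pt set \<Rightarrow> pt \<Rightarrow> pt \<Rightarrow> bool" where
  "bdry_tangent K D p u \<longleftrightarrow>
     (p, u) \<in> unit_tangent K \<and> (\<exists>\<epsilon>>0. geo K p u ` {-\<epsilon><..<\<epsilon>} \<subseteq> bdry K D)"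

text \<open>
  The vectors \<open>v\<close> and \<open>- geo_vel K p v r\<close> point from the two endpoints into the chord. The boundary
  directions \<open>u1\<close> and \<open>u2\<close> are those on the side of \<open>\<gamma>\<close> determined by the normal field \<open>n\<close>.
\<close>

definition is_chord_angles :: "real \<Rightarrow> pt set \<Rightarrow> pt set \<Rightarrow> real \<Rightarrow> real \<Rightarrow> bool" where
  "is_chord_angles K D \<gamma> a1 a2 \<longleftrightarrow>
     (\<exists>p v r n u1 u2. is_chord K D \<gamma> p v r \<and> orthonormal_frame K p v n \<and>
        bdry_tangent K D p u1 \<and> riem K u1 n > 0 \<and>
        bdry_tangent K D (geo K p v r) u2 \<and> riem K u2 n > 0 \<and>
        a1 = angle K u1 v \<and> a2 = angle K u2 (- geo_vel K p v r))"

text \<open>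
  The choice among the admissible pairs (order of the endpoints, side of \<open>\<gamma>\<close>) does not affect
  \<open>cot (\<alpha>\<^sub>1 \<gamma>) * cot (\<alpha>\<^sub>2 \<gamma>)\<close>. There is no admissible pair on the null set of those \<open>\<gamma>\<close> which
  pass through a vertex; all of these get the same unspecified value.
\<close>

definition chord_angles :: "real \<Rightarrow> pt set \<Rightarrow> pt set \<Rightarrow> real \<times> real" where
  "chord_angles K D \<gamma> = (SOME (a1, a2). is_chord_angles K D \<gamma> a1 a2)"

definition chord_angle1 :: "real \<Rightarrow> pt set \<Rightarrow> pt set \<Rightarrow> real" where
  "chord_angle1 K D \<gamma> = fst (chord_angles K D \<gamma>)"

definition chord_angle2 :: "real \<Rightarrow> pt set \<Rightarrow> pt set \<Rightarrow> real" where
  "chord_angle2 K D \<gamma> = snd (chord_angles K D \<gamma>)"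

end

theory Submission
  imports Defs
begin

text \<open>
  Fix an edge \<open>a\<^sub>i\<close> and describe a geodesic which crosses it at the point \<open>q\<close> with arclength \<open>s\<close> by the
  point \<open>y\<close> with arclength \<open>t\<close> at which it leaves \<open>D\<close> through another edge \<open>a\<^sub>j\<close>. If \<open>\<rho>\<close> is the distance
  of \<open>q\<close> and \<open>y\<close>, and \<open>\<alpha>\<close>, \<open>\<beta>\<close> are the angles of the chord with the directions of \<open>a\<^sub>i\<close> and \<open>a\<^sub>j\<close>, then
  \<open>\<partial>\<rho>/\<partial>t = cos \<beta>\<close> and \<open>\<partial>\<alpha>/\<partial>t = sin \<beta> / sin\<^sub>K \<rho>\<close>. So \<open>d\<mu> = sin \<alpha> sin \<beta> / sin\<^sub>K \<rho> ds dt\<close>, and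
  \<open>\<partial>/\<partial>t (- f(\<rho>) cos \<alpha>)\<close> is the difference of the two integrands of the theorem, with respect to
  \<open>ds dt\<close>. Integrating over \<open>t\<close> and summing over \<open>j \<noteq> i\<close>, the boundary terms telescope: at the two
  ends of \<open>a\<^sub>i\<close> the angle \<open>\<alpha>\<close> is \<open>0\<close> and \<open>\<pi>\<close>, and there remains \<open>f(s) + f(|a\<^sub>i| - s)\<close>, whose integral
  over \<open>s\<close> is twice that of \<open>f\<close>. Summing over \<open>i\<close> counts every geodesic twice.

  In the model, a geodesic is the intersection of the surface with a plane through \<open>0\<close>, so that
  incidence is the vanishing of a determinant, which is linear in each point.
\<close>

section \<open>Linear algebra of the quadric model\<close>

text \<open>Convexity is given by shortest geodesics, whereas the sign information needed later is
  linear. The bridge is the cone over \<open>D\<close>: its supporting planes at the midpoints of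
  the edges exhibit \<open>D\<close> as the set where the functionals \<open>h k\<close> of the
  edges are nonnegative, and chords, exits and vertices are then controlled by the signs of these
  functionals. Along a geodesic such a functional is a combination of \<open>cosK\<close> and
  \<open>sinK\<close>, so that one argument serves all \<open>K\<close>. Special to the sphere are
  the bounds by half a period and the lunes, which contain antipodal vertices. For adjacent edges
  the density blows up at the common vertex. The first integrand is still integrable, because the
  integral of the density is the measure of geodesics crossing a segment, hence finite; in the
  second one the sines of the density cancel those of the cotangents and leave
  \<open>f'(\<rho>) cos \<alpha> cos \<beta>\<close>, which is bounded. This justifies Fubini. Since
  \<open>\<mu>\<close> lives on a quotient \<sigma>-algebra, images of rectangles are shown to be
  measurable through incidence with compact sets.\<close>

definition det3 :: "pt \<Rightarrow> pt \<Rightarrow> pt \<Rightarrow> real" where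
  "det3 p q r = fst p * (fst (snd q) * snd (snd r) - snd (snd q) * fst (snd r))
     - fst (snd p) * (fst q * snd (snd r) - snd (snd q) * fst r)
     + snd (snd p) * (fst q * fst (snd r) - fst (snd q) * fst r)"

lemma det3_Pair:
  "det3 (a, b, c) (d, e, f) (g, h, i) = a * (e * i - f * h) - b * (d * i - f * g) + c * (d * h - e * g)"
  by (simp add: det3_def)

lemma det3_linear:
  "det3 (x + y) q r = det3 x q r + det3 y q r" "det3 (a *\<^sub>R x) q r = a * det3 x q r"
  "det3 p (x + y) r = det3 p x r + det3 p y r" "det3 p (a *\<^sub>R x) r = a * det3 p x r"
  "det3 p q (x + y) = det3 p q x + det3 p q y" "det3 p q (a *\<^sub>R x) = a * det3 p q x"
  "det3 (- x) q r = - det3 x q r" "det3 p (- x) r = - det3 p x r" "det3 p q (- x) = - det3 p q x"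
  "det3 (x - y) q r = det3 x q r - det3 y q r" "det3 p (x - y) r = det3 p x r - det3 p y r"
  "det3 p q (x - y) = det3 p q x - det3 p q y"
  by (simp_all add: det3_def algebra_simps)

lemma det3_same [simp]: "det3 p p r = 0" "det3 p r p = 0" "det3 r p p = 0"
  by (simp_all add: det3_def algebra_simps)

lemma det3_swap: "det3 q p r = - det3 p q r" "det3 p r q = - det3 p q r"
  and det3_rotate: "det3 q r p = det3 p q r"
  by (simp_all add: det3_def algebra_simps)

lemma continuous_on_det3 [continuous_intros]:
  assumes "continuous_on S f" "continuous_on S g" "continuous_on S h"
  shows "continuous_on S (\<lambda>x. det3 (f x) (g x) (h x))"
  unfolding det3_def using assms by (intro continuous_intros)

lemma continuous_on_quad [continuous_intros]:
  assumes "continuous_on S f" "continuous_on S g"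
  shows "continuous_on S (\<lambda>x. quad K (f x) (g x))"
  unfolding quad_def using assms by (intro continuous_intros)

lemma quad_linear:
  "quad K (x + y) q = quad K x q + quad K y q" "quad K (a *\<^sub>R x) q = a * quad K x q"
  "quad K p (x + y) = quad K p x + quad K p y" "quad K p (a *\<^sub>R x) = a * quad K p x"
  "quad K (- x) q = - quad K x q" "quad K p (- x) = - quad K p x"
  "quad K (x - y) q = quad K x q - quad K y q" "quad K p (x - y) = quad K p x - quad K p y"
  by (simp_all add: quad_def inner_diff inner_add inner_commute algebra_simps)

lemma riem_linear:
  "riem K (x + y) q = riem K x q + riem K y q" "riem K (a *\<^sub>R x) q = a * riem K x q"
  "riem K p (x + y) = riem K p x + riem K p y" "riem K p (a *\<^sub>R x) = a * riem K p x"
  "riem K (- x) q = - riem K x q" "riem K p (- x) = - riem K p x"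
  "riem K (x - y) q = riem K x q - riem K y q" "riem K p (x - y) = riem K p x - riem K p y"
  by (simp_all add: riem_def inner_diff inner_add inner_commute algebra_simps add_divide_distrib diff_divide_distrib)

lemma riem_sym: "riem K x y = riem K y x" and quad_sym: "quad K x y = quad K y x"
  by (simp_all add: riem_def quad_def inner_commute mult.commute)

lemma quad_eq_riem: "K \<noteq> 0 \<Longrightarrow> quad K x y = K * riem K x y"
  by (simp add: quad_def riem_def field_simps)

text \<open>Multiplying the unit condition by \<open>K\<close> removes the division; for
  \<open>K = 0\<close>, tangency at \<open>p0 > 0\<close> forces \<open>v0 = 0\<close>.\<close>

lemma unit_tangent_coords:
  assumes "((p0, p1, p2), (v0, v1, v2)) \<in> unit_tangent K"
  shows "p0 * p0 + K * (p1 * p1 + p2 * p2) = 1" "p0 * v0 + K * (p1 * v1 + p2 * v2) = 0"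
    "v0 * v0 + K * (v1 * v1 + v2 * v2) = K" "K \<le> 0 \<Longrightarrow> p0 > 0" "K = 0 \<Longrightarrow> v0 = 0" "K = 0 \<Longrightarrow> p0 = 1"
    "v1 * v1 + v2 * v2 + v0 * v0 / K = 1"
proof -
  show 1: "p0 * p0 + K * (p1 * p1 + p2 * p2) = 1" "p0 * v0 + K * (p1 * v1 + p2 * v2) = 0"
    "K \<le> 0 \<Longrightarrow> p0 > 0" "v1 * v1 + v2 * v2 + v0 * v0 / K = 1"
    using assms by (auto simp: unit_tangent_def surface_def quad_def riem_def)
  then show "K = 0 \<Longrightarrow> v0 = 0" "K = 0 \<Longrightarrow> p0 = 1"
    by (auto simp: square_eq_1_iff)
  then show "v0 * v0 + K * (v1 * v1 + v2 * v2) = K"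
    using 1 by (cases "K = 0") (auto simp: field_simps)
qed

lemma unit_tangent_uminus: "(p, v) \<in> unit_tangent K \<Longrightarrow> (p, - v) \<in> unit_tangent K"
  by (simp add: unit_tangent_def quad_linear riem_linear)

lemma geo_uminus: "geo K p (- v) t = geo K p v (- t)" "geo_vel K p (- v) t = - geo_vel K p v (- t)"
  by (simp_all add: geo_def geo_vel_def sinK_def cosK_def)

text \<open>
  The normal \<open>n\<close> with \<open>det3 p v n = 1\<close>: the cross product of \<open>p\<close> and \<open>v\<close> for the form \<open>quad K\<close>, scaled
  such that there is no division by \<open>K\<close>.
\<close>

definition nrm :: "real \<Rightarrow> pt \<Rightarrow> pt \<Rightarrow> pt" where
  "nrm K p v = (K * (fst (snd p) * snd (snd v) - snd (snd p) * fst (snd v)),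
     snd (snd p) * fst v - fst p * snd (snd v), fst p * fst (snd v) - fst (snd p) * fst v)"

lemma nrm:
  assumes "(p, v) \<in> unit_tangent K"
  shows "orthonormal_frame K p v (nrm K p v)" and "det3 p v (nrm K p v) = 1"
proof -
  obtain p0 p1 p2 v0 v1 v2 where [simp]: "p = (p0, p1, p2)" "v = (v0, v1, v2)"
    by (cases p, cases v) auto
  note uc = unit_tangent_coords[OF assms[simplified]]
  define a b c where abc: "a = p1 * v2 - p2 * v1" "b = p2 * v0 - p0 * v2" "c = p0 * v1 - p1 * v0"
  have n: "nrm K p v = (K * a, b, c)" by (simp add: nrm_def abc)
  \<comment> \<open>Lagrange's identity for the form \<open>quad K\<close>: \<open>K\<close> times
    the left side is the Gram determinant of \<open>p\<close> and \<open>v\<close>, which is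
    \<open>K\<close>. For \<open>K = 0\<close> the coordinates are explicit.\<close>
  have one: "K * (a * a) + b * b + c * c = 1"
  proof (cases "K = 0")
    case True
    then show ?thesis using uc unfolding abc by simp
  next
    case False
    have "K * (K * (a * a) + b * b + c * c) =
      (p0 * p0 + K * (p1 * p1 + p2 * p2)) * (v0 * v0 + K * (v1 * v1 + v2 * v2))
      - (p0 * v0 + K * (p1 * v1 + p2 * v2)) * (p0 * v0 + K * (p1 * v1 + p2 * v2))"
      unfolding abc by (simp add: algebra_simps)
    then show ?thesis using False uc(1-3) by simp
  qed
  have "quad K p (nrm K p v) = 0"
    unfolding n by (simp add: quad_def abc algebra_simps)
  moreover have "riem K (nrm K p v) (nrm K p v) = 1"
    unfolding n using one by (auto simp: riem_def algebra_simps)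
  moreover have "riem K v (nrm K p v) = 0"
    unfolding n using uc(5) by (cases "K = 0") (auto simp: riem_def abc field_simps)
  ultimately show "orthonormal_frame K p v (nrm K p v)"
    using assms unfolding orthonormal_frame_def unit_tangent_def by auto
  show "det3 p v (nrm K p v) = 1"
    unfolding n using one by (simp add: det3_Pair abc algebra_simps)
qed

text \<open>Cramer's rule for a basis of determinant \<open>1\<close>.\<close>

lemma frame_expansion:
  assumes "det3 q T N = 1"
  shows "x = det3 x T N *\<^sub>R q + det3 q x N *\<^sub>R T + det3 q T x *\<^sub>R N"
proof -
  obtain x0 x1 x2 q0 q1 q2 where xq: "x = (x0, x1, x2)" "q = (q0, q1, q2)"
    by (cases x, cases q) auto
  obtain t0 t1 t2 n0 n1 n2 where tn: "T = (t0, t1, t2)" "N = (n0, n1, n2)"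
    by (cases T, cases N) auto
  have "x = det3 q T N *\<^sub>R x" using assms by simp
  also have "\<dots> = det3 x T N *\<^sub>R q + det3 q x N *\<^sub>R T + det3 q T x *\<^sub>R N"
    unfolding xq tn by (simp add: det3_Pair algebra_simps)
  finally show ?thesis .
qed

lemma frame_facts:
  assumes "orthonormal_frame K q T N"
  shows "quad K q q = 1" "quad K q T = 0" "quad K q N = 0" "quad K T N = 0" "quad K T T = K" "quad K N N = K"
    "riem K T T = 1" "riem K N N = 1" "riem K T N = 0"
proof -
  have u: "(q, T) \<in> unit_tangent K" "(q, N) \<in> unit_tangent K" "riem K T N = 0"
    using assms by (auto simp: orthonormal_frame_def)
  then show 1: "quad K q q = 1" "quad K q T = 0" "quad K q N = 0" "riem K T T = 1" "riem K N N = 1" "riem K T N = 0"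
    by (auto simp: unit_tangent_def surface_def)
  have 0: "K = 0 \<Longrightarrow> fst T = 0" "K = 0 \<Longrightarrow> fst N = 0"
    using u unit_tangent_coords(5) by (metis prod.collapse)+
  show "quad K T N = 0" "quad K T T = K" "quad K N N = K"
    using 1 0 quad_eq_riem[of K] by (cases "K = 0"; simp add: quad_def)+
qed

lemma frame_quad:
  assumes "orthonormal_frame K q T N"
  shows "quad K (a *\<^sub>R q + b *\<^sub>R T + c *\<^sub>R N) (a' *\<^sub>R q + b' *\<^sub>R T + c' *\<^sub>R N) = a * a' + K * (b * b' + c * c')"
  using frame_facts[OF assms] quad_sym[of K T q] quad_sym[of K N q] quad_sym[of K N T]
  by (simp add: quad_linear algebra_simps)

lemma frame_riem:
  assumes "orthonormal_frame K q T N" "K = 0 \<Longrightarrow> a = 0 \<and> a' = 0"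
  shows "riem K (a *\<^sub>R q + b *\<^sub>R T + c *\<^sub>R N) (a' *\<^sub>R q + b' *\<^sub>R T + c' *\<^sub>R N) = a * a' / K + (b * b' + c * c')"
proof (cases "K = 0")
  case False
  then show ?thesis using frame_quad[OF assms(1), of a b c a' b' c'] quad_eq_riem[OF False]
    by (simp add: field_simps)
next
  case True
  then show ?thesis using frame_facts[OF assms(1)] assms(2) riem_sym[of 0 N T]
    by (simp add: riem_linear algebra_simps)
qed

section \<open>The generalized trigonometric functions\<close>

lemma sinK_0 [simp]: "sinK K 0 = 0" and cosK_0 [simp]: "cosK K 0 = 1"
  by (simp_all add: sinK_def cosK_def)

lemma sinK_minus [simp]: "sinK K (- t) = - sinK K t" and cosK_minus [simp]: "cosK K (- t) = cosK K t"
  by (simp_all add: sinK_def cosK_def)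

lemma sinK_add: "sinK K (s + t) = sinK K s * cosK K t + cosK K s * sinK K t"
  by (auto simp: sinK_def cosK_def distrib_left sin_add sinh_add add_divide_distrib)

lemma cosK_add: "cosK K (s + t) = cosK K s * cosK K t - K * (sinK K s * sinK K t)"
  by (auto simp: sinK_def cosK_def distrib_left cos_add cosh_add field_simps)

lemma sinK_diff: "sinK K (s - t) = sinK K s * cosK K t - cosK K s * sinK K t"
  using sinK_add[of K s "- t"] by simp

lemma cosK_diff: "cosK K (s - t) = cosK K s * cosK K t + K * (sinK K s * sinK K t)"
  using cosK_add[of K s "- t"] by simp

lemma sinK_pos:
  assumes "0 < t" "K > 0 \<Longrightarrow> t < pi / sqrt K"
  shows "sinK K t > 0"
proof -
  have "sin (sqrt K * t) > 0" if "K > 0"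
    using assms that by (intro sin_gt_zero) (auto simp: field_simps)
  then show ?thesis using assms by (auto simp: sinK_def)
qed

lemma half_period: "K > 0 \<Longrightarrow> sinK K (pi / sqrt K) = 0" "K > 0 \<Longrightarrow> cosK K (pi / sqrt K) = - 1"
  by (auto simp: sinK_def cosK_def)

lemma sinK_nonneg:
  assumes "0 \<le> t" "K > 0 \<Longrightarrow> t \<le> pi / sqrt K"
  shows "sinK K t \<ge> 0"
proof -
  consider "t = 0" | "K > 0" "t = pi / sqrt K" | "0 < t" "K > 0 \<Longrightarrow> t < pi / sqrt K"
    using assms by fastforce
  then show ?thesis
    by cases (use half_period(1) sinK_pos[of t K] in auto)
qed

lemma sinK_neg:
  assumes "K > 0" "pi / sqrt K < t" "t < 2 * pi / sqrt K"
  shows "sinK K t < 0"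
proof -
  have "2 * pi / sqrt K = pi / sqrt K + pi / sqrt K" by simp
  then have "sinK K (t - pi / sqrt K) > 0" using assms by (intro sinK_pos) linarith+
  then show ?thesis using half_period[OF assms(1)] by (simp add: sinK_diff)
qed

lemma sinK_eq_0:
  assumes "sinK K t = 0" "K > 0 \<Longrightarrow> \<bar>t\<bar> < pi / sqrt K"
  shows "t = 0"
proof (rule ccontr)
  assume "t \<noteq> 0"
  then consider "t > 0" | "- t > 0" by linarith
  then show False
  proof cases
    case 1
    then have "sinK K t > 0" using assms(2) by (intro sinK_pos) linarith+
    then show False using assms(1) by simp
  next
    case 2
    then have "sinK K (- t) > 0" using assms(2) by (intro sinK_pos) linarith+
    then show False using assms(1) by simp
  qed
qed

text \<open>The difference \<open>s - t\<close> has sine \<open>0\<close> and cosine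
  \<open>1\<close>. Below half a period this forces it to be \<open>0\<close>; at half a period the
  cosine is \<open>- 1\<close>, and between half and full period the sine is negative.\<close>

lemma cosK_sinK_eqD:
  assumes "cosK K s = cosK K t" "sinK K s = sinK K t" "K > 0 \<Longrightarrow> \<bar>s - t\<bar> < 2 * pi / sqrt K"
  shows "s = t"
proof -
  have 0: "sinK K (s - t) = 0" using assms(1,2) by (simp add: sinK_diff mult.commute)
  have 1: "cosK K (s - t) = 1" using assms(1,2) cosK_sinK[of K t] by (simp add: cosK_diff power2_eq_square)
  show ?thesis
  proof (cases "K > 0 \<and> \<bar>s - t\<bar> \<ge> pi / sqrt K")
    case False
    then have "s - t = 0" using sinK_eq_0[OF 0] by fastforce
    then show ?thesis by simp
  next
    case True
    then have K: "K > 0" and ge: "\<bar>s - t\<bar> \<ge> pi / sqrt K" by auto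
    have "\<bar>s - t\<bar> = s - t \<or> \<bar>s - t\<bar> = - (s - t)" by linarith
    then have a: "cosK K \<bar>s - t\<bar> = 1" "sinK K \<bar>s - t\<bar> = 0"
      using 0 1 cosK_minus[of K "s - t"] sinK_minus[of K "s - t"] by (metis neg_equal_0_iff_equal)+
    then have "\<not> pi / sqrt K < \<bar>s - t\<bar>" using sinK_neg[OF K, of "\<bar>s - t\<bar>"] assms(3)[OF K] by linarith
    then have "\<bar>s - t\<bar> = pi / sqrt K" using ge by linarith
    then show ?thesis using a half_period[OF K] by simp
  qed
qed

section \<open>Geodesics as plane sections\<close>

lemma geo_add: "geo K (geo K p v s) (geo_vel K p v s) t = geo K p v (s + t)"
  and geo_vel_add: "geo_vel K (geo K p v s) (geo_vel K p v s) t = geo_vel K p v (s + t)"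
  by (simp_all add: geo_def geo_vel_def cosK_add sinK_add algebra_simps)

lemma geo_0 [simp]: "geo K p v 0 = p" and geo_vel_0 [simp]: "geo_vel K p v 0 = v"
  by (simp_all add: geo_def geo_vel_def)

lemma unit_tangent_indep:
  assumes "(p, v) \<in> unit_tangent K" "a *\<^sub>R p + b *\<^sub>R v = c *\<^sub>R p + d *\<^sub>R v"
  shows "a = c" "b = d"
proof -
  let ?N = "nrm K p v"
  have "det3 (a *\<^sub>R p + b *\<^sub>R v) v ?N = det3 (c *\<^sub>R p + d *\<^sub>R v) v ?N"
    "det3 p (a *\<^sub>R p + b *\<^sub>R v) ?N = det3 p (c *\<^sub>R p + d *\<^sub>R v) ?N"
    using assms(2) by simp_all
  then show "a = c" "b = d" using nrm(2)[OF assms(1)] by (simp_all add: det3_linear)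
qed

lemma geo_inj:
  assumes "(p, v) \<in> unit_tangent K" "geo K p v s = geo K p v t" "K > 0 \<Longrightarrow> \<bar>s - t\<bar> < 2 * pi / sqrt K"
  shows "s = t"
  using cosK_sinK_eqD[of K s t] unit_tangent_indep[OF assms(1)] assms(2,3) unfolding geo_def by blast

text \<open>\<open>p\<close> and \<open>v\<close> are independent, so equal points have equal
  \<open>cosK\<close> and \<open>sinK\<close>, which determine the velocity too. Thus a closed great
  circle passes each of its points in a single direction.\<close>

lemma geo_eq_imp_vel_eq:
  assumes "(p, v) \<in> unit_tangent K" "geo K p v s = geo K p v t"
  shows "geo_vel K p v s = geo_vel K p v t"
  using unit_tangent_indep[OF assms(1)] assms(2) unfolding geo_def geo_vel_def by metis

lemma geo_in_surface: "(p, v) \<in> unit_tangent K \<Longrightarrow> geo K p v t \<in> surface K"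
  using geo_unit_tangent by (fastforce simp: unit_tangent_def)

lemma surface_uminus: "x \<in> surface K \<Longrightarrow> K \<le> 0 \<Longrightarrow> - x \<notin> surface K"
  by (auto simp: surface_def)

text \<open>Moving along the geodesic changes the basis of its plane by a matrix of determinant
  \<open>(cosK)\<^sup>2 + K (sinK)\<^sup>2 = 1\<close>.\<close>

lemma det3_geo: "det3 (geo K p v t) (geo_vel K p v t) x = det3 p v x"
  using arg_cong[OF cosK_sinK[of K t], of "\<lambda>c. c * det3 p v x"]
  by (simp add: geo_def geo_vel_def det3_linear det3_swap(1)[of v p] algebra_simps power2_eq_square)

text \<open>The inverse of \<open>t \<mapsto> (cosK K t, sinK K t)\<close> on \<open>(0, \<pi>/\<surd>K)\<close>, resp. \<open>(0, \<infinity>)\<close>.\<close>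

definition argK :: "real \<Rightarrow> real \<Rightarrow> real \<Rightarrow> real" where
  "argK K A S = (if K > 0 then arccos A / sqrt K else if K = 0 then S
     else arsinh (sqrt (- K) * S) / sqrt (- K))"

lemma argK:
  assumes "A\<^sup>2 + K * S\<^sup>2 = 1" "S > 0" "K \<le> 0 \<Longrightarrow> A > 0"
  shows "cosK K (argK K A S) = A" "sinK K (argK K A S) = S" "0 < argK K A S"
    "K > 0 \<Longrightarrow> argK K A S < pi / sqrt K"
proof -
  consider "K > 0" | "K = 0" | "K < 0" by linarith
  then have "cosK K (argK K A S) = A \<and> sinK K (argK K A S) = S \<and> 0 < argK K A S \<and>
    (K > 0 \<longrightarrow> argK K A S < pi / sqrt K)"
  proof cases
    case 1
    have "K * S\<^sup>2 > 0" using 1 assms(2) by simp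
    then have "A\<^sup>2 < 1" using assms(1) by linarith
    then have A: "- 1 < A" "A < 1" by (auto simp: power2_less_1_iff abs_less_iff)
    have b: "0 < arccos A" "arccos A < pi" using arccos_lt_bounded[OF A] by auto
    have "(sin (arccos A))\<^sup>2 = 1 - A\<^sup>2"
      using A by (simp add: sin_squared_eq)
    also have "\<dots> = (sqrt K * S)\<^sup>2" using 1 assms(1) by (simp add: power_mult_distrib)
    finally have "sin (arccos A) = sqrt K * S"
      by (rule power2_eq_imp_eq) (use b 1 assms(2) in \<open>auto intro: less_imp_le[OF sin_gt_zero]\<close>)
    moreover have "sqrt K * (arccos A / sqrt K) = arccos A" using 1 by simp
    ultimately show ?thesis using 1 A b
      by (simp add: cosK_def sinK_def argK_def divide_strict_right_mono)
  next
    case 2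
    then show ?thesis using assms by (auto simp: cosK_def sinK_def argK_def square_eq_1_iff power2_eq_square)
  next
    case 3
    have "(sqrt (- K) * S)\<^sup>2 = - K * S\<^sup>2" using 3 by (simp add: power_mult_distrib)
    then have "(cosh (arsinh (sqrt (- K) * S)))\<^sup>2 = A\<^sup>2"
      using assms(1) unfolding cosh_square_eq by simp
    then have "cosh (arsinh (sqrt (- K) * S)) = A"
      by (rule power2_eq_imp_eq) (use 3 assms(3) in auto)
    moreover have "sqrt (- K) * (arsinh (sqrt (- K) * S) / sqrt (- K)) = arsinh (sqrt (- K) * S)"
      using 3 by simp
    moreover have "arsinh (sqrt (- K) * S) > 0" using 3 assms(2) by simp
    ultimately show ?thesis using 3 assms(2) by (simp add: cosK_def sinK_def argK_def)
  qed
  then show "cosK K (argK K A S) = A" "sinK K (argK K A S) = S" "0 < argK K A S"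
    "K > 0 \<Longrightarrow> argK K A S < pi / sqrt K" by auto
qed

lemma cosK_sinK_surj:
  assumes "A\<^sup>2 + K * S\<^sup>2 = 1" "K \<le> 0 \<Longrightarrow> A > 0"
  shows "\<exists>t. cosK K t = A \<and> sinK K t = S"
proof -
  consider "S > 0" | "S < 0" | "S = 0" "A = 1" | "S = 0" "A = - 1" "K > 0"
  proof (cases "S = 0")
    case True
    then have "A = 1 \<or> A = - 1" using assms(1) by (simp add: power2_eq_1_iff)
    then show ?thesis using True assms(2) that by force
  qed (use that in linarith)
  then show ?thesis
  proof cases
    case 1
    then show ?thesis using argK[OF assms(1)] assms(2) by blast
  next
    case 2
    then show ?thesis using argK[of A K "- S"] assms
      by (intro exI[of _ "- argK K A (- S)"]) auto
  next
    case 3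
    then show ?thesis by (intro exI[of _ 0]) auto
  next
    case 4
    then show ?thesis using half_period by blast
  qed
qed

text \<open>The coefficients of \<open>x\<close> in the basis \<open>p\<close>, \<open>v\<close> lie
  on the conic parametrized by \<open>cosK\<close> and \<open>sinK\<close>. For
  \<open>K \<le> 0\<close> only one branch is parametrized: on the other one, \<open>- x\<close>
  would lie on the geodesic, hence on the surface together with \<open>x\<close>.\<close>

lemma geodesic_iff:
  assumes pv: "(p, v) \<in> unit_tangent K" and x: "x \<in> surface K"
  shows "x \<in> geodesic K p v \<longleftrightarrow> det3 p v x = 0"
proof
  assume "x \<in> geodesic K p v"
  then show "det3 p v x = 0" by (auto simp: geodesic_def geo_def det3_linear)
next
  assume 0: "det3 p v x = 0"
  define A where "A = det3 x v (nrm K p v)"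
  define B where "B = det3 p x (nrm K p v)"
  have xe: "x = A *\<^sub>R p + B *\<^sub>R v"
    using frame_expansion[OF nrm(2)[OF pv], of x] 0 by (simp add: A_def B_def)
  have AB: "A\<^sup>2 + K * B\<^sup>2 = 1"
    using frame_quad[OF nrm(1)[OF pv], of A B 0 A B 0] x
    by (simp add: xe[symmetric] surface_def power2_eq_square)
  have A0: "A > 0" if K: "K \<le> 0"
  proof (rule ccontr)
    assume "\<not> A > 0"
    moreover have "A \<noteq> 0"
    proof
      assume "A = 0"
      then have "K * B\<^sup>2 = 1" using AB by simp
      moreover have "K * B\<^sup>2 \<le> 0" using K by (simp add: mult_nonpos_nonneg)
      ultimately show False by simp
    qed
    ultimately obtain t where "cosK K t = - A" "sinK K t = - B"
      using cosK_sinK_surj[of "- A" K "- B"] AB by auto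
    then have "geo K p v t = - x" by (simp add: geo_def xe)
    then have "- x \<in> surface K" using geo_in_surface[OF pv] by metis
    then show False using surface_uminus[OF x K] by simp
  qed
  obtain t where "cosK K t = A" "sinK K t = B" using cosK_sinK_surj[OF AB A0] by blast
  then have "geo K p v t = x" by (simp add: geo_def xe)
  then show "x \<in> geodesic K p v" unfolding geodesic_def by blast
qed

lemma continuous_on_cosK [continuous_intros]: "continuous_on S f \<Longrightarrow> continuous_on S (\<lambda>x. cosK K (f x))"
  and continuous_on_sinK [continuous_intros]: "continuous_on S f \<Longrightarrow> continuous_on S (\<lambda>x. sinK K (f x))"
proof -
  have "continuous_on UNIV (cosK K)" "continuous_on UNIV (sinK K)"
    by (rule DERIV_continuous_on, rule cosK_deriv, rule DERIV_continuous_on, rule sinK_deriv)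
  then show "continuous_on S f \<Longrightarrow> continuous_on S (\<lambda>x. cosK K (f x))"
    "continuous_on S f \<Longrightarrow> continuous_on S (\<lambda>x. sinK K (f x))"
    by (auto intro: continuous_on_compose2)
qed

lemma continuous_on_geo [continuous_intros]:
  "continuous_on S p \<Longrightarrow> continuous_on S v \<Longrightarrow> continuous_on S f \<Longrightarrow> continuous_on S (\<lambda>x. geo K (p x) (v x) (f x))"
  and continuous_on_geo_vel [continuous_intros]:
  "continuous_on S p \<Longrightarrow> continuous_on S v \<Longrightarrow> continuous_on S f \<Longrightarrow> continuous_on S (\<lambda>x. geo_vel K (p x) (v x) (f x))"
  unfolding geo_def geo_vel_def by (intro continuous_intros; assumption)+

lemma frame_unit_tangent:
  assumes "orthonormal_frame K q T N"
  shows "(q, b *\<^sub>R T + c *\<^sub>R N) \<in> unit_tangent K \<longleftrightarrow> b\<^sup>2 + c\<^sup>2 = 1"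
  using assms frame_quad[OF assms, of 1 0 0 0 b c] frame_riem[OF assms, of 0 0 b c b c]
  by (auto simp: unit_tangent_def orthonormal_frame_def power2_eq_square)

lemma unit_tangent_components:
  assumes "orthonormal_frame K q T N" "det3 q T N = 1" "(q, u) \<in> unit_tangent K"
  shows "u = det3 q u N *\<^sub>R T + det3 q T u *\<^sub>R N" "(det3 q u N)\<^sup>2 + (det3 q T u)\<^sup>2 = 1"
    "riem K T u = det3 q u N" "riem K u N = det3 q T u"
proof -
  note e = frame_expansion[OF assms(2), of u]
  have "det3 u T N = quad K q u"
    using frame_quad[OF assms(1), of 1 0 0 "det3 u T N" "det3 q u N" "det3 q T u"] e by simp
  then have "det3 u T N = 0" using assms(3) by (simp add: unit_tangent_def)
  then show *: "u = det3 q u N *\<^sub>R T + det3 q T u *\<^sub>R N" using e by simp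
  then show "(det3 q u N)\<^sup>2 + (det3 q T u)\<^sup>2 = 1"
    using frame_unit_tangent[OF assms(1)] assms(3) by metis
  show "riem K T u = det3 q u N" "riem K u N = det3 q T u"
    using frame_riem[OF assms(1), of 0 0 1 0 "det3 q u N" "det3 q T u"]
      frame_riem[OF assms(1), of 0 0 "det3 q u N" "det3 q T u" 0 1] * by simp_all
qed

section \<open>Polar coordinates and distance\<close>

lemma unit_tangent_exists:
  assumes "q \<in> surface K"
  shows "\<exists>v. (q, v) \<in> unit_tangent K"
proof -
  obtain q0 q1 q2 where q: "q = (q0, q1, q2)" by (cases q) auto
  define m where "m = sqrt (q1\<^sup>2 + q2\<^sup>2)"
  \<comment> \<open>The position turned by a right angle in the last two coordinates. As its first
    coordinate is \<open>0\<close>, it is tangent and of unit length for every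
    \<open>K\<close>.\<close>
  define v :: pt where "v = (if q1 = 0 \<and> q2 = 0 then (0, 1, 0) else (0, - (q2 / m), q1 / m))"
  have "m * m = q1 * q1 + q2 * q2" by (simp add: m_def power2_eq_square)
  moreover have "q1 \<noteq> 0 \<or> q2 \<noteq> 0 \<Longrightarrow> m \<noteq> 0"
    by (simp add: m_def sum_power2_eq_zero_iff)
  moreover have "(q2 / m) * (q2 / m) + (q1 / m) * (q1 / m) = (q1 * q1 + q2 * q2) / (m * m)"
    by (simp add: add_divide_distrib)
  ultimately have "q1 \<noteq> 0 \<or> q2 \<noteq> 0 \<Longrightarrow> (q2 / m) * (q2 / m) + (q1 / m) * (q1 / m) = 1"
    by simp
  then have "(q, v) \<in> unit_tangent K"
    using assms by (auto simp: unit_tangent_def q v_def quad_def riem_def)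
  then show ?thesis ..
qed

text \<open>\<open>S\<close> is the length of the component of \<open>y\<close> tangent at
  \<open>q\<close>; where it vanishes, \<open>v\<close> is arbitrary.\<close>

lemma polar_form:
  assumes q: "q \<in> surface K" and y: "y \<in> surface K"
  obtains v S where "(q, v) \<in> unit_tangent K" "y = quad K q y *\<^sub>R q + S *\<^sub>R v" "S \<ge> 0"
    "(quad K q y)\<^sup>2 + K * S\<^sup>2 = 1"
proof -
  obtain T where T: "(q, T) \<in> unit_tangent K" using unit_tangent_exists[OF q] ..
  define N where "N = nrm K q T"
  note N = nrm[OF T, folded N_def]
  define A B C where ABC: "A = det3 y T N" "B = det3 q y N" "C = det3 q T y"
  define S where "S = sqrt (B\<^sup>2 + C\<^sup>2)"
  define v where "v = (if S = 0 then T else (B / S) *\<^sub>R T + (C / S) *\<^sub>R N)"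
  have e: "y = A *\<^sub>R q + B *\<^sub>R T + C *\<^sub>R N" unfolding ABC by (rule frame_expansion[OF N(2)])
  have Aq: "quad K q y = A"
    using frame_quad[OF N(1), of 1 0 0 A B C] e by simp
  have S2: "S\<^sup>2 = B\<^sup>2 + C\<^sup>2" by (simp add: S_def)
  have "A\<^sup>2 + K * S\<^sup>2 = quad K y y"
    using frame_quad[OF N(1), of A B C A B C] S2 by (simp add: e[symmetric] power2_eq_square)
  then have 1: "A\<^sup>2 + K * S\<^sup>2 = 1" using y by (simp add: surface_def)
  have v: "(q, v) \<in> unit_tangent K"
  proof (cases "S = 0")
    case False
    have "(B / S)\<^sup>2 + (C / S)\<^sup>2 = S\<^sup>2 / S\<^sup>2"
      by (simp only: power_divide add_divide_distrib[symmetric] S2[symmetric])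
    then have "(B / S)\<^sup>2 + (C / S)\<^sup>2 = 1" using False by simp
    then show ?thesis using False frame_unit_tangent[OF N(1)] by (simp add: v_def)
  qed (simp add: v_def T)
  have "y = A *\<^sub>R q + S *\<^sub>R v"
  proof (cases "S = 0")
    case True
    then have "B = 0" "C = 0" using S2 by (auto simp: sum_power2_eq_zero_iff)
    then show ?thesis using True e by simp
  next
    case False
    then show ?thesis using e by (simp add: v_def scaleR_add_right add.assoc)
  qed
  moreover have "S \<ge> 0" by (simp add: S_def)
  ultimately show thesis using that[OF v, of S] 1 Aq by simp
qed

text \<open>Otherwise \<open>- y\<close> would be a point of a geodesic through \<open>q\<close>,
  hence of the surface, which contains only one sheet.\<close>

lemma quad_pos:
  assumes q: "q \<in> surface K" and y: "y \<in> surface K" and K: "K \<le> 0"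
  shows "quad K q y > 0"
proof (rule ccontr)
  assume neg: "\<not> quad K q y > 0"
  obtain v S where v: "(q, v) \<in> unit_tangent K" "y = quad K q y *\<^sub>R q + S *\<^sub>R v" "S \<ge> 0"
    "(quad K q y)\<^sup>2 + K * S\<^sup>2 = 1" by (rule polar_form[OF q y])
  have "K * S\<^sup>2 \<le> 0" using K by (simp add: mult_nonpos_nonneg)
  then have "quad K q y \<noteq> 0" using v(4) by auto
  then obtain t where "cosK K t = - quad K q y" "sinK K t = - S"
    using cosK_sinK_surj[of "- quad K q y" K "- S"] v(4) neg by auto
  then have "geo K q v t = - (quad K q y *\<^sub>R q + S *\<^sub>R v)" by (simp add: geo_def)
  then have "geo K q v t = - y" using v(2) by simp
  then show False using geo_in_surface[OF v(1), of t] surface_uminus[OF y K] by simp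
qed

lemma polar:
  assumes q: "q \<in> surface K" and y: "y \<in> surface K" and "y \<noteq> q" "y \<noteq> - q"
  obtains v r where "(q, v) \<in> unit_tangent K" "y = geo K q v r" "0 < r" "K > 0 \<Longrightarrow> r < pi / sqrt K"
proof -
  obtain v S where v: "(q, v) \<in> unit_tangent K" "y = quad K q y *\<^sub>R q + S *\<^sub>R v" "S \<ge> 0"
    "(quad K q y)\<^sup>2 + K * S\<^sup>2 = 1" by (rule polar_form[OF q y])
  have "S \<noteq> 0"
  proof
    assume S: "S = 0"
    then consider "quad K q y = 1" | "quad K q y = - 1" using v(4) by (auto simp: power2_eq_1_iff)
    then show False
      by cases (use v(2) S assms(3,4) in \<open>metis (no_types) add.right_neutral scaleR_one scaleR_zero_left scaleR_minus1_left\<close>)+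
  qed
  then have S: "S > 0" using v(3) by simp
  note a = argK[OF v(4) S quad_pos[OF q y]]
  show thesis
    by (rule that[OF v(1), of "argK K (quad K q y) S"]) (use a v(2) in \<open>auto simp: geo_def\<close>)
qed

text \<open>The infimum runs over a set which contains a suitable length: \<open>0\<close> for
  \<open>q\<close> itself, half a period for its antipode, the polar distance otherwise.\<close>

lemma surface_dist_bounds:
  assumes q: "q \<in> surface K" and y: "y \<in> surface K"
  shows "surface_dist K q y \<ge> 0" "K > 0 \<Longrightarrow> surface_dist K q y \<le> pi / sqrt K"
proof -
  let ?X = "{t. 0 \<le> t \<and> (\<exists>v. (q, v) \<in> unit_tangent K \<and> geo K q v t = y)}"
  have ex: "\<exists>t\<in>?X. K > 0 \<longrightarrow> t \<le> pi / sqrt K"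
  proof -
    obtain T where T: "(q, T) \<in> unit_tangent K" using unit_tangent_exists[OF q] ..
    consider "y = q" | "y = - q" "K > 0" | "y \<noteq> q" "y \<noteq> - q"
      using surface_uminus[OF q] y by force
    then show ?thesis
    proof cases
      case 1
      then show ?thesis by (intro bexI[of _ 0]) (auto intro!: exI[of _ T] simp del: split_paired_Ex simp: T)
    next
      case 2
      then have "geo K q T (pi / sqrt K) = y" by (simp add: geo_def half_period)
      then show ?thesis using 2 by (intro bexI[of _ "pi / sqrt K"]) (auto intro!: exI[of _ T] simp del: split_paired_Ex simp: T)
    next
      case 3
      then obtain v r where "(q, v) \<in> unit_tangent K" "y = geo K q v r" "0 < r" "K > 0 \<Longrightarrow> r < pi / sqrt K"
        using polar[OF q y] by metis
      then show ?thesis by (intro bexI[of _ r]) (auto intro!: exI[of _ v] simp del: split_paired_Ex)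
    qed
  qed
  then have "?X \<noteq> {}" by blast
  then show "surface_dist K q y \<ge> 0"
    unfolding surface_dist_def by (intro cInf_greatest) auto
  show "surface_dist K q y \<le> pi / sqrt K" if "K > 0"
  proof -
    from ex obtain t where t0: "t \<in> ?X" "K > 0 \<longrightarrow> t \<le> pi / sqrt K" by (rule bexE)
    then have t: "t \<le> pi / sqrt K" using that by simp
    have "bdd_below ?X" by (rule bdd_belowI[of _ 0]) simp
    then have "Inf ?X \<le> t" by (rule cInf_lower[OF t0(1)])
    then show ?thesis using t unfolding surface_dist_def by linarith
  qed
qed

text \<open>Below half a period this makes an intermediate point a nonnegative combination of the
  two ends, so a linear functional which is nonnegative at the ends stays so in between.\<close>

lemma geo_between:
  "sinK K r *\<^sub>R geo K p v t = sinK K (r - t) *\<^sub>R p + sinK K t *\<^sub>R geo K p v r"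
  by (simp add: geo_def sinK_diff algebra_simps)

text \<open>A linear functional which vanishes at \<open>p\<close> takes on
  \<open>geo K p v \<tau>\<close> the sign of its value on \<open>v\<close>, so that first-order
  conditions are read off at a single nearby point.\<close>

lemma small_step:
  fixes \<delta> :: real
  assumes "\<delta> > 0"
  obtains \<tau> where "0 < \<tau>" "\<tau> < \<delta>" "sinK K \<tau> > 0"
proof (cases "K > 0")
  case True
  define h where "h = pi / sqrt K"
  have "h > 0" using True by (simp add: h_def)
  then show ?thesis using that[of "min (\<delta> / 2) (h / 2)"] assms sinK_pos[of "min (\<delta> / 2) (h / 2)" K]
    by (simp add: h_def[symmetric] min_def split: if_splits)
next
  case False
  then show ?thesis using that[of "\<delta> / 2"] assms sinK_pos[of "\<delta> / 2" K] by simp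
qed

text \<open>By central projection, geodesic convexity becomes convexity of the cone over \<open>D\<close>.\<close>

lemma geodesically_convex_comb:
  assumes conv: "geodesically_convex K D" and D: "D \<subseteq> surface K" and p: "p \<in> D" and q: "q \<in> D"
    and a: "a \<ge> 0" and b: "b \<ge> 0"
  shows "\<exists>c x. c \<ge> 0 \<and> x \<in> D \<and> a *\<^sub>R p + b *\<^sub>R q = c *\<^sub>R x"
proof -
  define d where "d = surface_dist K p q"
  have pq: "p \<in> surface K" "q \<in> surface K" using p q D by auto
  obtain v where v: "(p, v) \<in> unit_tangent K" and gq: "geo K p v d = q" and seg: "geo K p v ` {0..d} \<subseteq> D"
    using conv p q unfolding geodesically_convex_def d_def by blast
  note d = surface_dist_bounds[OF pq, folded d_def]
  consider "a = 0" | "b = 0" | "d = 0" | "K > 0" "d = pi / sqrt K" | "a > 0" "b > 0" "d > 0" "K > 0 \<Longrightarrow> d < pi / sqrt K"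
    using d a b by fastforce
  then show ?thesis
  proof cases
    case 1
    then show ?thesis using b q by (intro exI[of _ b] exI[of _ q]) simp
  next
    case 2
    then show ?thesis using a p by (intro exI[of _ a] exI[of _ p]) simp
  next
    case 3
    then have "q = p" using gq by simp
    then show ?thesis using a b p by (intro exI[of _ "a + b"] exI[of _ p]) (simp add: scaleR_add_left)
  next
    case 4
    \<comment> \<open>For antipodal ends the combination is a multiple of the end with the larger
      coefficient.\<close>
    then have "q = - p" using gq by (simp add: geo_def half_period)
    then have e: "a *\<^sub>R p + b *\<^sub>R q = (a - b) *\<^sub>R p" "a *\<^sub>R p + b *\<^sub>R q = (b - a) *\<^sub>R q"
      by (simp_all add: algebra_simps)
    show ?thesis
    proof (cases "a \<ge> b")
      case True
      then show ?thesis using e(1) p by (intro exI[of _ "a - b"] exI[of _ p]) simp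
    next
      case False
      then show ?thesis using e(2) q by (intro exI[of _ "b - a"] exI[of _ q]) simp
    qed
  next
    case 5
    have sd: "sinK K d > 0" using sinK_pos 5 by blast
    have cd: "(cosK K d)\<^sup>2 + K * (sinK K d)\<^sup>2 = 1" by (rule cosK_sinK)
    \<comment> \<open>The coordinates of \<open>a p + b q\<close> in the basis \<open>p\<close>,
      \<open>v\<close>. Division by \<open>R\<close> moves the vector onto the surface, and
      \<open>t\<close> is the resulting arclength from \<open>p\<close>.\<close>
    define X Y where XY: "X = a + b * cosK K d" "Y = b * sinK K d"
    have Y: "Y > 0" using sd 5 by (simp add: XY)
    have c1: "cosK K d > - 1"
    proof (cases "K > 0")
      case True
      then have "(cosK K d)\<^sup>2 < 1" using cd sd mult_pos_pos[OF True zero_less_power[OF sd, of 2]] by linarith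
      then show ?thesis by (simp add: abs_square_less_1)
    next
      case False
      then show ?thesis using cosK_pos[of K d] by simp
    qed
    have eq: "X\<^sup>2 + K * Y\<^sup>2 = (a - b)\<^sup>2 + 2 * (a * b) * (1 + cosK K d)"
    proof -
      have "X\<^sup>2 + K * Y\<^sup>2 = a\<^sup>2 + 2 * (a * b) * cosK K d + b\<^sup>2 * ((cosK K d)\<^sup>2 + K * (sinK K d)\<^sup>2)"
        by (simp add: XY power2_eq_square algebra_simps)
      then show ?thesis unfolding cd by (simp add: power2_eq_square algebra_simps)
    qed
    moreover have "2 * (a * b) * (1 + cosK K d) > 0" using 5 c1 by simp
    ultimately have pos: "X\<^sup>2 + K * Y\<^sup>2 > 0" by (metis add_nonneg_pos zero_le_power2)
    define R where "R = sqrt (X\<^sup>2 + K * Y\<^sup>2)"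
    have R: "R > 0" "R\<^sup>2 = X\<^sup>2 + K * Y\<^sup>2" using pos by (auto simp: R_def)
    have "(X / R)\<^sup>2 + K * (Y / R)\<^sup>2 = (X\<^sup>2 + K * Y\<^sup>2) / R\<^sup>2"
      by (simp add: power_divide add_divide_distrib)
    then have 1: "(X / R)\<^sup>2 + K * (Y / R)\<^sup>2 = 1" using R pos by simp
    define t where "t = argK K (X / R) (Y / R)"
    have Xp: "K \<le> 0 \<Longrightarrow> X > 0" using 5 cosK_pos[of K d] by (simp add: XY add_pos_pos)
    have t: "cosK K t = X / R" "sinK K t = Y / R" "0 < t" "K > 0 \<Longrightarrow> t < pi / sqrt K"
      using argK[OF 1] Y R(1) Xp unfolding t_def by auto
    \<comment> \<open>The coefficient of \<open>p\<close> is positive, which means that the point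
      does not lie beyond \<open>q\<close>.\<close>
    have "sinK K (d - t) = a * sinK K d / R"
      unfolding sinK_diff t(1,2) by (simp add: XY algebra_simps add_divide_distrib)
    then have sdt: "sinK K (d - t) > 0" using sd 5 R(1) by simp
    have "t \<le> d"
    proof (rule ccontr)
      assume "\<not> t \<le> d"
      then have "sinK K (t - d) > 0" using 5 t by (intro sinK_pos) force+
      then show False using sdt sinK_minus[of K "d - t"] by simp
    qed
    then have "geo K p v t \<in> D" using seg t(3) by auto
    moreover have "R *\<^sub>R geo K p v t = a *\<^sub>R p + b *\<^sub>R q"
    proof -
      have "R *\<^sub>R geo K p v t = X *\<^sub>R p + Y *\<^sub>R v"
        using R(1) by (simp add: geo_def t scaleR_add_right)
      also have "\<dots> = a *\<^sub>R p + b *\<^sub>R geo K p v d"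
        by (simp add: XY geo_def algebra_simps)
      finally show ?thesis using gq by simp
    qed
    ultimately show ?thesis using R(1) by (metis less_imp_le)
  qed
qed

declare split_paired_Ex [simp del] split_paired_All [simp del]

section \<open>A convex polygon as an intersection of half planes\<close>

locale polygon_domain =
  fixes K :: real and D :: "pt set" and n :: nat and P V :: "nat \<Rightarrow> pt" and L :: "nat \<Rightarrow> real"
  assumes dom: "convex_compact_domain K D"
    and poly: "geodesic_polygon K n P V L"
    and bd: "bdry K D = (\<Union>i<n. edge K P V L i)"
begin

abbreviation E :: "nat \<Rightarrow> real \<Rightarrow> pt" where "E i \<equiv> geo K (P i) (V i)"
abbreviation E' :: "nat \<Rightarrow> real \<Rightarrow> pt" where "E' i \<equiv> geo_vel K (P i) (V i)"

text \<open>A linear functional whose kernel is the plane of edge \<open>i\<close>; its sign tells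
  the side of the edge.\<close>

definition g :: "nat \<Rightarrow> pt \<Rightarrow> real" where "g i x = det3 (P i) (V i) x"

lemma n_pos: "0 < n"
  and vertex_unit_tangent: "i < n \<Longrightarrow> (P i, V i) \<in> unit_tangent K"
  and L_pos: "i < n \<Longrightarrow> 0 < L i"
  and next_vertex: "i < n \<Longrightarrow> E i (L i) = P (Suc i mod n)"
  and turning: "i < n \<Longrightarrow> E' i (L i) \<noteq> V (Suc i mod n)"
  and simple: "\<lbrakk>i < n; j < n; 0 \<le> s; s < L i; 0 \<le> t; t < L j; E i s = E j t\<rbrakk> \<Longrightarrow> i = j \<and> s = t"
proof -
  have 1: "0 < n" and 2: "\<forall>i<n. (P i, V i) \<in> unit_tangent K \<and> 0 < L i \<and>
      geo K (P i) (V i) (L i) = P (Suc i mod n) \<and> geo_vel K (P i) (V i) (L i) \<noteq> V (Suc i mod n)"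
    and 3: "\<forall>i<n. \<forall>j<n. \<forall>s\<in>{0..<L i}. \<forall>t\<in>{0..<L j}.
      geo K (P i) (V i) s = geo K (P j) (V j) t \<longrightarrow> i = j \<and> s = t"
    using poly unfolding geodesic_polygon_def by blast+
  show "0 < n" by (rule 1)
  show "i < n \<Longrightarrow> (P i, V i) \<in> unit_tangent K" "i < n \<Longrightarrow> 0 < L i" "i < n \<Longrightarrow> E i (L i) = P (Suc i mod n)"
    "i < n \<Longrightarrow> E' i (L i) \<noteq> V (Suc i mod n)"
    using 2 by simp_all
  show "i = j \<and> s = t" if "i < n" "j < n" "0 \<le> s" "s < L i" "0 \<le> t" "t < L j" "E i s = E j t"
    by (rule 3[rule_format]) (use that in simp_all)
qed

lemma D_surface: "D \<subseteq> surface K" and D_compact: "compact D" and D_conv: "geodesically_convex K D"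
  using dom by (auto simp: convex_compact_domain_def)

lemma E_surface: "i < n \<Longrightarrow> E i t \<in> surface K"
  using vertex_unit_tangent geo_in_surface by blast

lemma bdry_subset: "bdry K D \<subseteq> D"
proof -
  have "closedin (top_of_set (surface K)) D"
    using D_surface D_compact by (simp add: closed_subset compact_imp_closed)
  then show ?thesis unfolding bdry_def by (rule frontier_of_subset_closedin)
qed

lemma edge_in_bdry: "i < n \<Longrightarrow> 0 \<le> t \<Longrightarrow> t \<le> L i \<Longrightarrow> E i t \<in> bdry K D"
  unfolding bd edge_def by force

lemma edge_in_D: "i < n \<Longrightarrow> 0 \<le> t \<Longrightarrow> t \<le> L i \<Longrightarrow> E i t \<in> D"
  using edge_in_bdry bdry_subset by blast

lemma g_geo: "g i (geo K p v t) = cosK K t * g i p + sinK K t * g i v"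
  by (simp add: g_def geo_def det3_linear)

lemma g_E: "g i (E i t) = 0" "g i (E' i t) = 0"
  by (simp_all add: g_def geo_def geo_vel_def det3_linear)

lemma continuous_on_g [continuous_intros]: "continuous_on X f \<Longrightarrow> continuous_on X (\<lambda>x. g i (f x))"
  unfolding g_def by (intro continuous_intros)

lemma g_scale: "g i (c *\<^sub>R x) = c * g i x" "g i (- x) = - g i x" "g i (x + y) = g i x + g i y"
  by (simp_all add: g_def det3_linear)

lemma g_det: "g i x = det3 (E i t) (E' i t) x"
  by (simp add: g_def det3_geo)

definition cone :: "pt set" where "cone = {c *\<^sub>R x | c x. 0 \<le> c \<and> x \<in> D}"

lemma coneI: "0 \<le> c \<Longrightarrow> x \<in> D \<Longrightarrow> c *\<^sub>R x \<in> cone"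
  unfolding cone_def by blast

lemma convex_cone: "convex cone"
proof (rule convexI)
  fix x y and u v :: real assume x: "x \<in> cone" and y: "y \<in> cone" and uv: "0 \<le> u" "0 \<le> v"
  obtain a p where x': "a \<ge> 0" "p \<in> D" "x = a *\<^sub>R p" using x unfolding cone_def by blast
  obtain b q where y': "b \<ge> 0" "q \<in> D" "y = b *\<^sub>R q" using y unfolding cone_def by blast
  have "u * a \<ge> 0" "v * b \<ge> 0" using uv x'(1) y'(1) by simp_all
  from geodesically_convex_comb[OF D_conv D_surface x'(2) y'(2) this]
  obtain c z where "c \<ge> 0" "z \<in> D" "(u * a) *\<^sub>R p + (v * b) *\<^sub>R q = c *\<^sub>R z" by metis
  then show "u *\<^sub>R x + v *\<^sub>R y \<in> cone" using coneI[of c z] x'(3) y'(3) by simp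
qed

lemma cone_Int_surface: "cone \<inter> surface K \<subseteq> D"
proof
  fix y assume y: "y \<in> cone \<inter> surface K"
  then obtain c x where c: "0 \<le> c" "x \<in> D" "y = c *\<^sub>R x" unfolding cone_def by blast
  then have "quad K x x = 1" "quad K y y = 1" using y D_surface by (auto simp: surface_def)
  then have "c * c = 1" using c by (simp add: quad_linear)
  then have "c = 1" using c(1) by (simp add: square_eq_1_iff)
  then show "y \<in> D" using c by simp
qed

section \<open>Supporting planes along the boundary\<close>

lemma bdry_not_interior: "q \<in> bdry K D \<Longrightarrow> q \<notin> interior cone"
proof
  assume q: "q \<in> bdry K D" "q \<in> interior cone"
  have "openin (top_of_set (surface K)) (interior cone \<inter> surface K)"
    by (metis Int_commute open_interior openin_open_Int)
  moreover have "interior cone \<inter> surface K \<subseteq> D"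
    using cone_Int_surface interior_subset by blast
  ultimately have "interior cone \<inter> surface K \<subseteq> (top_of_set (surface K)) interior_of D"
    by (rule interior_of_maximal[rotated])
  then have "q \<in> (top_of_set (surface K)) interior_of D"
    using q bdry_subset D_surface by blast
  then show False using q(1) by (simp add: bdry_def frontier_of_def)
qed

text \<open>A boundary point is not interior to the convex cone, so some plane supports the cone
  there; a cone without interior lies in a plane, which serves for every point.\<close>

lemma supporting_functional:
  assumes q: "q \<in> bdry K D"
  obtains a where "a \<noteq> 0" "a \<bullet> q = 0" "\<And>y. y \<in> D \<Longrightarrow> a \<bullet> y \<ge> 0"
proof -
  have sub: "D \<subseteq> cone" using coneI[of 1] by auto
  have qD: "q \<in> D" using q bdry_subset by blast
  show thesis
  proof (cases "interior cone = {}")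
    case True
    obtain a b where a: "a \<noteq> 0" "cone \<subseteq> {x. a \<bullet> x = b}"
      by (rule empty_interior_subset_hyperplane[OF convex_cone True])
    have "0 \<in> cone" using coneI[of 0, OF _ qD] by simp
    then have "b = 0" using a(2) by auto
    then show ?thesis using a sub qD by (intro that[of a]) auto
  next
    case False
    then have "rel_interior cone = interior cone" by (simp add: interior_rel_interior_gen rel_interior_nonempty_interior)
    then have "q \<notin> rel_interior cone" using bdry_not_interior[OF q] by simp
    then obtain a where a: "a \<noteq> 0" "\<And>y. y \<in> cone \<Longrightarrow> a \<bullet> q \<le> a \<bullet> y"
      using supporting_hyperplane_rel_boundary[OF convex_cone, of q] sub qD by (metis subsetD)
    \<comment> \<open>The cone contains the whole ray of \<open>q\<close>; comparison with
      \<open>0\<close> and \<open>2 q\<close> puts \<open>q\<close> on the plane.\<close>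
    have "0 \<in> cone" "2 *\<^sub>R q \<in> cone" using coneI[of 0, OF _ qD] coneI[of 2, OF _ qD] by simp_all
    then have "a \<bullet> q = 0" using a(2)[of 0] a(2)[of "2 *\<^sub>R q"] by simp
    have "a \<bullet> y \<ge> 0" if "y \<in> D" for y using a(2)[of y] sub that \<open>a \<bullet> q = 0\<close> by auto
    then show ?thesis using a(1) \<open>a \<bullet> q = 0\<close> by (intro that[of a])
  qed
qed

text \<open>A functional supporting the cone at the midpoint of the edge is nonnegative along the
  edge on both sides, so it vanishes on the edge direction as well. Its kernel is then the plane of
  the edge, and it is a multiple of \<open>g i\<close>.\<close>

lemma edge_supporting:
  assumes i: "i < n"
  obtains e where "e \<in> {1, - 1}" "\<And>x. x \<in> D \<Longrightarrow> e * g i x \<ge> 0"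
proof -
  define m where "m = L i / 2"
  have m: "0 < m" "m < L i" using L_pos[OF i] by (auto simp: m_def)
  obtain \<tau> where \<tau>: "0 < \<tau>" "\<tau> < m" "sinK K \<tau> > 0" by (rule small_step[OF m(1)])
  obtain a where a: "a \<noteq> 0" "a \<bullet> E i m = 0" "\<And>y. y \<in> D \<Longrightarrow> a \<bullet> y \<ge> 0"
    using supporting_functional[OF edge_in_bdry[OF i, of m]] m by auto
  define T where "T = E' i m"
  define N where "N = nrm K (E i m) T"
  have ut: "(E i m, T) \<in> unit_tangent K" unfolding T_def by (rule geo_unit_tangent[OF vertex_unit_tangent[OF i]])
  have sh: "E i (m + t) = cosK K t *\<^sub>R E i m + sinK K t *\<^sub>R T" for t
    using geo_add[of K "P i" "V i" m t] unfolding T_def by (simp add: geo_def)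
  have "a \<bullet> E i (m + t) = sinK K t * (a \<bullet> T)" for t
    unfolding sh using a(2) by (simp add: inner_add_right)
  moreover have "E i (m + \<tau>) \<in> D" "E i (m + - \<tau>) \<in> D"
    using \<tau>(1,2) m by (auto intro!: edge_in_D[OF i] simp: m_def)
  ultimately have "sinK K \<tau> * (a \<bullet> T) \<ge> 0" "- (sinK K \<tau> * (a \<bullet> T)) \<ge> 0"
    using a(3)[of "E i (m + \<tau>)"] a(3)[of "E i (m + - \<tau>)"] by (simp_all del: add_uminus_conv_diff)
  then have "sinK K \<tau> * (a \<bullet> T) = 0" by linarith
  then have aT: "a \<bullet> T = 0" using \<tau>(3) by simp
  have ax: "a \<bullet> x = g i x * (a \<bullet> N)" for x
  proof -
    have "a \<bullet> x = a \<bullet> (det3 x T N *\<^sub>R E i m + det3 (E i m) x N *\<^sub>R T + det3 (E i m) T x *\<^sub>R N)"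
      using frame_expansion[OF nrm(2)[OF ut, folded N_def], of x] by simp
    also have "det3 (E i m) T x = g i x" unfolding T_def by (rule g_det[symmetric])
    also have "a \<bullet> (det3 x T N *\<^sub>R E i m + det3 (E i m) x N *\<^sub>R T + g i x *\<^sub>R N) = g i x * (a \<bullet> N)"
      by (simp only: inner_add_right inner_scaleR_right a(2) aT mult_zero_right add_0)
    finally show ?thesis .
  qed
  have "a \<bullet> N \<noteq> 0" using ax[of a] a(1) by auto
  have D0: "g i x * (a \<bullet> N) \<ge> 0" if "x \<in> D" for x using a(3)[OF that] ax[of x] by simp
  from \<open>a \<bullet> N \<noteq> 0\<close> consider "a \<bullet> N > 0" | "a \<bullet> N < 0" by linarith
  then show thesis
  proof cases
    case 1
    then show ?thesis using D0
      by (intro that[of 1]) (auto simp: zero_le_mult_iff)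
  next
    case 2
    then show ?thesis using D0
      by (intro that[of "- 1"]) (auto simp: zero_le_mult_iff)
  qed
qed

text \<open>At an interior zero, \<open>g i\<close> could not change sign along any geodesic through
  the point, so it would vanish on all tangent vectors there and hence identically.\<close>

lemma interior_g_nonzero:
  assumes i: "i < n" and z: "z \<in> (top_of_set (surface K)) interior_of D"
  shows "g i z \<noteq> 0"
proof
  assume 0: "g i z = 0"
  obtain e where e: "e \<in> {1, - 1}" "\<And>x. x \<in> D \<Longrightarrow> e * g i x \<ge> 0"
    by (rule edge_supporting[OF i]) blast
  obtain W where W: "open W" "z \<in> W" "W \<inter> surface K \<subseteq> D"
    using z unfolding interior_of_def by (auto simp: openin_open)
  have zs: "z \<in> surface K" using z interior_of_subset D_surface by fastforce
  have gu: "g i u = 0" if u: "(z, u) \<in> unit_tangent K" for u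
  proof -
    have "continuous_on UNIV (geo K z u)"
      using continuous_on_geo[OF continuous_on_const continuous_on_const continuous_on_id] by simp
    then have "open (geo K z u -` W)" using W(1) by (simp add: open_vimage)
    moreover have "0 \<in> geo K z u -` W" using W(2) by simp
    ultimately obtain \<delta> where \<delta>: "\<delta> > 0" "\<And>t. \<bar>t\<bar> < \<delta> \<Longrightarrow> geo K z u t \<in> W"
      unfolding open_dist by (metis dist_real_def diff_zero vimage_eq)
    obtain \<tau> where \<tau>: "0 < \<tau>" "\<tau> < \<delta>" "sinK K \<tau> > 0" by (rule small_step[OF \<delta>(1)])
    have "geo K z u \<tau> \<in> D" "geo K z u (- \<tau>) \<in> D"
      using \<tau> \<delta>(2)[of \<tau>] \<delta>(2)[of "- \<tau>"] W(3) geo_in_surface[OF u] by auto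
    then have "e * (sinK K \<tau> * g i u) \<ge> 0" "e * (- sinK K \<tau> * g i u) \<ge> 0"
      using e(2)[of "geo K z u \<tau>"] e(2)[of "geo K z u (- \<tau>)"] 0 by (simp_all add: g_geo)
    then have "sinK K \<tau> * g i u = 0" using e(1) by auto
    then show ?thesis using \<tau>(3) by auto
  qed
  obtain T where T: "(z, T) \<in> unit_tangent K" using unit_tangent_exists[OF zs] ..
  have N: "(z, nrm K z T) \<in> unit_tangent K" using nrm(1)[OF T] by (simp add: orthonormal_frame_def)
  have "g i x = 0" for x
  proof -
    have "g i x = g i (det3 x T (nrm K z T) *\<^sub>R z + det3 z x (nrm K z T) *\<^sub>R T + det3 z T x *\<^sub>R nrm K z T)"
      using frame_expansion[OF nrm(2)[OF T], of x] by simp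
    then show ?thesis using gu[OF T] gu[OF N] 0 by (simp only: g_scale)
  qed
  moreover have "g i (nrm K (P i) (V i)) = 1" using nrm(2)[OF vertex_unit_tangent[OF i]] by (simp add: g_def)
  ultimately show False by simp
qed

lemma interior_nonempty: "(top_of_set (surface K)) interior_of D \<noteq> {}"
  using dom unfolding convex_compact_domain_def by (metis closure_of_empty)

end

lemma unit_tangent_parallel:
  assumes "(p, v) \<in> unit_tangent K" "(p, u) \<in> unit_tangent K" "det3 p v u = 0"
  shows "u = v \<or> u = - v"
proof -
  note c = unit_tangent_components[OF nrm[OF assms(1)] assms(2)]
  have "(det3 p u (nrm K p v))\<^sup>2 = 1" using c(2) assms(3) by simp
  then consider "det3 p u (nrm K p v) = 1" | "det3 p u (nrm K p v) = - 1" by (auto simp: power2_eq_1_iff)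
  then show ?thesis by cases (use c(1) assms(3) in simp_all)
qed

context polygon_domain
begin

section \<open>Orientation of the boundary\<close>

lemma next_less [simp]: "Suc i mod n < n"
  using n_pos by simp

lemma next_unit_tangent: "i < n \<Longrightarrow> (P (Suc i mod n), E' i (L i)) \<in> unit_tangent K"
  using geo_unit_tangent[OF vertex_unit_tangent, of i "L i"] next_vertex by simp

lemma g_next: "i < n \<Longrightarrow> g i x = det3 (P (Suc i mod n)) (E' i (L i)) x"
  using g_det[of i x "L i"] next_vertex by simp

lemma edge_end:
  assumes "i < n"
  shows "E i (L i - t) = cosK K t *\<^sub>R P (Suc i mod n) - sinK K t *\<^sub>R E' i (L i)"
  using geo_add[of K "P i" "V i" "L i" "- t"] next_vertex[OF assms] by (simp add: geo_def)

text \<open>Equal directions are excluded by the maximality of the edges, opposite ones because the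
  next edge would run back along this one, against simplicity.\<close>

lemma turn_nonzero:
  assumes i: "i < n"
  shows "det3 (P (Suc i mod n)) (E' i (L i)) (V (Suc i mod n)) \<noteq> 0"
proof
  let ?j = "Suc i mod n"
  assume "det3 (P ?j) (E' i (L i)) (V ?j) = 0"
  then have "V ?j = - E' i (L i)"
    using unit_tangent_parallel[OF next_unit_tangent[OF i] vertex_unit_tangent] turning[OF i] by simp
  then have e: "E ?j t = E i (L i - t)" for t
    unfolding edge_end[OF i] by (simp add: geo_def)
  \<comment> \<open>A third, so that \<open>t\<close> differs from \<open>L i - t\<close>; this
    refutes the case \<open>?j = i\<close> of a single edge, too.\<close>
  define t where "t = min (L i) (L ?j) / 3"
  have t: "0 < t" "t < L i" "t < L ?j" "t < L i - t"
    using L_pos[OF i] L_pos[of ?j] by (auto simp: t_def min_def)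
  have "?j = i \<and> t = L i - t"
    by (rule simple[OF next_less i]) (use t e in auto)
  then show False using t by simp
qed

text \<open>Consecutive edges agree in sign: a point just behind the common vertex, tested by the
  first edge, and a point just before it, tested by the second, give the same determinant
  \<open>d\<close>. It is nonzero because the boundary turns.\<close>

lemma orientation: "\<exists>e\<in>{1, - 1}. \<forall>i<n. \<forall>x\<in>D. 0 \<le> e * g i x"
proof -
  have "\<forall>i\<in>{..<n}. \<exists>e. e \<in> {1, - 1} \<and> (\<forall>x\<in>D. 0 \<le> e * g i x)"
    using edge_supporting by (metis lessThan_iff)
  then obtain e where e: "\<forall>i\<in>{..<n}. e i \<in> {1, - 1} \<and> (\<forall>x\<in>D. 0 \<le> e i * g i x)"
    using bchoice by metis
  then have e1: "e i \<in> {1, - 1}" and e2: "x \<in> D \<Longrightarrow> 0 \<le> e i * g i x" if "i < n" for i x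
    using that by auto
  have step: "e (Suc i mod n) = e i" if i: "i < n" for i
  proof -
    let ?j = "Suc i mod n"
    let ?W = "E' i (L i)"
    define m where "m = min (L i) (L ?j)"
    have m: "0 < m" "m \<le> L i" "m \<le> L ?j" using L_pos[OF i] L_pos[of ?j] by (auto simp: m_def)
    obtain t where t: "0 < t" "t < m" "sinK K t > 0" by (rule small_step[OF m(1)])
    define d where "d = det3 (P ?j) ?W (V ?j)"
    have "E ?j t \<in> D" "E i (L i - t) \<in> D" using t m i by (auto intro!: edge_in_D)
    then have "0 \<le> e i * g i (E ?j t)" "0 \<le> e ?j * g ?j (E i (L i - t))" using e2 i by auto
    moreover have "g i (E ?j t) = sinK K t * d"
      unfolding g_next[OF i] by (simp add: geo_def det3_linear d_def)
    moreover have "g ?j (E i (L i - t)) = sinK K t * d"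
      unfolding g_def edge_end[OF i] by (simp add: det3_linear d_def det3_swap(2)[of "P ?j" "V ?j"])
    ultimately have "0 \<le> sinK K t * (e i * d)" "0 \<le> sinK K t * (e ?j * d)" by (simp_all add: mult_ac)
    then have "0 \<le> e i * d" "0 \<le> e ?j * d" using t(3) by (simp_all add: zero_le_mult_iff)
    moreover have "d \<noteq> 0" unfolding d_def by (rule turn_nonzero[OF i])
    ultimately show ?thesis using e1[OF i] e1[of ?j] by auto
  qed
  have "e i = e 0" if "i < n" for i
    using that
  proof (induction i)
    case (Suc i)
    then show ?case using step[of i] by simp
  qed simp
  then have "\<forall>i<n. \<forall>x\<in>D. 0 \<le> e 0 * g i x" using e2 by (metis (no_types))
  then show ?thesis by (rule bexI) (rule e1[OF n_pos])
qed

text \<open>\<open>orient\<close> is \<open>1\<close> if the edges run counterclockwise around \<open>D\<close>, so that \<open>h i\<close> is nonnegative on \<open>D\<close>.\<close>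

definition orient :: real where
  "orient = (SOME e. e \<in> {1, - 1} \<and> (\<forall>i<n. \<forall>x\<in>D. 0 \<le> e * g i x))"

definition h :: "nat \<Rightarrow> pt \<Rightarrow> real" where "h i x = orient * g i x"

lemma orient: "orient = 1 \<or> orient = - 1" and h_nonneg: "i < n \<Longrightarrow> x \<in> D \<Longrightarrow> 0 \<le> h i x"
proof -
  have "orient \<in> {1, - 1} \<and> (\<forall>i<n. \<forall>x\<in>D. 0 \<le> orient * g i x)"
    unfolding orient_def by (rule someI_ex) (use orientation in blast)
  then show "orient = 1 \<or> orient = - 1" "i < n \<Longrightarrow> x \<in> D \<Longrightarrow> 0 \<le> h i x"
    unfolding h_def by auto
qed

lemma h_g: "h i x * h j y = g i x * g j y" "h i x = 0 \<longleftrightarrow> g i x = 0"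
  using orient by (auto simp: h_def)

lemma h_linear: "h i (c *\<^sub>R x) = c * h i x" "h i (- x) = - h i x" "h i (x + y) = h i x + h i y"
  "h i (x - y) = h i x - h i y"
  by (simp_all add: h_def g_def det3_linear algebra_simps)

lemma h_geo: "h i (geo K p v t) = cosK K t * h i p + sinK K t * h i v"
  by (simp add: h_def g_geo algebra_simps)

lemma h_E [simp]: "h i (E i t) = 0" "h i (E' i t) = 0"
  by (simp_all add: h_def g_E)

lemma h_P [simp]: "h i (P i) = 0" "h i (V i) = 0"
  using h_E[of i 0] by simp_all

lemma h_next [simp]: "i < n \<Longrightarrow> h i (P (Suc i mod n)) = 0"
  using h_E(1)[of i "L i"] by (simp add: next_vertex)

lemma continuous_on_h [continuous_intros]: "continuous_on X f \<Longrightarrow> continuous_on X (\<lambda>x. h i (f x))"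
  unfolding h_def by (intro continuous_intros)

lemma P_in_D: "i < n \<Longrightarrow> P i \<in> D"
  using edge_in_D[of i 0] L_pos[of i] by simp

lemma turn_pos:
  assumes i: "i < n"
  shows "h i (V (Suc i mod n)) > 0" "h (Suc i mod n) (E' i (L i)) < 0"
proof -
  let ?j = "Suc i mod n"
  obtain t where t: "0 < t" "t < L ?j" "sinK K t > 0" by (rule small_step[OF L_pos[OF next_less]])
  have "E ?j t \<in> D" using t by (auto intro!: edge_in_D)
  moreover have "h i (E ?j t) = sinK K t * h i (V ?j)" using i by (simp add: h_geo)
  ultimately have "0 \<le> sinK K t * h i (V ?j)" using h_nonneg[OF i, of "E ?j t"] by simp
  then have "0 \<le> h i (V ?j)" using t(3) by (simp add: zero_le_mult_iff)
  moreover have "h i (V ?j) \<noteq> 0" using turn_nonzero[OF i] g_next[OF i] by (simp add: h_g)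
  ultimately show 1: "h i (V ?j) > 0" by simp
  have "g ?j (E' i (L i)) = - g i (V ?j)"
    unfolding g_next[OF i] by (simp add: g_def det3_swap(2)[of "P ?j" "V ?j"])
  then show "h ?j (E' i (L i)) < 0" using 1 by (simp add: h_def)
qed

section \<open>Edges as faces of the domain\<close>

definition pred :: "nat \<Rightarrow> nat" where "pred i = (if i = 0 then n - 1 else i - 1)"

lemma pred: "i < n \<Longrightarrow> pred i < n" "i < n \<Longrightarrow> Suc (pred i) mod n = i"
  using n_pos by (auto simp: pred_def)

lemma turn_pred:
  assumes i: "i < n"
  shows "h (pred i) (P i) = 0" "h (pred i) (V i) > 0"
  using h_next[OF pred(1)[OF i]] turn_pos(1)[OF pred(1)[OF i]] pred(2)[OF i] by simp_all

text \<open>The half plane of the previous edge bounds the line at its start, that of the next edge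
  at its end.\<close>

lemma line_in_D:
  assumes i: "i < n" and D: "E i t \<in> D"
  shows "sinK K t \<ge> 0" "sinK K (L i - t) \<ge> 0"
proof -
  have "sinK K t * h (pred i) (V i) \<ge> 0"
    using h_nonneg[OF pred(1)[OF i] D] turn_pred[OF i] by (simp add: h_geo)
  then show "sinK K t \<ge> 0" using turn_pred(2)[OF i] by (simp add: zero_le_mult_iff)
  have "E i t = cosK K (L i - t) *\<^sub>R P (Suc i mod n) - sinK K (L i - t) *\<^sub>R E' i (L i)"
    using edge_end[OF i, of "L i - t"] by simp
  then have "h (Suc i mod n) (E i t) = - sinK K (L i - t) * h (Suc i mod n) (E' i (L i))"
    by (simp add: h_def g_def det3_linear)
  then have "sinK K (L i - t) * - h (Suc i mod n) (E' i (L i)) \<ge> 0"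
    using h_nonneg[OF next_less D, of i] by simp
  then show "sinK K (L i - t) \<ge> 0" using turn_pos(2)[OF i] by (simp add: zero_le_mult_iff mult_le_0_iff)
qed

text \<open>A longer edge would reach a point where \<open>sinK\<close> is negative, outside the
  half plane of the previous edge.\<close>

lemma L_le:
  assumes i: "i < n" and K: "K > 0"
  shows "L i \<le> pi / sqrt K"
proof (rule ccontr)
  assume l: "\<not> L i \<le> pi / sqrt K"
  define h where "h = pi / sqrt K"
  have h: "h > 0" "2 * pi / sqrt K = 2 * h" using K by (simp_all add: h_def)
  define t where "t = min (L i) (3 * h / 2)"
  have t: "h < t" "t < 2 * h" "t \<le> L i" "0 \<le> t" using l h by (auto simp: t_def h_def[symmetric])
  have "sinK K t < 0" using sinK_neg[OF K, of t] t h by (simp add: h_def[symmetric])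
  then show False using line_in_D(1)[OF i edge_in_D[OF i t(4,3)]] by simp
qed

lemma h_eq_0_imp_edge:
  assumes i: "i < n" and x: "x \<in> D" and h0: "h i x = 0"
  obtains t where "0 \<le> t" "t \<le> L i" "x = E i t"
proof -
  have xs: "x \<in> surface K" and ps: "P i \<in> surface K" using x P_in_D[OF i] D_surface by auto
  consider "x = P i" | "x = - P i" "K > 0" | "x \<noteq> P i" "x \<noteq> - P i"
    using surface_uminus[OF ps] xs by force
  then show thesis
  proof cases
    case 1
    then show ?thesis using L_pos[OF i] by (intro that[of 0]) auto
  next
    case 2
    define t where "t = pi / sqrt K"
    \<comment> \<open>The antipode of the starting vertex: the half plane of the next edge forces
      the edge to have length exactly half a period, so that the antipode is its other end.\<close>
    have xt: "x = E i t" using 2 by (simp add: geo_def half_period t_def)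
    have t: "0 \<le> t" "L i \<le> t" using 2 L_le[OF i] by (auto simp: t_def)
    have "sinK K (L i - t) \<ge> 0" using line_in_D(2)[OF i] x xt by simp
    then have "sinK K (t - L i) \<le> 0" using sinK_minus[of K "L i - t"] by simp
    then have "\<not> t - L i > 0" using sinK_pos[of "t - L i" K] L_pos[OF i] by (force simp: t_def)
    then show ?thesis using that[of t] t xt by simp
  next
    case 3
    obtain v r where v: "(P i, v) \<in> unit_tangent K" "x = geo K (P i) v r" "0 < r" "K > 0 \<Longrightarrow> r < pi / sqrt K"
      using polar[OF ps xs 3] by metis
    have sr: "sinK K r > 0" using sinK_pos v(3,4) by blast
    have "h i v = 0" using h0 v(2) sr by (simp add: h_geo)
    then have "v = V i \<or> v = - V i" using unit_tangent_parallel[OF vertex_unit_tangent[OF i] v(1)] by (simp add: h_g g_def)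
    then consider "x = E i r" | "x = E i (- r)" using v(2) by (auto simp: geo_uminus)
    then show ?thesis
    proof cases
      case 1
      have "\<not> r > L i"
      proof
        assume "r > L i"
        then have "sinK K (r - L i) > 0" using v(4) L_pos[OF i] by (intro sinK_pos) force+
        then show False using line_in_D(2)[OF i, of r] x 1 sinK_minus[of K "r - L i"] by simp
      qed
      then show ?thesis using 1 v(3) that[of r] by simp
    next
      case 2
      then show ?thesis using line_in_D(1)[OF i, of "- r"] x sr by simp
    qed
  qed
qed

lemma h_pos:
  assumes i: "i < n" "0 < s" "s < L i" and j: "j < n" "j \<noteq> i"
  shows "h j (E i s) > 0"
proof (rule ccontr)
  have D: "E i s \<in> D" using i by (intro edge_in_D) auto
  assume "\<not> h j (E i s) > 0"
  then have "h j (E i s) = 0" using h_nonneg[OF j(1) D] by simp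
  then obtain t where t: "0 \<le> t" "t \<le> L j" "E i s = E j t"
    using h_eq_0_imp_edge[OF j(1) D] by metis
  show False
  proof (cases "t = L j")
    case True
    \<comment> \<open>The end of edge \<open>j\<close> is the start of the edge that follows, at
      parameter \<open>0\<close>; simplicity speaks only of half-open edges.\<close>
    then have "E i s = E (Suc j mod n) 0" using t(3) next_vertex[OF j(1)] by simp
    then have "s = 0" using simple[OF i(1) next_less, of s 0 j] i L_pos[OF next_less] by simp
    then show False using i by simp
  next
    case False
    then show False using simple[OF i(1) j(1), of s t] t i j by simp
  qed
qed

text \<open>If \<open>x\<close> satisfied all inequalities outside \<open>D\<close>, a geodesic from
  an interior point \<open>z\<close> to \<open>x\<close> would meet the boundary on some edge
  \<open>k\<close>. There \<open>h k\<close> vanishes, but before \<open>x\<close> it is a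
  combination in which \<open>h k z > 0\<close> has positive weight. So the meeting point is
  \<open>x\<close> itself, which then lies in \<open>D\<close>.\<close>

lemma in_D_iff:
  assumes x: "x \<in> surface K"
  shows "x \<in> D \<longleftrightarrow> (\<forall>k<n. 0 \<le> h k x)"
proof
  assume "x \<in> D"
  then show "\<forall>k<n. 0 \<le> h k x" using h_nonneg by blast
next
  assume nn: "\<forall>k<n. 0 \<le> h k x"
  show "x \<in> D"
  proof (rule ccontr)
    assume xD: "x \<notin> D"
    obtain z where z: "z \<in> (top_of_set (surface K)) interior_of D" using interior_nonempty by blast
    have zD: "z \<in> D" by (rule subsetD[OF interior_of_subset z])
    then have zs: "z \<in> surface K" using D_surface by blast
    have hz: "h k z > 0" if "k < n" for k
      using h_nonneg[OF that zD] interior_g_nonzero[OF that z] h_g(2)[of k z] by linarith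
    have "x \<noteq> - z" using hz[OF n_pos] nn n_pos by (force simp: h_linear)
    moreover have "x \<noteq> z" using zD xD by blast
    ultimately obtain v r where v: "(z, v) \<in> unit_tangent K" "x = geo K z v r" "0 < r" "K > 0 \<Longrightarrow> r < pi / sqrt K"
      using polar[OF zs x] by metis
    let ?S = "geo K z v ` {0..r}"
    have "connected ?S"
      by (intro connected_continuous_image continuous_intros connected_Icc)
    then have "connectedin (top_of_set (surface K)) ?S"
      using geo_in_surface[OF v(1)] by (auto simp: connectedin_subtopology)
    moreover have "z \<in> ?S" using v(3) by (auto intro!: image_eqI[of _ _ 0])
    moreover have "x \<in> ?S" using v(2,3) by auto
    ultimately have "?S \<inter> (top_of_set (surface K)) frontier_of D \<noteq> {}"
      using xD zD by (intro connectedin_Int_frontier_of) blast+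
    then obtain t where t: "0 \<le> t" "t \<le> r" and tb: "geo K z v t \<in> bdry K D" unfolding bdry_def by auto
    then obtain k s where k: "k < n" "geo K z v t = E k s" unfolding bd edge_def by auto
    have sr: "sinK K r > 0" using sinK_pos v(3,4) by blast
    have "sinK K r * h k (geo K z v t) = sinK K (r - t) * h k z + sinK K t * h k x"
      using arg_cong[OF geo_between[of K r z v t], of "h k"] v(2) by (simp add: h_linear)
    moreover have "sinK K t * h k x \<ge> 0" "sinK K (r - t) \<ge> 0"
      using nn k t v(4) sinK_nonneg[of t K] sinK_nonneg[of "r - t" K] by force+
    moreover have "h k (geo K z v t) = 0" using k by simp
    ultimately have "sinK K (r - t) * h k z \<le> 0" "sinK K (r - t) \<ge> 0" by simp_all
    then have "sinK K (r - t) = 0" using hz[OF k(1)] by (simp add: mult_le_0_iff)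
    then have "r = t" using sinK_eq_0[of K "r - t"] t v(3,4) by force
    then show False using tb bdry_subset v(2) xD by blast
  qed
qed

end

section \<open>Chords\<close>

lemma det3_coplanar:
  assumes "det3 q T N = 1" "det3 q T x = 0" "det3 q T y = 0"
  shows "det3 x y q = 0" "det3 x y T = 0"
proof -
  have "x = det3 x T N *\<^sub>R q + det3 q x N *\<^sub>R T" "y = det3 y T N *\<^sub>R q + det3 q y N *\<^sub>R T"
    using frame_expansion[OF assms(1), of x] frame_expansion[OF assms(1), of y] assms(2,3) by simp_all
  then obtain a b c d where "x = a *\<^sub>R q + b *\<^sub>R T" "y = c *\<^sub>R q + d *\<^sub>R T" by metis
  then show "det3 x y q = 0" "det3 x y T = 0" by (simp_all add: det3_linear)
qed

lemma geodesic_shift: "geodesic K (geo K p v t) (geo_vel K p v t) = geodesic K p v"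
proof -
  have "geodesic K (geo K p v t) (geo_vel K p v t) = (\<lambda>s. geo K p v (t + s)) ` UNIV"
    unfolding geodesic_def by (simp add: geo_add)
  also have "\<dots> = geo K p v ` range ((+) t)" by (simp only: image_image)
  also have "range ((+) t) = UNIV" by simp
  finally show ?thesis by (simp only: geodesic_def)
qed

lemma geodesic_uminus: "geodesic K p (- v) = geodesic K p v"
proof -
  have "geodesic K p (- v) = geo K p v ` range uminus"
  proof -
    have "geo K p (- v) = (\<lambda>s. geo K p v (- s))" by (rule ext) (rule geo_uminus)
    then show ?thesis unfolding geodesic_def by (simp only: image_image)
  qed
  also have "range uminus = (UNIV :: real set)" by simp
  finally show ?thesis by (simp only: geodesic_def)
qed

section \<open>Uniqueness of the chord\<close>

lemma is_chord_rev:
  assumes "is_chord K D \<gamma> q v r"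
  shows "is_chord K D \<gamma> (geo K q v r) (- geo_vel K q v r) r"
proof -
  have "geo K (geo K q v r) (- geo_vel K q v r) = (\<lambda>t. geo K q v (r - t))"
    by (rule ext) (simp add: geo_uminus geo_add)
  then have "geo K (geo K q v r) (- geo_vel K q v r) ` {0..r} = geo K q v ` (\<lambda>t. r - t) ` {0..r}"
    by (simp only: image_image)
  also have "(\<lambda>t. r - t) ` {0..r} = {0..r}" by simp
  finally have img: "geo K (geo K q v r) (- geo_vel K q v r) ` {0..r} = geo K q v ` {0..r}" .
  have qv: "(q, v) \<in> unit_tangent K" and \<gamma>: "\<gamma> = geodesic K q v" and r: "0 \<le> r"
    and D: "\<gamma> \<inter> D = geo K q v ` {0..r}"
    using assms unfolding is_chord_def by blast+
  show ?thesis
    unfolding is_chord_def img D geodesic_uminus geodesic_shift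
    using unit_tangent_uminus[OF geo_unit_tangent[OF qv]] \<gamma> r by blast
qed

text \<open>A chord shorter than the full circle determines its ends: the parametrization is still
  injective slightly beyond \<open>r\<close>, so a second chord in the same direction cannot
  overshoot the end, and it has to contain the start.\<close>

lemma is_chord_forward:
  assumes c: "is_chord K D \<gamma> q v r" and c': "is_chord K D \<gamma> (geo K q v \<tau>) (geo_vel K q v \<tau>) r'"
    and K: "K > 0 \<Longrightarrow> r < 2 * pi / sqrt K" and \<tau>: "0 \<le> \<tau>" "\<tau> \<le> r"
  shows "\<tau> = 0 \<and> r' = r"
proof -
  have qv: "(q, v) \<in> unit_tangent K" and D1: "\<gamma> \<inter> D = geo K q v ` {0..r}" and r: "0 \<le> r"
    using c by (auto simp: is_chord_def)
  have r': "0 \<le> r'" using c' by (auto simp: is_chord_def)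
  have D2: "\<gamma> \<inter> D = (\<lambda>u. geo K q v (\<tau> + u)) ` {0..r'}"
    using c' unfolding is_chord_def geo_add by blast
  \<comment> \<open>Half of the room that is left before a great circle closes.\<close>
  define \<delta> where "\<delta> = (if K > 0 then (2 * pi / sqrt K - r) / 2 else 1)"
  have \<delta>: "\<delta> > 0" "K > 0 \<Longrightarrow> r + \<delta> < 2 * pi / sqrt K"
    using K by (auto simp: \<delta>_def) argo
  have inj: "x = y" if "geo K q v x = geo K q v y" "0 \<le> x" "x \<le> r + \<delta>" "0 \<le> y" "y \<le> r + \<delta>" for x y
    by (rule geo_inj[OF qv that(1)]) (use \<delta>(2) that(2-) in linarith)
  have le: "\<tau> + r' \<le> r"
  proof (rule ccontr)
    assume n: "\<not> \<tau> + r' \<le> r"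
    define u where "u = min r' (r - \<tau> + \<delta>)"
    have u: "0 \<le> u" "u \<le> r'" "r < \<tau> + u" "\<tau> + u \<le> r + \<delta>" using n \<tau> \<delta>(1) r' by (auto simp: u_def)
    have "geo K q v (\<tau> + u) \<in> geo K q v ` {0..r}" using D1 D2 u by auto
    then obtain y where y: "0 \<le> y" "y \<le> r" "geo K q v (\<tau> + u) = geo K q v y" by auto
    have "\<tau> + u = y" by (rule inj[OF y(3)]) (use u y \<tau> \<delta>(1) in auto)
    then show False using u y by simp
  qed
  have "geo K q v 0 \<in> (\<lambda>u. geo K q v (\<tau> + u)) ` {0..r'}" "geo K q v r \<in> (\<lambda>u. geo K q v (\<tau> + u)) ` {0..r'}"
    unfolding D2[symmetric] D1 using r by (intro imageI; simp)+
  then obtain u w where u: "0 \<le> u" "u \<le> r'" "geo K q v 0 = geo K q v (\<tau> + u)"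
    and w: "0 \<le> w" "w \<le> r'" "geo K q v r = geo K q v (\<tau> + w)" by auto
  have "0 = \<tau> + u" by (rule inj[OF u(3)]) (use u \<tau> \<delta> le r in auto)
  moreover have "r = \<tau> + w" by (rule inj[OF w(3)]) (use w \<tau> \<delta> le r in auto)
  ultimately show ?thesis using u w le \<tau> by simp
qed

text \<open>A second chord starts on the first one, in a parallel direction; the opposite direction
  is reduced to the equal one by reversing the first chord.\<close>

lemma is_chord_unique:
  assumes c: "is_chord K D \<gamma> q v r" and c': "is_chord K D \<gamma> q' v' r'"
    and K: "K > 0 \<Longrightarrow> r < 2 * pi / sqrt K"
  shows "r' = r" "q' = q \<and> v' = v \<or> q' = geo K q v r \<and> v' = - geo_vel K q v r"
proof -
  have qv: "(q, v) \<in> unit_tangent K" and g1: "\<gamma> = geodesic K q v" and D1: "\<gamma> \<inter> D = geo K q v ` {0..r}"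
    using c by (auto simp: is_chord_def)
  have qv': "(q', v') \<in> unit_tangent K" and g2: "\<gamma> = geodesic K q' v'" and D2: "\<gamma> \<inter> D = geo K q' v' ` {0..r'}"
    and r': "0 \<le> r'"
    using c' by (auto simp: is_chord_def)
  have "geo K q' v' 0 \<in> \<gamma> \<inter> D" using r' unfolding D2 by (intro imageI) simp
  then obtain \<tau> where \<tau>: "0 \<le> \<tau>" "\<tau> \<le> r" "q' = geo K q v \<tau>" unfolding D1 by auto
  have ut: "(q', geo_vel K q v \<tau>) \<in> unit_tangent K" using geo_unit_tangent[OF qv] \<tau>(3) by simp
  obtain u where u: "0 < u" "sinK K u > 0" by (rule small_step[of 1 K]) auto
  have "geo K q' v' u \<in> geodesic K q v" using g1 g2 by (auto simp: geodesic_def)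
  then have "det3 q v (geo K q' v' u) = 0" using geodesic_iff[OF qv geo_in_surface[OF qv']] by blast
  moreover have "det3 q v (geo K q' v' u) = det3 q' (geo_vel K q v \<tau>) (geo K q' v' u)"
    using det3_geo[of K q v \<tau>] \<tau>(3) by simp
  ultimately have "det3 q' (geo_vel K q v \<tau>) v' = 0" using u by (simp add: geo_def det3_linear)
  then have "v' = geo_vel K q v \<tau> \<or> v' = - geo_vel K q v \<tau>" by (rule unit_tangent_parallel[OF ut qv'])
  then have "r' = r \<and> (q' = q \<and> v' = v \<or> q' = geo K q v r \<and> v' = - geo_vel K q v r)"
  proof
    assume v': "v' = geo_vel K q v \<tau>"
    then have "\<tau> = 0 \<and> r' = r" using is_chord_forward[OF c _ K \<tau>(1,2)] c' \<tau>(3) by simp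
    then show ?thesis using \<tau>(3) v' by simp
  next
    assume v': "v' = - geo_vel K q v \<tau>"
    let ?q = "geo K q v r" and ?v = "- geo_vel K q v r"
    have e: "q' = geo K ?q ?v (r - \<tau>)" "v' = geo_vel K ?q ?v (r - \<tau>)"
      using \<tau>(3) v' by (simp_all add: geo_uminus geo_add geo_vel_add)
    have "r - \<tau> = 0 \<and> r' = r"
      by (rule is_chord_forward[OF is_chord_rev[OF c]]) (use c' e K \<tau> in auto)
    then show ?thesis using e by simp
  qed
  then show "r' = r" "q' = q \<and> v' = v \<or> q' = geo K q v r \<and> v' = - geo_vel K q v r" by auto
qed

lemma chord_length_eq:
  assumes c: "is_chord K D \<gamma> q v r" and K: "K > 0 \<Longrightarrow> r < 2 * pi / sqrt K"
  shows "chord_length K D \<gamma> = r"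
  unfolding chord_length_def
proof (rule the_equality)
  show "\<exists>p v. is_chord K D \<gamma> p v r" using c by blast
next
  fix r' assume "\<exists>p v. is_chord K D \<gamma> p v r'"
  then show "r' = r" using is_chord_unique(1)[OF c _ K] by blast
qed

context polygon_domain
begin

section \<open>Leaving the domain along a geodesic\<close>

text \<open>The component along \<open>v\<close> is \<open>sinK K t\<close>, which is unbounded for
  \<open>K \<le> 0\<close>, but bounded on the compact \<open>D\<close>.\<close>

lemma exit_nonpos:
  assumes pv: "(p, v) \<in> unit_tangent K" and K: "K \<le> 0"
  shows "\<exists>t\<ge>0. geo K p v t \<notin> D"
proof (rule ccontr)
  assume "\<not> ?thesis"
  then have D: "geo K p v t \<in> D" if "t \<ge> 0" for t using that by blast
  let ?B = "\<lambda>x. det3 p x (nrm K p v)"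
  have "compact (?B ` D)"
    by (intro compact_continuous_image D_compact continuous_intros)
  then obtain M where M: "\<And>x. x \<in> D \<Longrightarrow> \<bar>?B x\<bar> \<le> M"
    using compact_imp_bounded[of "?B ` D"] unfolding bounded_iff by auto
  have M0: "M \<ge> 0" using M[OF D[of 0]] by simp
  define A where "A = sqrt (1 - K * (M + 1)\<^sup>2)"
  have pos: "1 - K * (M + 1)\<^sup>2 > 0"
    using mult_nonpos_nonneg[of K "(M + 1)\<^sup>2"] K by simp
  then have "A\<^sup>2 + K * (M + 1)\<^sup>2 = 1" "A > 0" by (simp_all add: A_def)
  then have "sinK K (argK K A (M + 1)) = M + 1" "argK K A (M + 1) > 0"
    using argK[of A K "M + 1"] M0 by simp_all
  then obtain t where t: "t \<ge> 0" "sinK K t = M + 1" by (meson less_imp_le)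
  have "?B (geo K p v t) = M + 1"
    using t(2) nrm(2)[OF pv] by (simp add: geo_def det3_linear)
  then show False using M[OF D[OF t(1)]] by simp
qed

text \<open>For \<open>K > 0\<close>, a ray that stays in \<open>D\<close> runs through antipodal
  pairs, where \<open>h 0\<close> is nonnegative with both signs and hence \<open>0\<close>. The
  circle is then the line of edge \<open>0\<close>, which passes through \<open>P 0\<close>.\<close>

lemma exit_exists:
  assumes pv: "(p, v) \<in> unit_tangent K" and nv: "det3 p v (P 0) \<noteq> 0"
  shows "\<exists>t\<ge>0. geo K p v t \<notin> D"
proof (rule ccontr)
  assume "\<not> (\<exists>t\<ge>0. geo K p v t \<notin> D)"
  then have D: "geo K p v t \<in> D" if "t \<ge> 0" for t using that by blast
  show False
  proof (cases "K > 0")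
    case True
    define t where "t = pi / sqrt K"
    have t: "0 < t" "2 * pi / sqrt K = 2 * t" using True by (simp_all add: t_def)
    have "p \<in> D" "- p \<in> D" using D[of 0] D[of t] True t(1) by (simp_all add: geo_def half_period t_def)
    then have 0: "h 0 p = 0" using h_nonneg[OF n_pos, of p] h_nonneg[OF n_pos, of "- p"] by (simp add: h_linear)
    have "sinK K (t / 2) > 0" "sinK K (3 * t / 2) < 0"
      using t True by (auto intro!: sinK_pos sinK_neg simp: t_def[symmetric])
    moreover have "0 \<le> sinK K (t / 2) * h 0 v" "0 \<le> sinK K (3 * t / 2) * h 0 v"
      using h_nonneg[OF n_pos D[of "t / 2"]] h_nonneg[OF n_pos D[of "3 * t / 2"]] t(1) by (simp_all add: h_geo 0)
    ultimately have "h 0 v = 0" by (simp add: zero_le_mult_iff)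
    then have "det3 p v (P 0) = 0"
      using 0 det3_coplanar(1)[OF nrm(2)[OF vertex_unit_tangent[OF n_pos]]] by (simp add: h_g g_def)
    then show False using nv by simp
  next
    case False
    show False using exit_nonpos[OF pv] D False by force
  qed
qed

text \<open>\<open>t\<close> is the infimum of the times outside \<open>D\<close>. If every
  functional vanishing at that point had a nonnegative derivative, all of them would stay
  nonnegative for a while; by \<open>h_geo\<close> no error of second order arises. The hypothesis
  on the vertices keeps the exit point away from the ends of the edge.\<close>

lemma exit_edge:
  assumes pv: "(p, v) \<in> unit_tangent K" and p: "p \<in> D" and nv: "\<And>k. k < n \<Longrightarrow> det3 p v (P k) \<noteq> 0"
  obtains t i s where "0 \<le> t" "i < n" "0 < s" "s < L i" "geo K p v t = E i s" "h i (geo_vel K p v t) < 0"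
proof -
  define B where "B = {t. 0 \<le> t \<and> geo K p v t \<notin> D}"
  have Bne: "B \<noteq> {}" using exit_exists[OF pv nv[OF n_pos]] by (auto simp: B_def)
  have bdd: "bdd_below B" by (rule bdd_belowI[of _ 0]) (simp add: B_def)
  define t where "t = Inf B"
  have t0: "0 \<le> t" unfolding t_def using Bne by (rule cInf_greatest) (simp add: B_def)
  have before: "geo K p v u \<in> D" if "0 \<le> u" "u < t" for u
  proof (rule ccontr)
    assume "geo K p v u \<notin> D"
    then have "u \<in> B" using that by (simp add: B_def)
    then show False using cInf_lower[OF _ bdd, of u] that by (simp add: t_def)
  qed
  have cont: "continuous_on UNIV (\<lambda>u. h k (geo K p v (t + u)))" for k
    by (intro continuous_intros)
  have lim: "((\<lambda>u. h k (geo K p v (t + u))) \<longlongrightarrow> h k (geo K p v t)) (at 0)" for k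
    using cont[of k] by (simp add: continuous_on_eq_continuous_at isCont_def) (metis add.right_neutral)
  have tD: "geo K p v t \<in> D"
  proof (cases "t = 0")
    case False
    have "0 \<le> h k (geo K p v t)" if k: "k < n" for k
    proof (rule tendsto_lowerbound)
      show "((\<lambda>u. h k (geo K p v (t + u))) \<longlongrightarrow> h k (geo K p v t)) (at_left 0)"
        using lim by (rule filterlim_mono) (auto simp: at_le)
      have "\<forall>\<^sub>F u in at_left 0. u \<in> {- t<..<0}"
        using False t0 by (intro eventually_at_leftI[of "- t"]) auto
      then show "\<forall>\<^sub>F u in at_left 0. 0 \<le> h k (geo K p v (t + u))"
        by eventually_elim (use h_nonneg[OF k] before in auto)
    qed simp
    then show ?thesis using in_D_iff[OF geo_in_surface[OF pv]] by blast
  qed (simp add: p)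
  have "\<exists>k<n. h k (geo K p v t) = 0 \<and> h k (geo_vel K p v t) < 0"
  proof (rule ccontr)
    assume neg: "\<not> ?thesis"
    have ev: "\<forall>\<^sub>F u in at_right 0. 0 \<le> h k (geo K p v (t + u))" if k: "k \<in> {..<n}" for k
    proof (cases "h k (geo K p v t) = 0")
      case False
      then have "0 < h k (geo K p v t)" using h_nonneg[OF _ tD, of k] k by simp
      moreover have "((\<lambda>u. h k (geo K p v (t + u))) \<longlongrightarrow> h k (geo K p v t)) (at_right 0)"
        using lim by (rule filterlim_mono) (auto simp: at_le)
      ultimately have "\<forall>\<^sub>F u in at_right 0. 0 < h k (geo K p v (t + u))" by (rule order_tendstoD(1)[rotated])
      then show ?thesis by eventually_elim simp
    next
      case True
      then have v: "0 \<le> h k (geo_vel K p v t)" using neg k by force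
      define b where "b = (if K > 0 then pi / sqrt K else 1)"
      have b: "b > 0" "K > 0 \<Longrightarrow> b = pi / sqrt K" by (auto simp: b_def)
      have "\<forall>\<^sub>F u in at_right 0. u \<in> {0<..<b}"
        using b by (intro eventually_at_rightI[of 0 b]) auto
      then show ?thesis
      proof eventually_elim
        case (elim u)
        then have "sinK K u > 0" using b(2) by (intro sinK_pos) auto
        then show ?case using v True geo_add[of K p v t u] by (metis add_0 h_geo less_imp_le mult_nonneg_nonneg mult_zero_right)
      qed
    qed
    have "\<forall>\<^sub>F u in at_right 0. \<forall>k\<in>{..<n}. 0 \<le> h k (geo K p v (t + u))"
      using ev by (intro eventually_ball_finite) auto
    then obtain b where b: "b > 0" "\<And>u. 0 < u \<Longrightarrow> u < b \<Longrightarrow> \<forall>k\<in>{..<n}. 0 \<le> h k (geo K p v (t + u))"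
      unfolding eventually_at_right_field by (metis add_0)
    have after: "geo K p v (t + u) \<in> D" if "0 < u" "u < b" for u
      using b(2)[OF that] in_D_iff[OF geo_in_surface[OF pv]] by simp
    have "t + b \<le> t"
      unfolding t_def
    proof (rule cInf_greatest[OF Bne], unfold t_def[symmetric])
      fix u assume u: "u \<in> B"
      show "t + b \<le> u"
      proof (rule ccontr)
        assume "\<not> t + b \<le> u"
        then consider "u < t" | "u = t" | "0 < u - t" "u - t < b" by linarith
        then show False
          by cases (use before[of u] tD after[of "u - t"] u in \<open>auto simp: B_def\<close>)
      qed
    qed
    then show False using b(1) by simp
  qed
  then obtain k where k: "k < n" "h k (geo K p v t) = 0" "h k (geo_vel K p v t) < 0" by blast
  obtain s where s: "0 \<le> s" "s \<le> L k" "geo K p v t = E k s"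
    by (rule h_eq_0_imp_edge[OF k(1) tD k(2)])
  have "det3 p v (E k s) = 0" using s(3)[symmetric] by (simp add: geo_def det3_linear)
  then have "s \<noteq> 0" "s \<noteq> L k" using nv[OF k(1)] nv[OF next_less] next_vertex[OF k(1)] by auto
  then show thesis using that[OF t0 k(1), of s] s k(3) by simp
qed

text \<open>Following the geodesic both ways gives two exits. If they were on the same edge,
  coinciding exits would have one velocity with both signs of \<open>h i\<close>, and distinct ones
  would put \<open>P i\<close> on the geodesic.\<close>

lemma meets_two_edges:
  assumes pv: "(p, v) \<in> unit_tangent K" and p: "p \<in> D" and nv: "\<And>k. k < n \<Longrightarrow> det3 p v (P k) \<noteq> 0"
  shows "\<exists>i j s t. i < n \<and> j < n \<and> i \<noteq> j \<and> 0 < s \<and> s < L i \<and> 0 < t \<and> t < L j \<and>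
     det3 p v (E i s) = 0 \<and> det3 p v (E j t) = 0"
proof -
  obtain a i s where a: "0 \<le> a" "i < n" "0 < s" "s < L i" "geo K p v a = E i s" "h i (geo_vel K p v a) < 0"
    by (rule exit_edge[OF pv p nv])
  have nv': "det3 p (- v) (P k) \<noteq> 0" if "k < n" for k using nv[OF that] by (simp add: det3_linear)
  obtain b j t where b: "0 \<le> b" "j < n" "0 < t" "t < L j" "geo K p (- v) b = E j t" "h j (geo_vel K p (- v) b) < 0"
    by (rule exit_edge[OF unit_tangent_uminus[OF pv] p nv'])
  have b': "geo K p v (- b) = E j t" "h j (geo_vel K p v (- b)) > 0" using b(5,6) by (simp_all add: geo_uminus h_linear)
  have on: "det3 p v (E i s) = 0" "det3 p v (E j t) = 0"
    unfolding a(5)[symmetric] b'(1)[symmetric] by (simp_all add: geo_def det3_linear)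
  have "i \<noteq> j"
  proof
    assume ij: "i = j"
    show False
    proof (cases "s = t")
      case True
      then have "geo_vel K p v a = geo_vel K p v (- b)"
        using geo_eq_imp_vel_eq[OF pv] a(5) b'(1) ij by simp
      then show False using a(6) b'(2) ij by simp
    next
      case False
      have "\<bar>s - t\<bar> < L i" using a(3,4) b(3,4) ij by (auto simp: abs_less_iff)
      then have "sinK K (s - t) \<noteq> 0"
        using sinK_eq_0[of K "s - t"] False L_le[OF a(2)] by force
      moreover have "sinK K (s - t) *\<^sub>R P i = sinK K s *\<^sub>R E i t - sinK K t *\<^sub>R E i s"
        by (simp add: geo_def sinK_diff algebra_simps)
      then have "sinK K (s - t) * det3 p v (P i) = sinK K s * det3 p v (E i t) - sinK K t * det3 p v (E i s)"
        by (metis (no_types) det3_linear(6,12))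
      then have "sinK K (s - t) * det3 p v (P i) = 0" using on ij by simp
      ultimately show False using nv[OF a(2)] by simp
    qed
  qed
  then show ?thesis using a b on by blast
qed

end

lemma frame_transport:
  assumes "orthonormal_frame K p v N"
  shows "orthonormal_frame K (geo K p v t) (geo_vel K p v t) N"
proof -
  note f = frame_facts[OF assms]
  have "(geo K p v t, geo_vel K p v t) \<in> unit_tangent K"
    using assms geo_unit_tangent by (simp add: orthonormal_frame_def)
  moreover from this have "(geo K p v t, N) \<in> unit_tangent K"
    using f quad_sym[of K N v] by (simp add: unit_tangent_def geo_def quad_linear)
  moreover have "riem K (geo_vel K p v t) N = 0"
  proof (cases "K = 0")
    case False
    then have "riem K p N = 0" using quad_eq_riem[OF False, of p N] f by simp
    then show ?thesis using f by (simp add: geo_vel_def riem_linear)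
  qed (use f in \<open>simp add: geo_vel_def riem_linear\<close>)
  ultimately show ?thesis by (simp add: orthonormal_frame_def)
qed

lemma frame_normal_unique:
  assumes "orthonormal_frame K p v N"
  shows "N = nrm K p v \<or> N = - nrm K p v"
proof -
  have v: "(p, v) \<in> unit_tangent K" and N: "(p, N) \<in> unit_tangent K" "riem K v N = 0"
    using assms by (auto simp: orthonormal_frame_def)
  note c = unit_tangent_components[OF nrm[OF v] N(1)]
  have "det3 p N (nrm K p v) = 0" using c(3) N(2) by simp
  then have "N = det3 p v N *\<^sub>R nrm K p v" "(det3 p v N)\<^sup>2 = 1" using c(1,2) by simp_all
  then show ?thesis by (auto simp: power2_eq_1_iff)
qed

lemma geo_polar_unique:
  assumes "(p, u) \<in> unit_tangent K" "(p, v) \<in> unit_tangent K" "geo K p u s = geo K p v t"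
    and "0 < s" "0 \<le> t" "K > 0 \<Longrightarrow> s < pi / sqrt K" "K > 0 \<Longrightarrow> t \<le> pi / sqrt K"
  shows "u = v \<and> s = t"
proof -
  have ss: "sinK K s > 0" using sinK_pos assms by blast
  have p: "2 * pi / sqrt K = pi / sqrt K + pi / sqrt K" by simp
  have "det3 p v (geo K p u s) = 0" unfolding assms(3) by (simp add: geo_def det3_linear)
  then have "det3 p v u = 0" using ss by (simp add: geo_def det3_linear)
  then consider "u = v" | "u = - v" using unit_tangent_parallel[OF assms(2,1)] by blast
  then show ?thesis
  proof cases
    case 1
    have "s = t"
    proof (rule geo_inj[OF assms(1)])
      show "geo K p u s = geo K p u t" using assms(3) 1 by simp
      show "\<bar>s - t\<bar> < 2 * pi / sqrt K" if "K > 0"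
        using assms(4,5) assms(6,7)[OF that] p by linarith
    qed
    then show ?thesis using 1 by simp
  next
    case 2
    have "- s = t"
    proof (rule geo_inj[OF assms(2)])
      show "geo K p v (- s) = geo K p v t" using assms(3) 2 by (simp add: geo_uminus)
      show "\<bar>- s - t\<bar> < 2 * pi / sqrt K" if "K > 0"
        using assms(4,5) assms(6,7)[OF that] p by linarith
    qed
    then show ?thesis using assms by simp
  qed
qed

lemma cot_arccos: "\<bar>x\<bar> \<le> 1 \<Longrightarrow> cot (arccos x) = x / sqrt (1 - x\<^sup>2)"
  by (simp add: cot_def cos_arccos_abs sin_arccos_abs)

context polygon_domain
begin

section \<open>Chords joining two edges\<close>

lemma between_in_D:
  assumes v: "(q, v) \<in> unit_tangent K" and q: "q \<in> D" and y: "geo K q v r \<in> D"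
    and r: "0 < r" "K > 0 \<Longrightarrow> r < pi / sqrt K" and t: "0 \<le> t" "t \<le> r"
  shows "geo K q v t \<in> D"
proof -
  have "0 \<le> h k (geo K q v t)" if k: "k < n" for k
  proof -
    have "sinK K r * h k (geo K q v t) = sinK K (r - t) * h k q + sinK K t * h k (geo K q v r)"
      using arg_cong[OF geo_between[of K r q v t], of "h k"] by (simp add: h_linear)
    moreover have "0 \<le> sinK K t" "0 \<le> sinK K (r - t)" using r t by (force intro!: sinK_nonneg)+
    ultimately have "0 \<le> sinK K r * h k (geo K q v t)" using h_nonneg[OF k] q y by simp
    moreover have "sinK K r > 0" using sinK_pos r by blast
    ultimately show ?thesis by (simp add: zero_le_mult_iff)
  qed
  then show ?thesis using in_D_iff[OF geo_in_surface[OF v]] by blast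
qed

text \<open>A point of the geodesic other than \<open>q\<close> and \<open>- q\<close> is reached
  from \<open>q\<close> along \<open>v\<close> or \<open>- v\<close>, within half a period if
  \<open>K > 0\<close>. The direction \<open>- v\<close> is ruled out by \<open>backward\<close>,
  and \<open>forward\<close> bounds the time along \<open>v\<close>.\<close>

lemma chordI:
  assumes v: "(q, v) \<in> unit_tangent K" and q: "q \<in> D" and qD: "- q \<notin> D"
    and r: "0 \<le> r" "K > 0 \<Longrightarrow> r < pi / sqrt K" and sub: "geo K q v ` {0..r} \<subseteq> D"
    and backward: "\<And>t. geo K q v t \<in> D \<Longrightarrow> 0 \<le> sinK K t"
    and forward: "\<And>t. 0 < t \<Longrightarrow> (K > 0 \<Longrightarrow> t < pi / sqrt K) \<Longrightarrow> geo K q v t \<in> D \<Longrightarrow> t \<le> r"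
  shows "is_chord K D (geodesic K q v) q v r"
proof -
  have "x \<in> geo K q v ` {0..r}" if x: "x \<in> geodesic K q v" "x \<in> D" for x
  proof (cases "x = q")
    case True
    then show ?thesis using r by (intro image_eqI[of _ _ 0]) auto
  next
    case False
    have qs: "q \<in> surface K" and xs: "x \<in> surface K" using q x D_surface by auto
    have "x \<noteq> - q" using x(2) qD by blast
    then obtain u t where u: "(q, u) \<in> unit_tangent K" "x = geo K q u t" "0 < t" "K > 0 \<Longrightarrow> t < pi / sqrt K"
      using polar[OF qs xs False] by metis
    have st: "sinK K t > 0" using sinK_pos u(3,4) by blast
    have "det3 q v x = 0" using geodesic_iff[OF v xs] x(1) by simp
    then have "det3 q v u = 0" using u(2) st by (simp add: geo_def det3_linear)
    then consider "u = v" | "u = - v" using unit_tangent_parallel[OF v u(1)] by blast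
    then show ?thesis
    proof cases
      case 1
      then show ?thesis using forward[OF u(3,4)] u(2,3) x(2) by auto
    next
      case 2
      then show ?thesis using backward[of "- t"] u(2) x(2) st by (simp add: geo_uminus)
    qed
  qed
  then have "geodesic K q v \<inter> D = geo K q v ` {0..r}"
    using sub unfolding geodesic_def by blast
  then show ?thesis using v r by (simp add: is_chord_def)
qed

text \<open>\<open>h i\<close> vanishes at the first point and is positive at the second, so its
  derivative at the start is positive; likewise \<open>h j\<close> has a negative derivative at the
  end. Hence going on beyond either end leaves \<open>D\<close>. In between every \<open>h k\<close>
  is positive, because it is nonnegative at both ends and positive at one of them.\<close>

lemma chord_pair:
  assumes i: "i < n" "0 < s" "s < L i" and j: "j < n" "0 < t" "t < L j" and ij: "i \<noteq> j"
  obtains v r where "(E i s, v) \<in> unit_tangent K" "E j t = geo K (E i s) v r" "0 < r"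
    "K > 0 \<Longrightarrow> r < pi / sqrt K" "h i v > 0" "h j (geo_vel K (E i s) v r) < 0"
    "is_chord K D (geodesic K (E i s) v) (E i s) v r"
    "\<And>\<tau> k. 0 < \<tau> \<Longrightarrow> \<tau> < r \<Longrightarrow> k < n \<Longrightarrow> h k (geo K (E i s) v \<tau>) > 0"
proof -
  let ?q = "E i s" and ?y = "E j t"
  have qD: "?q \<in> D" and yD: "?y \<in> D" using i j by (auto intro!: edge_in_D)
  have hy: "h k ?y > 0" if "k < n" "k \<noteq> j" for k using h_pos[OF j] that by simp
  have hq: "h k ?q > 0" if "k < n" "k \<noteq> i" for k using h_pos[OF i] that by simp
  have ne: "?y \<noteq> ?q" "?y \<noteq> - ?q" using hy[OF i(1) ij] by (auto simp: h_linear)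
  obtain v r where v: "(?q, v) \<in> unit_tangent K" "?y = geo K ?q v r" "0 < r" "K > 0 \<Longrightarrow> r < pi / sqrt K"
    using polar[OF E_surface[OF i(1)] E_surface[OF j(1)] ne] by metis
  have sr: "sinK K r > 0" using sinK_pos v(3,4) by blast
  have "sinK K r * h i v > 0" using hy[OF i(1) ij] v(2) by (simp add: h_geo)
  then have hv: "h i v > 0" using sr by (simp add: zero_less_mult_iff)
  let ?w = "geo_vel K ?q v r"
  have shift: "geo K ?q v a = geo K ?y ?w (a - r)" for a
    using geo_add[of K ?q v r "a - r"] v(2) by simp
  have hj: "h j (geo K ?q v a) = sinK K (a - r) * h j ?w" for a
    unfolding shift by (simp add: h_geo)
  have "sinK K (- r) * h j ?w > 0" using hj[of 0] hq[OF j(1)] ij by simp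
  then have hw: "h j ?w < 0" using sr by (simp add: mult_less_0_iff)
  have chord: "is_chord K D (geodesic K ?q v) ?q v r"
  proof (rule chordI[OF v(1) qD])
    have "h j (- ?q) < 0" using hq[OF j(1)] ij by (simp add: h_linear)
    then show "- ?q \<notin> D" using h_nonneg[OF j(1), of "- ?q"] by linarith
    show "0 \<le> r" using v(3) by simp
    show "K > 0 \<Longrightarrow> r < pi / sqrt K" by (rule v(4))
    show "geo K ?q v ` {0..r} \<subseteq> D"
      using between_in_D[OF v(1) qD _ v(3,4)] yD v(2) by auto
    show "0 \<le> sinK K a" if "geo K ?q v a \<in> D" for a
      using h_nonneg[OF i(1) that] hv by (simp add: h_geo zero_le_mult_iff)
    show "a \<le> r" if "0 < a" "K > 0 \<Longrightarrow> a < pi / sqrt K" "geo K ?q v a \<in> D" for a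
    proof (rule ccontr)
      assume "\<not> a \<le> r"
      then have "sinK K (a - r) > 0" using that(2) v(3) by (intro sinK_pos) force+
      moreover have "0 \<le> sinK K (a - r) * h j ?w" using h_nonneg[OF j(1) that(3)] hj by simp
      ultimately show False using hw by (simp add: zero_le_mult_iff)
    qed
  qed
  have inner: "h k (geo K ?q v \<tau>) > 0" if \<tau>: "0 < \<tau>" "\<tau> < r" and k: "k < n" for \<tau> k
  proof -
    have "sinK K r * h k (geo K ?q v \<tau>) = sinK K (r - \<tau>) * h k ?q + sinK K \<tau> * h k ?y"
      using arg_cong[OF geo_between[of K r ?q v \<tau>], of "h k"] v(2) by (simp add: h_linear)
    moreover have "0 < sinK K \<tau>" "0 < sinK K (r - \<tau>)" using \<tau> v(4) by (force intro!: sinK_pos)+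
    moreover have "0 \<le> h k ?q" "0 \<le> h k ?y" "0 < h k ?q \<or> 0 < h k ?y"
      using hq[OF k] hy[OF k] h_nonneg[OF k qD] h_nonneg[OF k yD] ij by auto
    ultimately have "0 < sinK K r * h k (geo K ?q v \<tau>)"
      by (metis add_nonneg_pos add_pos_nonneg less_imp_le mult_nonneg_nonneg mult_pos_pos)
    then show ?thesis using sr by (simp add: zero_less_mult_iff)
  qed
  show thesis by (rule that[OF v hv hw chord inner])
qed

section \<open>Angles of a chord\<close>

text \<open>A geodesic that stays in the boundary on both sides cannot change the sign of
  \<open>h i\<close>, so its direction lies in the plane of the edge.\<close>

lemma bdry_tangent_edge:
  assumes i: "i < n" "0 < s" "s < L i"
  shows "bdry_tangent K D (E i s) u \<longleftrightarrow> u = E' i s \<or> u = - E' i s"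
proof
  have T: "(E i s, E' i s) \<in> unit_tangent K" by (rule geo_unit_tangent[OF vertex_unit_tangent[OF i(1)]])
  {
    assume "bdry_tangent K D (E i s) u"
    then obtain \<epsilon> where u: "(E i s, u) \<in> unit_tangent K" and \<epsilon>: "\<epsilon> > 0" "geo K (E i s) u ` {-\<epsilon><..<\<epsilon>} \<subseteq> bdry K D"
      by (auto simp: bdry_tangent_def)
    obtain \<tau> where \<tau>: "0 < \<tau>" "\<tau> < \<epsilon>" "sinK K \<tau> > 0" by (rule small_step[OF \<epsilon>(1)])
    have "geo K (E i s) u \<tau> \<in> D" "geo K (E i s) u (- \<tau>) \<in> D"
      using \<epsilon>(2) bdry_subset \<tau> by (auto simp: image_subset_iff)
    then have "0 \<le> sinK K \<tau> * h i u" "0 \<le> - (sinK K \<tau> * h i u)"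
      using h_nonneg[OF i(1), of "geo K (E i s) u \<tau>"] h_nonneg[OF i(1), of "geo K (E i s) u (- \<tau>)"]
      by (simp_all add: h_geo[where p = "E i s"])
    then have "h i u = 0" using \<tau>(3) by (simp add: zero_le_mult_iff mult_le_0_iff)
    then have "det3 (E i s) (E' i s) u = 0" by (simp add: h_g g_det[of i u s])
    then show "u = E' i s \<or> u = - E' i s" by (rule unit_tangent_parallel[OF T u])
  }
  assume u: "u = E' i s \<or> u = - E' i s"
  define \<epsilon> where "\<epsilon> = min s (L i - s)"
  have \<epsilon>: "\<epsilon> > 0" using i by (simp add: \<epsilon>_def)
  have "geo K (E i s) u x \<in> bdry K D" if "x \<in> {-\<epsilon><..<\<epsilon>}" for x
  proof -
    have "geo K (E i s) u x = E i (s + x) \<or> geo K (E i s) u x = E i (s + - x)"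
      using u by (auto simp: geo_add geo_uminus)
    moreover have "0 \<le> s + x" "s + x \<le> L i" "0 \<le> s + - x" "s + - x \<le> L i" using that by (auto simp: \<epsilon>_def)
    ultimately show ?thesis using edge_in_bdry[OF i(1)] by metis
  qed
  moreover have "(E i s, u) \<in> unit_tangent K" using u T unit_tangent_uminus[OF T] by auto
  ultimately show "bdry_tangent K D (E i s) u" unfolding bdry_tangent_def using \<epsilon> by blast
qed

text \<open>The sines of the angles are \<open>h i v\<close> and \<open>- h j w\<close>. The edge
  directions lie on opposite sides of the chord (\<open>opp\<close>), so the choice of a common side
  reverses exactly one of them. As the chord direction is reversed at the second end, too, the two
  cosines are \<open>a\<close>, \<open>b\<close> or \<open>- a\<close>, \<open>- b\<close>.\<close>

lemma cot_angles_pair: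
  assumes i: "i < n" "0 < s" "s < L i" and j: "j < n" "0 < t" "t < L j"
    and v: "(E i s, v) \<in> unit_tangent K" "E j t = geo K (E i s) v r" and hv: "h i v > 0"
    and hw: "h j (geo_vel K (E i s) v r) < 0"
    and N: "orthonormal_frame K (E i s) v N"
    and u1: "bdry_tangent K D (E i s) u1" "riem K u1 N > 0"
    and u2: "bdry_tangent K D (E j t) u2" "riem K u2 N > 0"
  shows "cot (angle K u1 v) * cot (angle K u2 (- geo_vel K (E i s) v r)) =
    riem K (E' i s) v * riem K (E' j t) (geo_vel K (E i s) v r) / (h i v * - h j (geo_vel K (E i s) v r))"
proof -
  let ?q = "E i s" and ?y = "E j t"
  define T where "T = E' i s"
  define T' where "T' = E' j t"
  define w where "w = geo_vel K ?q v r"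
  define a where "a = riem K T v"
  define b where "b = riem K T' w"
  have T: "(?q, T) \<in> unit_tangent K" unfolding T_def by (rule geo_unit_tangent[OF vertex_unit_tangent[OF i(1)]])
  have T': "(?y, T') \<in> unit_tangent K" unfolding T'_def by (rule geo_unit_tangent[OF vertex_unit_tangent[OF j(1)]])
  have w: "(?y, w) \<in> unit_tangent K" using geo_unit_tangent[OF v(1)] v(2) unfolding w_def by simp
  have a2: "a\<^sup>2 + (h i v)\<^sup>2 = 1"
    using unit_tangent_components(2,3)[OF nrm[OF T] v(1)] orient
    by (auto simp: a_def h_def g_det[of i v s] T_def)
  have b2: "b\<^sup>2 + (h j w)\<^sup>2 = 1"
    using unit_tangent_components(2,3)[OF nrm[OF T'] w] orient
    by (auto simp: b_def h_def g_det[of j w t] T'_def)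
  note fr = nrm[OF v(1)]
  have fr': "orthonormal_frame K ?y w (nrm K ?q v)" "det3 ?y w (nrm K ?q v) = 1"
    using frame_transport[OF fr(1), of r] det3_geo[of K ?q v r] fr(2) v(2) unfolding w_def by simp_all
  have r1: "riem K T (nrm K ?q v) = - g i v"
    using unit_tangent_components(4)[OF fr T] by (simp add: g_det[of i v s] T_def[symmetric] det3_swap(2)[of ?q v])
  have r2: "riem K T' (nrm K ?q v) = - g j w"
    using unit_tangent_components(4)[OF fr' T'] by (simp add: g_det[of j w t] T'_def[symmetric] det3_swap(2)[of ?y w])
  have opp: "riem K T N * riem K T' N < 0"
  proof -
    have "riem K T N * riem K T' N = g i v * g j w"
      using frame_normal_unique[OF N] r1 r2 by (auto simp: riem_linear)
    also have "\<dots> = h i v * h j w" by (simp add: h_g)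
    finally show ?thesis using hv hw by (simp add: w_def mult_pos_neg)
  qed
  have u1': "u1 = T \<or> u1 = - T" using u1(1) bdry_tangent_edge[OF i] by (simp add: T_def)
  have u2': "u2 = T' \<or> u2 = - T'" using u2(1) bdry_tangent_edge[OF j] by (simp add: T'_def)
  have "(u1 = T \<and> u2 = - T') \<or> (u1 = - T \<and> u2 = T')"
    using u1' u2' u1(2) u2(2) opp by (auto simp: riem_linear mult_less_0_iff)
  then have c: "(riem K u1 v = a \<and> riem K u2 (- w) = b) \<or> (riem K u1 v = - a \<and> riem K u2 (- w) = - b)"
    by (auto simp: riem_linear a_def b_def)
  have sq: "sqrt (1 - a\<^sup>2) = h i v" "sqrt (1 - b\<^sup>2) = - h j w"
    using a2 b2 hv hw by (auto simp: w_def[symmetric] intro!: real_sqrt_unique)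
  have le: "\<bar>a\<bar> \<le> 1" "\<bar>b\<bar> \<le> 1"
    using a2 b2 zero_le_power2[of "h i v"] zero_le_power2[of "h j w"]
    unfolding abs_square_le_1[symmetric] by linarith+
  have "cot (angle K u1 v) * cot (angle K u2 (- w)) = a / sqrt (1 - a\<^sup>2) * (b / sqrt (1 - b\<^sup>2))"
    using c le by (auto simp: angle_def cot_arccos)
  also have "\<dots> = a * b / (h i v * - h j w)" unfolding sq by simp
  finally show ?thesis by (simp only: a_def b_def T_def T'_def w_def)
qed

text \<open>The value of \<open>SOME\<close> is controlled by showing that every admissible pair has
  this product and that one exists. Exchanging the ends of the chord only exchanges the
  factors.\<close>

lemma cot_chord_angles_pair:
  assumes i: "i < n" "0 < s" "s < L i" and j: "j < n" "0 < t" "t < L j"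
    and v: "(E i s, v) \<in> unit_tangent K" "E j t = geo K (E i s) v r" and r: "K > 0 \<Longrightarrow> r < pi / sqrt K"
    and hv: "h i v > 0" and hw: "h j (geo_vel K (E i s) v r) < 0"
    and chord: "is_chord K D \<gamma> (E i s) v r"
  shows "cot (chord_angle1 K D \<gamma>) * cot (chord_angle2 K D \<gamma>) =
    riem K (E' i s) v * riem K (E' j t) (geo_vel K (E i s) v r) / (h i v * - h j (geo_vel K (E i s) v r))"
    (is "_ = ?F")
proof -
  let ?q = "E i s" and ?y = "E j t" and ?w = "geo_vel K (E i s) v r"
  have r2: "K > 0 \<Longrightarrow> r < 2 * pi / sqrt K" using r by (smt (verit) divide_right_mono pi_gt_zero real_sqrt_ge_zero)
  have all: "cot a1 * cot a2 = ?F" if c: "is_chord_angles K D \<gamma> a1 a2" for a1 a2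
  proof -
    obtain p v' r' N u1 u2 where d: "is_chord K D \<gamma> p v' r'" "orthonormal_frame K p v' N"
      "bdry_tangent K D p u1" "riem K u1 N > 0" "bdry_tangent K D (geo K p v' r') u2" "riem K u2 N > 0"
      "a1 = angle K u1 v'" "a2 = angle K u2 (- geo_vel K p v' r')"
      using c unfolding is_chord_angles_def by blast
    have r': "r' = r" by (rule is_chord_unique(1)[OF chord d(1) r2])
    consider "p = ?q" "v' = v" | "p = ?y" "v' = - ?w"
      using is_chord_unique(2)[OF chord d(1) r2] v(2) by auto
    then show ?thesis
    proof cases
      case 1
      then show ?thesis
        using cot_angles_pair[OF i j v hv hw, of N u1 u2] d r' v(2) by simp
    next
      case 2
      have e: "geo K p v' r' = ?q" "geo_vel K p v' r' = - v"
        using 2 r' v(2) geo_add[of K ?q v r "- r"] geo_vel_add[of K ?q v r "- r"] by (simp_all add: geo_uminus)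
      have "orthonormal_frame K ?q (- v) N" using frame_transport[OF d(2), of r'] e by simp
      then have N: "orthonormal_frame K ?q v N"
        using unit_tangent_uminus[of ?q "- v" K] by (auto simp: orthonormal_frame_def riem_linear)
      show ?thesis
        using cot_angles_pair[OF i j v hv hw N, of u2 u1] d e 2 by (simp add: mult.commute)
    qed
  qed
  have ex: "\<exists>x. case x of (a1, a2) \<Rightarrow> is_chord_angles K D \<gamma> a1 a2"
  proof -
    define N where "N = nrm K ?q v"
    note fr = nrm[OF v(1), folded N_def]
    have T: "(?q, E' i s) \<in> unit_tangent K" by (rule geo_unit_tangent[OF vertex_unit_tangent[OF i(1)]])
    have T': "(?y, E' j t) \<in> unit_tangent K" by (rule geo_unit_tangent[OF vertex_unit_tangent[OF j(1)]])
    have fr': "orthonormal_frame K ?y ?w N" "det3 ?y ?w N = 1"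
      using frame_transport[OF fr(1), of r] det3_geo[of K ?q v r] fr(2) v(2) by simp_all
    have r1: "riem K (E' i s) N = - g i v"
      using unit_tangent_components(4)[OF fr T] by (simp add: g_det[of i v s] det3_swap(2)[of ?q v])
    have r2: "riem K (E' j t) N = - g j ?w"
      using unit_tangent_components(4)[OF fr' T'] by (simp add: g_det[of j ?w t] det3_swap(2)[of ?y ?w])
    \<comment> \<open>The signs turn both edge directions to the side of \<open>N\<close>, whichever
      way the edges run around \<open>D\<close>.\<close>
    have "riem K (- orient *\<^sub>R E' i s) N > 0" "riem K (orient *\<^sub>R E' j t) N > 0"
      using hv hw r1 r2 by (simp_all add: riem_linear h_def)
    moreover have "bdry_tangent K D ?q (- orient *\<^sub>R E' i s)" "bdry_tangent K D ?y (orient *\<^sub>R E' j t)"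
      using orient by (auto simp: bdry_tangent_edge[OF i] bdry_tangent_edge[OF j])
    ultimately have "is_chord_angles K D \<gamma> (angle K (- orient *\<^sub>R E' i s) v) (angle K (orient *\<^sub>R E' j t) (- ?w))"
      unfolding is_chord_angles_def using chord fr(1) v(2) by metis
    then show ?thesis by (metis case_prodI)
  qed
  have "is_chord_angles K D \<gamma> (chord_angle1 K D \<gamma>) (chord_angle2 K D \<gamma>)"
  proof -
    define z where "z = chord_angles K D \<gamma>"
    have "case z of (a1, a2) \<Rightarrow> is_chord_angles K D \<gamma> a1 a2"
      unfolding z_def chord_angles_def by (rule someI_ex[OF ex])
    then show ?thesis
      unfolding chord_angle1_def chord_angle2_def z_def[symmetric] by (simp add: case_prod_beta)
  qed
  then show ?thesis by (rule all)
qed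

section \<open>Vertices and lunes\<close>

lemma vertex_direction:
  assumes k: "k < n" and u: "(P k, u) \<in> unit_tangent K" and 0: "h k u = 0"
  shows "h (pred k) u \<noteq> 0"
proof -
  have "u = V k \<or> u = - V k"
    using unit_tangent_parallel[OF vertex_unit_tangent[OF k] u] 0 by (simp add: h_g g_def)
  then show ?thesis using turn_pred(2)[OF k] by (auto simp: h_linear)
qed

text \<open>Both adjacent functionals vanish at the vertex, and a geodesic passing through it inside
  \<open>D\<close> would make them vanish on its direction; but the two edges are not
  parallel.\<close>

lemma vertex_extreme:
  assumes k: "k < n" and u: "(P k, u) \<in> unit_tangent K" and \<epsilon>: "\<epsilon> > 0"
    and D: "geo K (P k) u ` {-\<epsilon><..<\<epsilon>} \<subseteq> D"
  shows False
proof -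
  obtain \<tau> where \<tau>: "0 < \<tau>" "\<tau> < \<epsilon>" "sinK K \<tau> > 0" by (rule small_step[OF \<epsilon>])
  have *: "geo K (P k) u \<tau> \<in> D" "geo K (P k) u (- \<tau>) \<in> D"
    using D \<tau> by (auto simp: image_subset_iff)
  have "h m u = 0" if m: "m < n" "h m (P k) = 0" for m
  proof -
    have "0 \<le> sinK K \<tau> * h m u" "0 \<le> - (sinK K \<tau> * h m u)"
      using h_nonneg[OF m(1) *(1)] h_nonneg[OF m(1) *(2)] m(2) by (simp_all add: h_geo)
    then show ?thesis using \<tau>(3) by (simp add: zero_le_mult_iff mult_le_0_iff)
  qed
  from this[OF k] this[OF pred(1)[OF k] turn_pred(1)[OF k]] show False
    using vertex_direction[OF k u] by simp
qed

text \<open>By \<open>vertex_extreme\<close>, a chord ending at a vertex has no boundary tangent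
  there, and no chord has a vertex in its interior.\<close>

lemma no_chord_angles_vertex:
  assumes k: "k < n" and P: "P k \<in> \<gamma>"
  shows "\<not> is_chord_angles K D \<gamma> a1 a2"
proof
  assume "is_chord_angles K D \<gamma> a1 a2"
  then obtain p v r u1 u2 where c: "is_chord K D \<gamma> p v r"
    and u1: "bdry_tangent K D p u1" and u2: "bdry_tangent K D (geo K p v r) u2"
    unfolding is_chord_angles_def by blast
  have pv: "(p, v) \<in> unit_tangent K" and D: "\<gamma> \<inter> D = geo K p v ` {0..r}"
    using c unfolding is_chord_def by blast+
  have nt: False if b: "bdry_tangent K D (P k) u" for u
  proof -
    obtain \<epsilon> where "(P k, u) \<in> unit_tangent K" "\<epsilon> > 0" "geo K (P k) u ` {-\<epsilon><..<\<epsilon>} \<subseteq> bdry K D"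
      using b unfolding bdry_tangent_def by blast
    then show False using vertex_extreme[OF k] bdry_subset by (meson order_trans)
  qed
  have "P k \<in> \<gamma> \<inter> D" using P P_in_D[OF k] by blast
  then obtain \<tau> where \<tau>: "0 \<le> \<tau>" "\<tau> \<le> r" "P k = geo K p v \<tau>" unfolding D by auto
  consider "\<tau> = 0" | "\<tau> = r" | "0 < \<tau>" "\<tau> < r" using \<tau> by linarith
  then show False
  proof cases
    case 1
    then show False using nt u1 \<tau>(3) by simp
  next
    case 2
    then show False using nt u2 \<tau>(3) by simp
  next
    case 3
    have "geo K (P k) (geo_vel K p v \<tau>) x \<in> D" if "x \<in> {- min \<tau> (r - \<tau>)<..<min \<tau> (r - \<tau>)}" for x
    proof -
      have "geo K p v (\<tau> + x) \<in> geo K p v ` {0..r}" using that 3 by (intro imageI) auto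
      then show ?thesis using D \<tau>(3) by (simp add: geo_add) blast
    qed
    then have "geo K (P k) (geo_vel K p v \<tau>) ` {- min \<tau> (r - \<tau>)<..<min \<tau> (r - \<tau>)} \<subseteq> D"
      by (rule image_subsetI)
    moreover have "(P k, geo_vel K p v \<tau>) \<in> unit_tangent K" using geo_unit_tangent[OF pv, of \<tau>] \<tau>(3) by simp
    ultimately show False using vertex_extreme[OF k, of "geo_vel K p v \<tau>" "min \<tau> (r - \<tau>)"] 3 by simp
  qed
qed

lemma chord_angles_vertex:
  assumes "k < n" "P k \<in> \<gamma>"
  shows "chord_angles K D \<gamma> = (SOME (a1, a2). False)"
proof -
  have "is_chord_angles K D \<gamma> = (\<lambda>a1 a2. False)"
    using no_chord_angles_vertex[OF assms] by (intro ext) blast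
  then show ?thesis unfolding chord_angles_def by simp
qed

text \<open>The length is the supremum of the times in \<open>D\<close>, restricted to half a period
  for \<open>K > 0\<close>. It is attained by closedness, and below half a period because the
  antipode is outside \<open>D\<close>. Backwards, an adjacent functional that is positive on
  \<open>u\<close> keeps the geodesic out of \<open>D\<close>.\<close>

lemma vertex_chord:
  assumes k: "k < n" and u: "(P k, u) \<in> unit_tangent K" and anti: "- P k \<notin> D"
    and nn: "0 \<le> h k u" "0 \<le> h (pred k) u"
  obtains r where "0 \<le> r" "K > 0 \<Longrightarrow> r < pi / sqrt K" "is_chord K D (geodesic K (P k) u) (P k) u r"
proof -
  define R where "R = {r. 0 \<le> r \<and> (K > 0 \<longrightarrow> r \<le> pi / sqrt K) \<and> geo K (P k) u r \<in> D}"
  have 0: "0 \<in> R" using P_in_D[OF k] by (auto simp: R_def)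
  have lt: "r < pi / sqrt K" if "r \<in> R" "K > 0" for r
  proof -
    have "r \<noteq> pi / sqrt K" using that anti by (auto simp: R_def geo_def half_period)
    then show ?thesis using that by (auto simp: R_def)
  qed
  have bdd: "bdd_above R"
  proof (cases "K > 0")
    case True
    then show ?thesis by (intro bdd_aboveI[of _ "pi / sqrt K"]) (simp add: R_def)
  next
    case False
    then obtain t where t: "t \<ge> 0" "geo K (P k) u t \<notin> D" using exit_nonpos[OF u] by auto
    have "r \<le> t" if "r \<in> R" for r
    proof (rule ccontr)
      assume "\<not> r \<le> t"
      then show False using between_in_D[OF u P_in_D[OF k], of r t] that t False by (auto simp: R_def)
    qed
    then show ?thesis by (rule bdd_aboveI)
  qed
  have "closed R"
  proof -
    have "closed {r. 0 \<le> r \<and> (K > 0 \<longrightarrow> r \<le> pi / sqrt K)}"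
      by (cases "K > 0") (auto intro!: closed_Collect_conj closed_Collect_le continuous_intros)
    moreover have "closed (geo K (P k) u -` D)"
      using D_compact by (intro closed_vimage compact_imp_closed) (auto intro!: continuous_intros)
    ultimately have "closed ({r. 0 \<le> r \<and> (K > 0 \<longrightarrow> r \<le> pi / sqrt K)} \<inter> geo K (P k) u -` D)" by (rule closed_Int)
    also have "\<dots> = R" by (auto simp: R_def)
    finally show ?thesis .
  qed
  then have SR: "Sup R \<in> R" using 0 bdd by (intro closed_contains_Sup) auto
  have RD: "0 \<le> r" "geo K (P k) u r \<in> D" if "r \<in> R" for r using that by (simp_all add: R_def)
  note S = RD(1)[OF SR] lt[OF SR]
  have "is_chord K D (geodesic K (P k) u) (P k) u (Sup R)"
  proof (rule chordI[OF u P_in_D[OF k] anti S])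
    show "geo K (P k) u ` {0..Sup R} \<subseteq> D"
    proof (cases "Sup R = 0")
      case True
      then show ?thesis using P_in_D[OF k] by simp
    next
      case False
      then have "0 < Sup R" using S(1) by simp
      from between_in_D[OF u P_in_D[OF k] RD(2)[OF SR] this S(2)] show ?thesis by auto
    qed
    show "0 \<le> sinK K t" if t: "geo K (P k) u t \<in> D" for t
    proof -
      have "0 \<le> sinK K t * h k u" "0 \<le> sinK K t * h (pred k) u"
        using h_nonneg[OF k t] h_nonneg[OF pred(1)[OF k] t] turn_pred(1)[OF k] by (simp_all add: h_geo)
      moreover have "h k u > 0 \<or> h (pred k) u > 0" using nn vertex_direction[OF k u] by linarith
      ultimately show ?thesis by (auto simp: zero_le_mult_iff)
    qed
    show "t \<le> Sup R" if "0 < t" "K > 0 \<Longrightarrow> t < pi / sqrt K" "geo K (P k) u t \<in> D" for t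
    proof (rule cSup_upper[OF _ bdd])
      show "t \<in> R" using that by (simp add: R_def less_imp_le)
    qed
  qed
  then show thesis using that S by blast
qed

text \<open>If the adjacent functionals have no opposite signs on \<open>u\<close>, then
  \<open>u\<close> or \<open>- u\<close> is a direction for \<open>vertex_chord\<close>. With
  opposite signs the geodesic only touches \<open>D\<close> at the vertex, and the chord has length
  \<open>0\<close>.\<close>

lemma vertex_geodesic_chord:
  assumes k: "k < n" and u: "(P k, u) \<in> unit_tangent K" and anti: "- P k \<notin> D"
  obtains v r where "0 \<le> r" "K > 0 \<Longrightarrow> r < pi / sqrt K" "is_chord K D (geodesic K (P k) u) (P k) v r"
proof -
  consider "0 \<le> h k u" "0 \<le> h (pred k) u" | "0 \<le> h k (- u)" "0 \<le> h (pred k) (- u)"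
    | "h k u * h (pred k) u < 0"
    by (simp add: h_linear mult_less_0_iff) linarith
  then show thesis
  proof cases
    case 1
    then show ?thesis using vertex_chord[OF k u anti] that by metis
  next
    case 2
    then show ?thesis using vertex_chord[OF k unit_tangent_uminus[OF u] anti] that geodesic_uminus by metis
  next
    case 3
    have s0: "sinK K t = 0" if t: "geo K (P k) u t \<in> D" for t
    proof -
      have "0 \<le> sinK K t * h k u" "0 \<le> sinK K t * h (pred k) u"
        using h_nonneg[OF k t] h_nonneg[OF pred(1)[OF k] t] turn_pred(1)[OF k] by (simp_all add: h_geo)
      then show ?thesis using 3 by (auto simp: zero_le_mult_iff mult_less_0_iff)
    qed
    have "is_chord K D (geodesic K (P k) u) (P k) u 0"
    proof (rule chordI[OF u P_in_D[OF k] anti])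
      show "t \<le> 0" if "0 < t" "K > 0 \<Longrightarrow> t < pi / sqrt K" "geo K (P k) u t \<in> D" for t
        using sinK_pos[OF that(1,2)] s0[OF that(3)] by simp
    qed (use P_in_D[OF k] s0 in auto)
    then show ?thesis by (rule that[rotated 2]) auto
  qed
qed

lemma lune_vertex:
  assumes k: "k < n" and anti: "- P k \<in> D"
  shows "K > 0" "m < n \<Longrightarrow> h m (P k) = 0"
proof -
  show "K > 0" using surface_uminus[of "P k" K] anti P_in_D[OF k] D_surface by force
  show "h m (P k) = 0" if "m < n"
    using h_nonneg[OF that anti] h_nonneg[OF that P_in_D[OF k]] by (simp add: h_linear)
qed

text \<open>All functionals vanish at the vertex, so membership in \<open>D\<close> along a geodesic
  from it depends only on the sign of \<open>sinK\<close>; a chord that contains a further point is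
  a full half circle.\<close>

lemma lune_chord:
  assumes k: "k < n" and anti: "- P k \<in> D" and u: "(P k, u) \<in> unit_tangent K"
    and y: "y \<in> geodesic K (P k) u" "y \<in> D" "y \<noteq> P k" "y \<noteq> - P k"
  shows "chord_length K D (geodesic K (P k) u) = pi / sqrt K"
proof -
  note K = lune_vertex(1)[OF k anti] and h0 = lune_vertex(2)[OF k anti]
  have Ps: "P k \<in> surface K" using P_in_D[OF k] D_surface by blast
  have ys: "y \<in> surface K" using y D_surface by blast
  obtain v r where v: "(P k, v) \<in> unit_tangent K" "y = geo K (P k) v r" "0 < r" "K > 0 \<Longrightarrow> r < pi / sqrt K"
    using polar[OF Ps ys y(3,4)] by metis
  have sr: "sinK K r > 0" using sinK_pos v(3,4) by blast
  have par: "w = u \<or> w = - u" if "(P k, w) \<in> unit_tangent K" "sinK K a > 0" "geo K (P k) w a \<in> geodesic K (P k) u" for w a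
  proof -
    have "det3 (P k) u (geo K (P k) w a) = 0" using geodesic_iff[OF u geo_in_surface[OF that(1)]] that(3) by simp
    then have "det3 (P k) u w = 0" using that(2) by (simp add: geo_def det3_linear)
    then show ?thesis by (rule unit_tangent_parallel[OF u that(1)])
  qed
  have vu: "v = u \<or> v = - u" using par[OF v(1) sr] v(2) y(1) by simp
  then have g: "geodesic K (P k) u = geodesic K (P k) v" using geodesic_uminus by metis
  have hv: "0 \<le> h m v" if "m < n" for m
    using h_nonneg[OF that y(2)] v(2) sr h0[OF that] by (simp add: h_geo zero_le_mult_iff)
  have "is_chord K D (geodesic K (P k) v) (P k) v (pi / sqrt K)"
  proof -
    have "geo K (P k) v t \<in> D" if "0 \<le> t" "t \<le> pi / sqrt K" for t
      using hv sinK_nonneg[of t K] that h0 by (auto simp: in_D_iff[OF geo_in_surface[OF v(1)]] h_geo)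
    then have "geo K (P k) v ` {0..pi / sqrt K} \<subseteq> D" by (intro image_subsetI) simp
    moreover have "x \<in> geo K (P k) v ` {0..pi / sqrt K}" if x: "x \<in> geodesic K (P k) v" "x \<in> D" for x
    proof -
      consider "x = P k" | "x = - P k" | "x \<noteq> P k" "x \<noteq> - P k" by blast
      then show ?thesis
      proof cases
        case 1
        then show ?thesis using K by (intro image_eqI[of _ _ 0]) auto
      next
        case 2
        then show ?thesis using K by (intro image_eqI[of _ _ "pi / sqrt K"]) (auto simp: geo_def half_period)
      next
        case 3
        have xs: "x \<in> surface K" using x D_surface by blast
        obtain w t where w: "(P k, w) \<in> unit_tangent K" "x = geo K (P k) w t" "0 < t" "K > 0 \<Longrightarrow> t < pi / sqrt K"
          using polar[OF Ps xs 3] by metis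
        have st: "sinK K t > 0" using sinK_pos w(3,4) by blast
        have "w = u \<or> w = - u" using par[OF w(1) st] w(2) x(1) g by simp
        then have "w = v \<or> w = - v" using vu by auto
        moreover have "w \<noteq> - v"
        proof
          assume wv: "w = - v"
          have "h m v = 0" if m: "m < n" for m
          proof -
            have "0 \<le> sinK K t * - h m v"
              using h_nonneg[OF m x(2)] w(2) h0[OF m] wv by (simp add: h_geo h_linear)
            then show ?thesis using hv[OF m] st by (simp add: zero_le_mult_iff mult_le_0_iff)
          qed
          then show False using vertex_direction[OF k v(1)] k pred(1)[OF k] by simp
        qed
        ultimately show ?thesis using w K by (intro image_eqI[of _ _ t]) auto
      qed
    qed
    ultimately have "geodesic K (P k) v \<inter> D = geo K (P k) v ` {0..pi / sqrt K}"
      unfolding geodesic_def by blast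
    then show ?thesis using v(1) K by (simp add: is_chord_def)
  qed
  then have "chord_length K D (geodesic K (P k) v) = pi / sqrt K"
    using K by (intro chord_length_eq) (auto simp: divide_strict_right_mono)
  then show ?thesis using g by simp
qed

text \<open>The intersection with \<open>D\<close> consists of two antipodal points; it is
  disconnected, so that no segment describes it.\<close>

lemma lune_no_chord:
  assumes k: "k < n" and anti: "- P k \<in> D" and g: "P k \<in> \<gamma>" "\<gamma> \<in> geodesics K"
    and no: "\<And>y. y \<in> \<gamma> \<Longrightarrow> y \<in> D \<Longrightarrow> y = P k \<or> y = - P k"
  shows "chord_length K D \<gamma> = (THE r. False)"
proof -
  have Ps: "P k \<in> surface K" using P_in_D[OF k] D_surface by blast
  have ne: "P k \<noteq> - P k"
  proof
    assume e: "P k = - P k"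
    have "quad K (P k) (P k) = 1" "quad K (- P k) (P k) = - 1" using Ps by (simp_all add: surface_def quad_linear)
    then show False using e by simp
  qed
  obtain p v where pv: "(p, v) \<in> unit_tangent K" "\<gamma> = geodesic K p v" using g(2) by (auto simp: geodesics_def)
  have as: "- P k \<in> surface K" using anti D_surface by blast
  have "det3 p v (P k) = 0" using g(1) geodesic_iff[OF pv(1) Ps] pv(2) by simp
  then have "- P k \<in> \<gamma>" using geodesic_iff[OF pv(1) as] pv(2) by (simp add: det3_linear)
  then have G: "\<gamma> \<inter> D = {P k, - P k}" using no g(1) anti P_in_D[OF k] by blast
  have "\<not> is_chord K D \<gamma> q w r" for q w r
  proof
    assume "is_chord K D \<gamma> q w r"
    then have "\<gamma> \<inter> D = geo K q w ` {0..r}" unfolding is_chord_def by blast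
    moreover have "connected (geo K q w ` {0..r})"
      by (intro connected_continuous_image continuous_intros connected_Icc)
    ultimately have "connected {P k, - P k}" using G by simp
    then show False using connected_finite_iff_sing[of "{P k, - P k}"] ne by auto
  qed
  then show ?thesis unfolding chord_length_def by simp
qed

end

section \<open>First variation of the chord length\<close>

lemma continuous_on_argK [continuous_intros]:
  assumes "continuous_on X a" "continuous_on X b" "\<And>x. x \<in> X \<Longrightarrow> K > 0 \<Longrightarrow> \<bar>a x\<bar> \<le> 1"
  shows "continuous_on X (\<lambda>x. argK K (a x) (b x))"
proof -
  consider "K > 0" | "K = 0" | "K < 0" by linarith
  then show ?thesis
  proof cases
    case 1
    have "continuous_on X (\<lambda>x. arccos (a x) / sqrt K)"
      using assms(1,3) 1 by (intro continuous_intros) (auto simp: abs_le_iff)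
    then show ?thesis using 1 by (simp add: argK_def)
  next
    case 2
    then show ?thesis using assms(2) by (simp add: argK_def)
  next
    case 3
    have "continuous_on X (\<lambda>x. sqrt (- K) * b x)" by (intro continuous_intros assms(2))
    then have "continuous_on X (\<lambda>x. arsinh (sqrt (- K) * b x) / sqrt (- K))"
      using 3 continuous_on_compose2[OF continuous_on_arsinh[of UNIV], of X "\<lambda>x. sqrt (- K) * b x"]
      by (intro continuous_on_divide continuous_on_const) auto
    then show ?thesis using 3 by (simp add: argK_def)
  qed
qed

lemma argK_cosK_sinK:
  assumes "0 < t" "K > 0 \<Longrightarrow> t < pi / sqrt K"
  shows "argK K (cosK K t) (sinK K t) = t"
proof -
  have "sinK K t > 0" using sinK_pos assms by blast
  note a = argK[OF cosK_sinK[of K t] this cosK_pos]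
  show ?thesis
  proof (rule cosK_sinK_eqD[OF a(1,2)])
    show "\<bar>argK K (cosK K t) (sinK K t) - t\<bar> < 2 * pi / sqrt K" if "K > 0"
    proof -
      have "2 * pi / sqrt K = pi / sqrt K + pi / sqrt K" by simp
      then show ?thesis using a(3) a(4)[OF _ that] that assms(1) assms(2)[OF that] by linarith
    qed
  qed auto
qed

text \<open>The conic \<open>A\<^sup>2 + K S\<^sup>2 = 1\<close> has velocity
  \<open>(- K S, A)\<close>, from which the speed of the argument is recovered as
  \<open>A S' - S A'\<close>. The relation \<open>orth\<close> is the derivative of the equation of
  the conic; it eliminates whichever of \<open>A'\<close> and \<open>S'\<close> does not occur in
  the derivative of \<open>arccos\<close> or \<open>arsinh\<close>.\<close>

lemma argK_has_derivative:
  assumes dA: "(A has_real_derivative A') (at t)" and dS: "(S has_real_derivative S') (at t)"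
    and eq: "\<And>x. (A x)\<^sup>2 + K * (S x)\<^sup>2 = 1" and S: "S t > 0" and A: "K \<le> 0 \<Longrightarrow> A t > 0"
  shows "((\<lambda>x. argK K (A x) (S x)) has_real_derivative A t * S' - S t * A') (at t)"
proof -
  have "((\<lambda>x. (A x)\<^sup>2 + K * (S x)\<^sup>2) has_real_derivative 2 * A t * A' + K * (2 * S t * S')) (at t)"
    by (auto intro!: derivative_eq_intros dA dS)
  moreover have "((\<lambda>x. (A x)\<^sup>2 + K * (S x)\<^sup>2) has_real_derivative 0) (at t)"
    unfolding eq by simp
  ultimately have orth: "A t * A' + K * (S t * S') = 0"
    using DERIV_unique by fastforce
  have one: "A t * A t + K * (S t * S t) = 1" using eq[of t] by (simp add: power2_eq_square)
  consider "K > 0" | "K = 0" | "K < 0" by linarith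
  then show ?thesis
  proof cases
    case 1
    have "1 - (A t)\<^sup>2 = (sqrt K * S t)\<^sup>2" using eq[of t] 1 by (simp add: power_mult_distrib)
    then have sq: "sqrt (1 - (A t)\<^sup>2) = sqrt K * S t" using 1 S by simp
    have "K * (S t)\<^sup>2 > 0" using 1 S by simp
    then have "(A t)\<^sup>2 < 1" using eq[of t] by linarith
    then have "- 1 < A t" "A t < 1" by (auto simp: abs_square_less_1)
    then have "((\<lambda>x. arccos (A x)) has_real_derivative inverse (- sqrt (1 - (A t)\<^sup>2)) * A') (at t)"
      by (intro DERIV_chain2[OF DERIV_arccos dA])
    then have "((\<lambda>x. arccos (A x) / sqrt K) has_real_derivative inverse (- sqrt (1 - (A t)\<^sup>2)) * A' / sqrt K) (at t)"
      by (rule DERIV_cdivide)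
    moreover have "inverse (- sqrt (1 - (A t)\<^sup>2)) * A' / sqrt K = A t * S' - S t * A'"
    proof -
      have "K * S t * (A t * S' - S t * A') = - A' * (A t * A t + K * (S t * S t))"
        using orth by (simp add: algebra_simps) algebra
      then have "A t * S' - S t * A' = - A' / (K * S t)" using 1 S one by (simp add: field_simps)
      moreover have "sqrt K * sqrt K = K" using 1 by simp
      moreover have "inverse (- (k * s)) * x / k = - x / (k * k * s)" for k s x :: real
        by (simp add: divide_inverse mult_ac)
      note this[of "sqrt K" "S t" A']
      ultimately show ?thesis unfolding sq by simp
    qed
    moreover have "(\<lambda>x. argK K (A x) (S x)) = (\<lambda>x. arccos (A x) / sqrt K)" using 1 by (simp add: argK_def)
    ultimately show ?thesis by simp
  next
    case 2
    have "A t = 1" using one A 2 by (simp add: square_eq_1_iff)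
    moreover have "A' = 0" using orth 2 calculation by simp
    ultimately show ?thesis using dS 2 by (simp add: argK_def)
  next
    case 3
    let ?k = "sqrt (- K)"
    have "(?k * S t)\<^sup>2 + 1 = (A t)\<^sup>2" using eq[of t] 3 by (simp add: power_mult_distrib)
    then have sq: "sqrt ((?k * S t)\<^sup>2 + 1) = A t" using A 3 by simp
    have d1: "((\<lambda>x. ?k * S x) has_real_derivative ?k * S') (at t)" by (rule DERIV_cmult[OF dS])
    have "((\<lambda>x. arsinh (?k * S x)) has_real_derivative 1 / sqrt ((?k * S t)\<^sup>2 + 1) * (?k * S')) (at t)"
      by (rule DERIV_chain2[OF arsinh_real_has_field_derivative d1])
    then have "((\<lambda>x. arsinh (?k * S x) / ?k) has_real_derivative 1 / sqrt ((?k * S t)\<^sup>2 + 1) * (?k * S') / ?k) (at t)"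
      by (rule DERIV_cdivide)
    moreover have "1 / sqrt ((?k * S t)\<^sup>2 + 1) * (?k * S') / ?k = A t * S' - S t * A'"
    proof -
      have "A t * (A t * S' - S t * A') = S' * (A t * A t + K * (S t * S t))"
        using orth by (simp add: algebra_simps) algebra
      then have "A t * S' - S t * A' = S' / A t" using 3 A one by (simp add: field_simps)
      then show ?thesis using 3 unfolding sq by simp
    qed
    moreover have "(\<lambda>x. argK K (A x) (S x)) = (\<lambda>x. arsinh (?k * S x) / ?k)" using 3 by (simp add: argK_def)
    ultimately show ?thesis by simp
  qed
qed

lemma det3_comb:
  assumes "det3 q T N = 1" "y = a *\<^sub>R q + b *\<^sub>R T + c *\<^sub>R N" "y' = a' *\<^sub>R q + b' *\<^sub>R T + c' *\<^sub>R N"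
  shows "det3 y y' q = b * c' - c * b'"
proof -
  have 1: "det3 T N q = 1" by (rule trans[OF det3_rotate assms(1)])
  moreover have "det3 N T q = - det3 T N q" by (rule det3_swap)
  ultimately show ?thesis unfolding assms(2,3) by (simp add: det3_linear algebra_simps)
qed

context polygon_domain
begin

section \<open>Coordinates of a chord in the frame of an edge\<close>

definition nu :: "nat \<Rightarrow> pt" where "nu i = nrm K (P i) (V i)"

text \<open>
  The coordinates of \<open>y\<close> in the frame of edge \<open>i\<close> at \<open>q = E i s\<close> are \<open>quad K q y\<close>, \<open>cB i s y\<close> and \<open>g i y\<close>.
  The distance of \<open>q\<close> and \<open>y\<close> is \<open>rho i s y\<close>, and \<open>cS i s y\<close> is its \<open>sinK\<close>. Up to a common sign, the angle
  of the chord from \<open>q\<close> to \<open>y\<close> with edge \<open>i\<close> has cosine \<open>cB / cS\<close> and sine \<open>g / cS\<close>.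
\<close>

definition cB :: "nat \<Rightarrow> real \<Rightarrow> pt \<Rightarrow> real" where "cB i s y = det3 (E i s) y (nu i)"
definition cS :: "nat \<Rightarrow> real \<Rightarrow> pt \<Rightarrow> real" where "cS i s y = sqrt ((cB i s y)\<^sup>2 + (g i y)\<^sup>2)"
definition rho :: "nat \<Rightarrow> real \<Rightarrow> pt \<Rightarrow> real" where "rho i s y = argK K (quad K (E i s) y) (cS i s y)"

lemma edge_frame:
  assumes "i < n"
  shows "orthonormal_frame K (E i s) (E' i s) (nu i)" "det3 (E i s) (E' i s) (nu i) = 1"
  unfolding nu_def using frame_transport[OF nrm(1)[OF vertex_unit_tangent[OF assms]], of s] nrm(2)[OF vertex_unit_tangent[OF assms]]
  by (simp_all add: det3_geo)

lemma edge_expansion: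
  assumes "i < n"
  shows "y = quad K (E i s) y *\<^sub>R E i s + cB i s y *\<^sub>R E' i s + g i y *\<^sub>R nu i"
proof -
  have "y = det3 y (E' i s) (nu i) *\<^sub>R E i s + cB i s y *\<^sub>R E' i s + g i y *\<^sub>R nu i"
    using frame_expansion[OF edge_frame(2)[OF assms, of s], of y] by (simp add: cB_def g_det[of i y s])
  moreover from this have "quad K (E i s) y = det3 y (E' i s) (nu i)"
    using frame_quad[OF edge_frame(1)[OF assms, of s], of 1 0 0 "det3 y (E' i s) (nu i)" "cB i s y" "g i y"] by simp
  ultimately show ?thesis by simp
qed

lemma edge_norm:
  assumes "i < n" "y \<in> surface K"
  shows "(quad K (E i s) y)\<^sup>2 + K * (cS i s y)\<^sup>2 = 1"
proof -
  have "quad K y y = (quad K (E i s) y)\<^sup>2 + K * (cS i s y)\<^sup>2"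
    using frame_quad[OF edge_frame(1)[OF assms(1), of s], of "quad K (E i s) y" "cB i s y" "g i y"
        "quad K (E i s) y" "cB i s y" "g i y"] edge_expansion[OF assms(1), of y s]
    by (simp add: cS_def power2_eq_square)
  then show ?thesis using assms(2) by (simp add: surface_def)
qed

text \<open>The determinant of \<open>E j t\<close>, \<open>E' j t\<close> and \<open>E i s\<close>,
  computed in the frame of edge \<open>i\<close>. It is the Wronskian of \<open>cB\<close> and
  \<open>g\<close> along edge \<open>j\<close>, which does not depend on \<open>t\<close> and is the
  source of the numerators in the derivatives of the angle and its cosine.\<close>

lemma edge_wedge:
  assumes "i < n" "j < n"
  shows "cB i s (E j t) * g i (E' j t) - g i (E j t) * cB i s (E' j t) = g j (E i s)"
  using det3_comb[OF edge_frame(2)[OF assms(1)] edge_expansion[OF assms(1)] edge_expansion[OF assms(1)]]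
  by (simp add: g_det[of j "E i s" t])

lemma cS_pos:
  assumes "i < n" "j < n" "g j (E i s) \<noteq> 0"
  shows "cS i s (E j t) > 0"
proof -
  have "cB i s (E j t) \<noteq> 0 \<or> g i (E j t) \<noteq> 0" using edge_wedge[OF assms(1,2), of s t] assms(3) by auto
  then show ?thesis unfolding cS_def by (auto simp: sum_power2_gt_zero_iff)
qed

lemma cS_sq: "(cS i s y)\<^sup>2 = (cB i s y)\<^sup>2 + (g i y)\<^sup>2"
  by (simp add: cS_def)

lemma deriv_edge:
  "((\<lambda>t. quad K q (E j t)) has_real_derivative quad K q (E' j t)) (at t)"
  "((\<lambda>t. cB i s (E j t)) has_real_derivative cB i s (E' j t)) (at t)"
  "((\<lambda>t. g i (E j t)) has_real_derivative g i (E' j t)) (at t)"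
  unfolding geo_def geo_vel_def cB_def g_def quad_linear det3_linear
  by (auto intro!: derivative_eq_intros cosK_deriv sinK_deriv simp: algebra_simps)

definition cS' :: "nat \<Rightarrow> nat \<Rightarrow> real \<Rightarrow> real \<Rightarrow> real" where
  "cS' i j s t = (cB i s (E j t) * cB i s (E' j t) + g i (E j t) * g i (E' j t)) / cS i s (E j t)"

text \<open>The derivative of \<open>rho i s (E j t)\<close> by \<open>t\<close>, i.e. the cosine of the angle of the chord with edge \<open>j\<close>.\<close>

definition cR :: "nat \<Rightarrow> nat \<Rightarrow> real \<Rightarrow> real \<Rightarrow> real" where
  "cR i j s t = quad K (E i s) (E j t) * cS' i j s t - cS i s (E j t) * quad K (E i s) (E' j t)"

text \<open>The density \<open>sin \<alpha> sin \<beta> / sin\<^sub>K \<rho>\<close> of \<open>\<mu>\<close> with respect to the positions \<open>s\<close>, \<open>t\<close> on the two edges.\<close>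

definition wt :: "nat \<Rightarrow> nat \<Rightarrow> real \<Rightarrow> real \<Rightarrow> real" where
  "wt i j s t = g i (E j t) * g j (E i s) / (cS i s (E j t)) ^ 3"

lemma deriv_cS:
  assumes "cS i s (E j t) > 0"
  shows "((\<lambda>t. cS i s (E j t)) has_real_derivative cS' i j s t) (at t)"
proof -
  have pos: "(cB i s (E j t))\<^sup>2 + (g i (E j t))\<^sup>2 > 0" using assms unfolding cS_def by simp
  have "((\<lambda>t. (cB i s (E j t))\<^sup>2 + (g i (E j t))\<^sup>2) has_real_derivative
      2 * (cB i s (E j t) * cB i s (E' j t) + g i (E j t) * g i (E' j t))) (at t)"
    by (auto intro!: derivative_eq_intros deriv_edge)
  then have "((\<lambda>t. cS i s (E j t)) has_real_derivative inverse (cS i s (E j t)) / 2 *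
      (2 * (cB i s (E j t) * cB i s (E' j t) + g i (E j t) * g i (E' j t)))) (at t)"
    unfolding cS_def by (rule DERIV_chain2[where f = sqrt and g = "\<lambda>t. (cB i s (E j t))\<^sup>2 + (g i (E j t))\<^sup>2" and x = t, OF DERIV_real_sqrt[OF pos]])
  moreover have "inverse x / 2 * (2 * y) = y / x" for x y :: real by (cases "x = 0") (simp_all add: field_simps)
  ultimately show ?thesis by (simp only: cS'_def)
qed

lemma deriv_rho:
  assumes "i < n" "j < n" "cS i s (E j t) > 0"
  shows "((\<lambda>t. rho i s (E j t)) has_real_derivative cR i j s t) (at t)"
  unfolding rho_def cR_def
  by (rule argK_has_derivative[OF deriv_edge(1) deriv_cS[OF assms(3)] edge_norm[OF assms(1) E_surface[OF assms(2)]] assms(3)])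
    (use quad_pos E_surface assms in auto)

text \<open>After \<open>cS\<^sup>2\<close> is expanded, the quotient rule leaves \<open>- g\<close>
  times the Wronskian of \<open>edge_wedge\<close>, over \<open>cS\<^sup>3\<close>.\<close>

lemma deriv_cos:
  assumes "i < n" "j < n" "cS i s (E j t) > 0"
  shows "((\<lambda>t. cB i s (E j t) / cS i s (E j t)) has_real_derivative - wt i j s t) (at t)"
proof -
  let ?B = "cB i s (E j t)" and ?B' = "cB i s (E' j t)" and ?C = "g i (E j t)" and ?C' = "g i (E' j t)" and ?S = "cS i s (E j t)"
  have d: "((\<lambda>t. cB i s (E j t) / cS i s (E j t)) has_real_derivative (?B' * ?S - ?B * cS' i j s t) / (?S * ?S)) (at t)"
    using DERIV_divide[OF deriv_edge(2) deriv_cS[OF assms(3)]] assms(3) by simp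
  have "(?B' * ?S - ?B * cS' i j s t) = (?B' * ?S\<^sup>2 - ?B * (?B * ?B' + ?C * ?C')) / ?S"
    using assms(3) by (simp add: cS'_def field_simps power2_eq_square)
  also have "?B' * ?S\<^sup>2 - ?B * (?B * ?B' + ?C * ?C') = - ?C * (?B * ?C' - ?C * ?B')"
    unfolding cS_sq by (simp add: algebra_simps power2_eq_square)
  also have "\<dots> = - (?C * g j (E i s))" using edge_wedge[OF assms(1,2)] by simp
  finally have "(?B' * ?S - ?B * cS' i j s t) / (?S * ?S) = - wt i j s t"
    by (simp add: wt_def power3_eq_cube)
  then show ?thesis using d by simp
qed

text \<open>The arccotangent of \<open>cB / g\<close>, with values in \<open>(0, pi)\<close>. The
  quotient does not change if the chord is reversed, as befits an unoriented geodesic, and it is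
  smooth wherever \<open>g\<close> is nonzero.\<close>

definition ang :: "nat \<Rightarrow> nat \<Rightarrow> real \<Rightarrow> real \<Rightarrow> real" where
  "ang i j s t = pi / 2 - arctan (cB i s (E j t) / g i (E j t))"

lemma ang_range: "0 < ang i j s t" "ang i j s t < pi"
  using arctan[of "cB i s (E j t) / g i (E j t)"] by (simp_all add: ang_def)

lemma deriv_ang:
  assumes "i < n" "j < n" "g i (E j t) \<noteq> 0"
  shows "((\<lambda>t. ang i j s t) has_real_derivative g j (E i s) / (cS i s (E j t))\<^sup>2) (at t)"
proof -
  let ?B = "cB i s (E j t)" and ?B' = "cB i s (E' j t)" and ?C = "g i (E j t)" and ?C' = "g i (E' j t)"
  have "((\<lambda>t. cB i s (E j t) / g i (E j t)) has_real_derivative (?B' * ?C - ?B * ?C') / (?C * ?C)) (at t)"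
    using DERIV_divide[OF deriv_edge(2,3)] assms(3) by simp
  then have "((\<lambda>t. arctan (cB i s (E j t) / g i (E j t))) has_real_derivative
      inverse (1 + (?B / ?C)\<^sup>2) * ((?B' * ?C - ?B * ?C') / (?C * ?C))) (at t)"
    by (rule DERIV_chain2[OF DERIV_arctan])
  then have "((\<lambda>t. ang i j s t) has_real_derivative 0 - inverse (1 + (?B / ?C)\<^sup>2) * ((?B' * ?C - ?B * ?C') / (?C * ?C))) (at t)"
    unfolding ang_def by (intro DERIV_diff DERIV_const)
  moreover have "0 - inverse (1 + (?B / ?C)\<^sup>2) * ((?B' * ?C - ?B * ?C') / (?C * ?C)) = g j (E i s) / (cS i s (E j t))\<^sup>2"
  proof -
    have "1 + (?B / ?C)\<^sup>2 = (cS i s (E j t))\<^sup>2 / (?C * ?C)"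
      using assms(3) unfolding cS_sq by (simp add: field_simps power2_eq_square)
    then have e1: "inverse (1 + (?B / ?C)\<^sup>2) * ((?B' * ?C - ?B * ?C') / (?C * ?C)) = (?B' * ?C - ?B * ?C') / (cS i s (E j t))\<^sup>2"
      using assms(3) by simp
    have "?B' * ?C - ?B * ?C' = - g j (E i s)" using edge_wedge[OF assms(1,2), of s t] by (simp add: mult.commute)
    then show ?thesis by (subst e1) simp
  qed
  ultimately show ?thesis by simp
qed

lemma ang_direction:
  assumes "g i (E j t) \<noteq> 0"
  shows "sin (ang i j s t) = \<bar>g i (E j t)\<bar> / cS i s (E j t)"
    "cos (ang i j s t) = sgn (g i (E j t)) * (cB i s (E j t) / cS i s (E j t))"
proof -
  let ?B = "cB i s (E j t)" and ?C = "g i (E j t)"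
  have "1 + (?B / ?C)\<^sup>2 = (?C\<^sup>2 + ?B\<^sup>2) / ?C\<^sup>2" using assms by (simp add: field_simps)
  then have sq: "sqrt (1 + (?B / ?C)\<^sup>2) = cS i s (E j t) / \<bar>?C\<bar>"
    by (simp add: cS_def real_sqrt_divide add.commute)
  show "sin (ang i j s t) = \<bar>?C\<bar> / cS i s (E j t)"
    unfolding ang_def by (simp add: sin_diff cos_arctan sq)
  show "cos (ang i j s t) = sgn ?C * (?B / cS i s (E j t))"
    unfolding ang_def using assms by (simp add: cos_diff sin_arctan sq sgn_if)
qed

text \<open>The initial direction of the chord from \<open>E i s\<close> to
  \<open>y\<close>.\<close>

definition dir :: "nat \<Rightarrow> real \<Rightarrow> pt \<Rightarrow> pt" where
  "dir i s y = (cB i s y / cS i s y) *\<^sub>R E' i s + (g i y / cS i s y) *\<^sub>R nu i"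

lemma dir:
  assumes "i < n" "y \<in> surface K" "cS i s y > 0"
  shows "(E i s, dir i s y) \<in> unit_tangent K" "geo K (E i s) (dir i s y) (rho i s y) = y"
    "0 < rho i s y" "K > 0 \<Longrightarrow> rho i s y < pi / sqrt K"
    "g i (dir i s y) = g i y / cS i s y" "riem K (E' i s) (dir i s y) = cB i s y / cS i s y"
proof -
  note fr = edge_frame[OF assms(1), of s]
  have "(cB i s y / cS i s y)\<^sup>2 + (g i y / cS i s y)\<^sup>2 = ((cB i s y)\<^sup>2 + (g i y)\<^sup>2) / (cS i s y)\<^sup>2"
    by (simp add: power_divide add_divide_distrib)
  then have "(cB i s y / cS i s y)\<^sup>2 + (g i y / cS i s y)\<^sup>2 = 1"
    using assms(3) by (simp add: cS_sq[symmetric])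
  then show 1: "(E i s, dir i s y) \<in> unit_tangent K"
    unfolding dir_def using frame_unit_tangent[OF fr(1)] by blast
  note a = argK[OF edge_norm[OF assms(1,2), of s] assms(3) quad_pos[OF E_surface[OF assms(1)] assms(2)], folded rho_def]
  show "geo K (E i s) (dir i s y) (rho i s y) = y"
  proof -
    have "geo K (E i s) (dir i s y) (rho i s y) = quad K (E i s) y *\<^sub>R E i s + cS i s y *\<^sub>R dir i s y"
      by (subst geo_def) (simp only: a(1,2))
    also have "cS i s y *\<^sub>R dir i s y = cB i s y *\<^sub>R E' i s + g i y *\<^sub>R nu i"
      using assms(3) by (simp add: dir_def scaleR_add_right)
    finally show ?thesis using edge_expansion[OF assms(1), of y s] by (simp add: add.assoc)
  qed
  show "0 < rho i s y" "K > 0 \<Longrightarrow> rho i s y < pi / sqrt K" using a(3,4) by auto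
  have "g i (nu i) = 1" using fr(2) by (simp add: g_det[of i _ s])
  then show "g i (dir i s y) = g i y / cS i s y" by (simp add: dir_def g_scale g_E)
  show "riem K (E' i s) (dir i s y) = cB i s y / cS i s y"
    using frame_facts[OF fr(1)] by (simp add: dir_def riem_linear)
qed

text \<open>The first variation formula: \<open>cR\<close>, found as a derivative, is the inner
  product of two unit vectors at the far end, hence bounded by \<open>1\<close>.\<close>

lemma dir_other_end:
  assumes i: "i < n" and j: "j < n" and S: "cS i s (E j t) > 0"
  defines "w \<equiv> geo_vel K (E i s) (dir i s (E j t)) (rho i s (E j t))"
  shows "g j w = - g j (E i s) / cS i s (E j t)" "riem K (E' j t) w = cR i j s t"
    "(cR i j s t)\<^sup>2 \<le> 1"
proof -
  let ?q = "E i s" and ?y = "E j t" and ?v = "dir i s (E j t)" and ?r = "rho i s (E j t)"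
  note d = dir[OF i E_surface[OF j] S]
  have cs: "cosK K ?r = quad K ?q ?y" "sinK K ?r = cS i s ?y"
    using argK[OF edge_norm[OF i E_surface[OF j], of s] S quad_pos[OF E_surface[OF i] E_surface[OF j]], folded rho_def] by auto
  have "geo K ?y w (- ?r) = ?q" using geo_add[of K ?q ?v ?r "- ?r"] d(2) by (simp add: w_def)
  then have "g j ?q = - sinK K ?r * g j w" by (metis g_geo g_E(1) add_0 mult_zero_right sinK_minus)
  then show "g j w = - g j (E i s) / cS i s (E j t)" using cs S by (simp add: field_simps)
  show R: "riem K (E' j t) w = cR i j s t"
  proof -
    \<comment> \<open>This is the side condition of \<open>frame_riem\<close>: in the Euclidean case
      edge directions have no component along the base point.\<close>
    have K0: "K = 0 \<Longrightarrow> quad K ?q (E' j t) = 0"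
    proof -
      assume K: "K = 0"
      have "(E j t, E' j t) \<in> unit_tangent K" by (rule geo_unit_tangent[OF vertex_unit_tangent[OF j]])
      then have "fst (E' j t) = 0" using unit_tangent_coords(5) K by (metis prod.collapse)
      then show ?thesis using K by (simp add: quad_def)
    qed
    have w: "w = (- K * cS i s ?y) *\<^sub>R ?q + (quad K ?q ?y * (cB i s ?y / cS i s ?y)) *\<^sub>R E' i s
        + (quad K ?q ?y * (g i ?y / cS i s ?y)) *\<^sub>R nu i"
      unfolding w_def geo_vel_def[of K ?q] cs by (simp add: dir_def scaleR_add_right)
    have "riem K (E' j t) w = riem K (quad K ?q (E' j t) *\<^sub>R ?q + cB i s (E' j t) *\<^sub>R E' i s + g i (E' j t) *\<^sub>R nu i) w"
      using edge_expansion[OF i, of "E' j t" s] by simp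
    also have "\<dots> = quad K ?q (E' j t) * (- K * cS i s ?y) / K
        + (cB i s (E' j t) * (quad K ?q ?y * (cB i s ?y / cS i s ?y)) + g i (E' j t) * (quad K ?q ?y * (g i ?y / cS i s ?y)))"
      unfolding w by (rule frame_riem[OF edge_frame(1)[OF i]]) (use K0 in simp)
    also have "\<dots> = cR i j s t"
    proof -
      have "quad K ?q (E' j t) * (- K * cS i s ?y) / K = - (cS i s ?y * quad K ?q (E' j t))"
      proof (cases "K = 0")
        case True
        then show ?thesis using K0[OF True] by simp
      qed simp
      moreover have "cB i s (E' j t) * (quad K ?q ?y * (cB i s ?y / cS i s ?y)) + g i (E' j t) * (quad K ?q ?y * (g i ?y / cS i s ?y))
        = quad K ?q ?y * cS' i j s t"
        using S by (simp add: cS'_def field_simps)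
      ultimately show ?thesis unfolding cR_def by linarith
    qed
    finally show ?thesis .
  qed
  have w: "(?y, w) \<in> unit_tangent K" using geo_unit_tangent[OF d(1), of ?r] d(2) by (simp add: w_def)
  note c = unit_tangent_components(2,3)[OF edge_frame[OF j, of t] w]
  then have "(cR i j s t)\<^sup>2 + (det3 ?y (E' j t) w)\<^sup>2 = 1" using R by simp
  then show "(cR i j s t)\<^sup>2 \<le> 1" using zero_le_power2[of "det3 ?y (E' j t) w"] by linarith
qed

lemma edge_sign:
  assumes i: "i < n" "0 < s" "s < L i" and j: "j < n" "j \<noteq> i"
  shows "g j (E i s) \<noteq> 0" "0 < t \<Longrightarrow> t < L j \<Longrightarrow> g i (E j t) * g j (E i s) > 0"
proof -
  have 1: "h j (E i s) > 0" by (rule h_pos[OF i j])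
  then show "g j (E i s) \<noteq> 0" using h_g(2)[of j "E i s"] by simp
  assume t: "0 < t" "t < L j"
  have "h i (E j t) > 0" by (rule h_pos) (use i j t in auto)
  then have "h i (E j t) * h j (E i s) > 0" using 1 by (rule mult_pos_pos)
  then show "g i (E j t) * g j (E i s) > 0" by (simp only: h_g(1))
qed

text \<open>In the last identity \<open>cS\<close> is \<open>sinK\<close> of the chord length, and
  the sines contained in \<open>wt\<close> cancel those of the cotangents, so that only the product
  of two cosines remains.\<close>

lemma pair_chord:
  assumes i: "i < n" "0 < s" "s < L i" and j: "j < n" "0 < t" "t < L j" and ij: "i \<noteq> j"
  defines "\<gamma> \<equiv> crossing K (P i) (V i) (nu i) (s, ang i j s t)"
  shows "\<gamma> = geodesic K (E i s) (dir i s (E j t))"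
    "is_chord K D \<gamma> (E i s) (dir i s (E j t)) (rho i s (E j t))"
    "\<And>\<tau> k. 0 < \<tau> \<Longrightarrow> \<tau> < rho i s (E j t) \<Longrightarrow> k < n \<Longrightarrow> h k (geo K (E i s) (dir i s (E j t)) \<tau>) > 0"
    "chord_length K D \<gamma> = rho i s (E j t)"
    "cot (chord_angle1 K D \<gamma>) * cot (chord_angle2 K D \<gamma>) * cS i s (E j t) * wt i j s t =
       cB i s (E j t) / cS i s (E j t) * cR i j s t"
proof -
  let ?q = "E i s" and ?y = "E j t"
  note sg = edge_sign[OF i j(1) ij[symmetric]]
  have C: "g i ?y \<noteq> 0" using sg(2)[OF j(2,3)] by auto
  have S: "cS i s ?y > 0" by (rule cS_pos[OF i(1) j(1) sg(1)])
  note d = dir[OF i(1) E_surface[OF j(1)] S]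
  note e = dir_other_end[OF i(1) j(1) S]
  \<comment> \<open>The direction at angle \<open>ang\<close> is that of the chord or its opposite,
    by the sign of \<open>g\<close>; both give the same geodesic.\<close>
  have "cos (ang i j s t) *\<^sub>R E' i s + sin (ang i j s t) *\<^sub>R nu i = sgn (g i ?y) *\<^sub>R dir i s ?y"
    using C by (simp add: ang_direction[OF C] dir_def sgn_if)
  then have "\<gamma> = geodesic K ?q (sgn (g i ?y) *\<^sub>R dir i s ?y)"
    by (simp add: \<gamma>_def crossing_def)
  then show \<gamma>: "\<gamma> = geodesic K ?q (dir i s ?y)" using C geodesic_uminus by (simp add: sgn_if)
  obtain v r where v: "(?q, v) \<in> unit_tangent K" "?y = geo K ?q v r" "0 < r" "K > 0 \<Longrightarrow> r < pi / sqrt K"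
    "h i v > 0" "h j (geo_vel K ?q v r) < 0" "is_chord K D (geodesic K ?q v) ?q v r"
    "\<And>\<tau> k. 0 < \<tau> \<Longrightarrow> \<tau> < r \<Longrightarrow> k < n \<Longrightarrow> h k (geo K ?q v \<tau>) > 0"
    by (rule chord_pair[OF i j ij]) blast
  have eq: "v = dir i s ?y \<and> r = rho i s ?y"
    by (rule geo_polar_unique[OF v(1) d(1)]) (use v(2-4) d(2-4) in \<open>auto intro: less_imp_le\<close>)
  show c: "is_chord K D \<gamma> ?q (dir i s ?y) (rho i s ?y)" using v(7) eq \<gamma> by simp
  show "h k (geo K ?q (dir i s ?y) \<tau>) > 0" if "0 < \<tau>" "\<tau> < rho i s ?y" "k < n" for \<tau> k
    using v(8) eq that by simp
  show "chord_length K D \<gamma> = rho i s ?y"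
  proof (rule chord_length_eq[OF c])
    assume K: "K > 0"
    have "2 * pi / sqrt K = pi / sqrt K + pi / sqrt K" by simp
    then show "rho i s ?y < 2 * pi / sqrt K" using d(3) d(4)[OF K] by linarith
  qed
  let ?w = "geo_vel K ?q (dir i s ?y) (rho i s ?y)"
  have "cot (chord_angle1 K D \<gamma>) * cot (chord_angle2 K D \<gamma>) =
    riem K (E' i s) (dir i s ?y) * riem K (E' j t) ?w / (h i (dir i s ?y) * - h j ?w)"
    by (rule cot_chord_angles_pair[OF i j d(1) d(2)[symmetric] d(4) _ _ c]) (use v(5,6) eq in auto)
  also have "h i (dir i s ?y) * - h j ?w = g i ?y * g j ?q / (cS i s ?y)\<^sup>2"
    using h_g(1)[of i "dir i s ?y" j ?w] d(5) e(1) by (simp add: power2_eq_square)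
  finally have "cot (chord_angle1 K D \<gamma>) * cot (chord_angle2 K D \<gamma>) =
    cB i s ?y / cS i s ?y * cR i j s t / (g i ?y * g j ?q / (cS i s ?y)\<^sup>2)" using d(6) e(2) by simp
  then show "cot (chord_angle1 K D \<gamma>) * cot (chord_angle2 K D \<gamma>) * cS i s ?y * wt i j s t =
       cB i s ?y / cS i s ?y * cR i j s t"
    using S C sg(1) by (simp add: wt_def field_simps power2_eq_square power3_eq_cube)
qed

section \<open>Integration along an edge and the boundary terms\<close>

lemma same_edge_rho:
  assumes i: "i < n" "0 < s" "s < L i"
  shows "rho i s (P i) = s" "cB i s (P i) / cS i s (P i) = - 1"
    "rho i s (P (Suc i mod n)) = L i - s" "cB i s (P (Suc i mod n)) / cS i s (P (Suc i mod n)) = 1"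
proof -
  note fr = edge_frame[OF i(1), of s]
  have gen: "quad K (E i s) (E i (s + a)) = cosK K a \<and> cB i s (E i (s + a)) = sinK K a \<and> g i (E i (s + a)) = 0" for a
  proof -
    have e: "E i (s + a) = cosK K a *\<^sub>R E i s + sinK K a *\<^sub>R E' i s"
      unfolding geo_add[of K "P i" "V i" s a, symmetric] by (rule geo_def)
    show ?thesis unfolding g_E e cB_def using frame_facts[OF fr(1)] fr(2) by (simp add: quad_linear det3_linear g_scale g_E)
  qed
  have Ki: "L i \<le> pi / sqrt K" if "K > 0" using L_le[OF i(1) that] .
  have p1: "sinK K s > 0" "sinK K (L i - s) > 0" using i Ki by (force intro!: sinK_pos)+
  have S1: "cS i s (P i) = sinK K s" "quad K (E i s) (P i) = cosK K s" "cB i s (P i) = - sinK K s"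
    using gen[of "- s"] p1 by (simp_all add: cS_def)
  have S2: "cS i s (P (Suc i mod n)) = sinK K (L i - s)" "quad K (E i s) (P (Suc i mod n)) = cosK K (L i - s)"
    "cB i s (P (Suc i mod n)) = sinK K (L i - s)"
    using gen[of "L i - s"] p1 next_vertex[OF i(1)] by (simp_all add: cS_def)
  show "rho i s (P i) = s" unfolding rho_def S1 by (rule argK_cosK_sinK) (use i Ki in force)+
  show "rho i s (P (Suc i mod n)) = L i - s" unfolding rho_def S2 by (rule argK_cosK_sinK) (use i Ki in force)+
  show "cB i s (P i) / cS i s (P i) = - 1" "cB i s (P (Suc i mod n)) / cS i s (P (Suc i mod n)) = 1"
    using S1 S2 p1 by simp_all
qed

lemma continuous_pair:
  assumes a: "continuous_on X a" and b: "continuous_on X b"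
  shows "continuous_on X (\<lambda>x. quad K (E i (a x)) (E j (b x)))"
    "continuous_on X (\<lambda>x. quad K (E i (a x)) (E' j (b x)))"
    "continuous_on X (\<lambda>x. cB i (a x) (E j (b x)))" "continuous_on X (\<lambda>x. cB i (a x) (E' j (b x)))"
    "continuous_on X (\<lambda>x. g i (E j (b x)))" "continuous_on X (\<lambda>x. g i (E' j (b x)))"
    "continuous_on X (\<lambda>x. g j (E i (a x)))"
    "continuous_on X (\<lambda>x. cS i (a x) (E j (b x)))"
  unfolding cB_def cS_def using a b by (auto intro!: continuous_intros)

lemma continuous_rho:
  assumes "i < n" "j < n" "continuous_on X a" "continuous_on X b"
  shows "continuous_on X (\<lambda>x. rho i (a x) (E j (b x)))"
  unfolding rho_def
proof (rule continuous_on_argK[OF continuous_pair(1,8)[OF assms(3,4)]])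
  fix x assume "K > 0"
  then have "K * (cS i (a x) (E j (b x)))\<^sup>2 \<ge> 0" by simp
  then have "(quad K (E i (a x)) (E j (b x)))\<^sup>2 \<le> 1"
    using edge_norm[OF assms(1) E_surface[OF assms(2)], of "a x" "b x"] by linarith
  then show "\<bar>quad K (E i (a x)) (E j (b x))\<bar> \<le> 1" by (simp add: abs_square_le_1)
qed

lemma continuous_pair_div:
  assumes a: "continuous_on X a" and b: "continuous_on X b" and S: "\<And>x. x \<in> X \<Longrightarrow> cS i (a x) (E j (b x)) > 0"
  shows "continuous_on X (\<lambda>x. cB i (a x) (E j (b x)) / cS i (a x) (E j (b x)))"
    "continuous_on X (\<lambda>x. cR i j (a x) (b x))" "continuous_on X (\<lambda>x. wt i j (a x) (b x))"
proof -
  have S': "\<forall>x\<in>X. cS i (a x) (E j (b x)) \<noteq> 0" "\<forall>x\<in>X. (cS i (a x) (E j (b x))) ^ 3 \<noteq> 0" using S by force+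
  note c = continuous_pair[OF a b]
  show "continuous_on X (\<lambda>x. cB i (a x) (E j (b x)) / cS i (a x) (E j (b x)))"
    using S' by (intro continuous_on_divide c)
  have "continuous_on X (\<lambda>x. cS' i j (a x) (b x))"
    unfolding cS'_def using S' by (intro continuous_on_divide continuous_on_add continuous_on_mult c)
  then show "continuous_on X (\<lambda>x. cR i j (a x) (b x))"
    unfolding cR_def by (intro continuous_on_diff continuous_on_mult c)
  show "continuous_on X (\<lambda>x. wt i j (a x) (b x))"
    unfolding wt_def using S' by (intro continuous_on_divide continuous_on_mult continuous_on_power c)
qed

text \<open>\<open>Z\<close> depends on edge \<open>j\<close> only through the far end
  \<open>y\<close>, so its values at a vertex agree for both adjacent edges. For interior
  \<open>s\<close> the denominators are positive up to the ends of edge \<open>j\<close>, and the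
  fundamental theorem applies on the closed interval.\<close>

lemma edge_integral:
  assumes i: "i < n" "0 < s" "s < L i" and j: "j < n" "j \<noteq> i"
    and f: "\<And>x. (f has_real_derivative f' x) (at x)" and f': "continuous_on UNIV f'"
  defines "Z \<equiv> \<lambda>y. - f (rho i s y) * (cB i s y / cS i s y)"
  shows "(\<integral>t. indicator {0<..<L j} t *\<^sub>R (f (rho i s (E j t)) * wt i j s t
      - f' (rho i s (E j t)) * (cB i s (E j t) / cS i s (E j t) * cR i j s t)) \<partial>lborel)
    = Z (P (Suc j mod n)) - Z (P j)"
proof -
  let ?G = "\<lambda>t. f (rho i s (E j t)) * wt i j s t
      - f' (rho i s (E j t)) * (cB i s (E j t) / cS i s (E j t) * cR i j s t)"
  have S: "cS i s (E j t) > 0" for t by (rule cS_pos[OF i(1) j(1) edge_sign(1)[OF i j]])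
  have cf: "continuous_on UNIV f" by (rule DERIV_continuous_on) (rule f)
  have d: "((\<lambda>t. Z (E j t)) has_real_derivative ?G t) (at t)" for t
  proof -
    have 1: "((\<lambda>t. f (rho i s (E j t))) has_real_derivative f' (rho i s (E j t)) * cR i j s t) (at t)"
      by (rule DERIV_chain2[OF f deriv_rho[OF i(1) j(1) S]])
    have "((\<lambda>t. - (f (rho i s (E j t)) * (cB i s (E j t) / cS i s (E j t)))) has_real_derivative
       - (f' (rho i s (E j t)) * cR i j s t * (cB i s (E j t) / cS i s (E j t)) + - wt i j s t * f (rho i s (E j t)))) (at t)"
      by (rule DERIV_minus[OF DERIV_mult[OF 1 deriv_cos[OF i(1) j(1) S]]])
    then show ?thesis unfolding Z_def by (simp add: algebra_simps)
  qed
  have cG: "continuous_on {0..L j} ?G"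
    by (intro continuous_on_diff continuous_on_mult continuous_on_compose2[OF cf] continuous_on_compose2[OF f']
      continuous_rho[OF i(1) j(1)] continuous_pair_div S continuous_on_const continuous_on_id) auto
  have "(\<integral>t. indicator {0<..<L j} t *\<^sub>R ?G t \<partial>lborel) = (\<integral>t. indicator {0..L j} t *\<^sub>R ?G t \<partial>lborel)"
  proof (rule integral_cong_AE)
    have "continuous_on {0<..<L j} ?G" by (rule continuous_on_subset[OF cG]) auto
    then show "(\<lambda>t. indicator {0<..<L j} t *\<^sub>R ?G t) \<in> borel_measurable lborel"
      using borel_measurable_continuous_on_indicator[of "{0<..<L j}" ?G] by (simp del: real_scaleR_def)
    show "(\<lambda>t. indicator {0..L j} t *\<^sub>R ?G t) \<in> borel_measurable lborel"
      using borel_measurable_continuous_on_indicator[of "{0..L j}" ?G] cG by (simp del: real_scaleR_def)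
    have "AE t in lborel. t \<noteq> 0 \<and> t \<noteq> L j" using AE_lborel_singleton[of 0] AE_lborel_singleton[of "L j"] by eventually_elim simp
    then show "AE t in lborel. indicator {0<..<L j} t *\<^sub>R ?G t = indicator {0..L j} t *\<^sub>R ?G t"
      by eventually_elim (auto simp: indicator_def)
  qed
  also have "\<dots> = Z (E j (L j)) - Z (E j 0)"
    by (rule integral_FTC_atLeastAtMost[OF _ _ cG])
      (use L_pos[OF j(1)] d in \<open>auto intro: has_vector_derivative_at_within simp: has_real_derivative_iff_has_vector_derivative\<close>)
  finally show ?thesis using next_vertex[OF j(1)] by simp
qed

lemma sum_next: "(\<Sum>j<n. F (Suc j mod n)) = (\<Sum>j<n. F j)" for F :: "nat \<Rightarrow> real"
proof -
  obtain m where m: "n = Suc m" using n_pos by (cases n) auto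
  have "(\<Sum>j<n. F (Suc j mod n)) = (\<Sum>j<m. F (Suc j mod n)) + F 0" by (simp add: m)
  also have "(\<Sum>j<m. F (Suc j mod n)) = (\<Sum>j<m. F (Suc j))" by (intro sum.cong) (auto simp: m)
  also have "\<dots> + F 0 = (\<Sum>j<n. F j)" unfolding m sum.lessThan_Suc_shift by simp
  finally show ?thesis .
qed

text \<open>The cyclic sum over all edges vanishes, so omitting \<open>j = i\<close> leaves minus
  the difference over edge \<open>i\<close>, which \<open>same_edge_rho\<close> evaluates.\<close>

lemma boundary_terms:
  fixes f :: "real \<Rightarrow> real"
  assumes i: "i < n" "0 < s" "s < L i"
  defines "Z \<equiv> \<lambda>y. - f (rho i s y) * (cB i s y / cS i s y)"
  shows "(\<Sum>j\<in>{..<n} - {i}. Z (P (Suc j mod n)) - Z (P j)) = f s + f (L i - s)"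
proof -
  have "(\<Sum>j<n. Z (P (Suc j mod n)) - Z (P j)) = 0"
    using sum_next[of "\<lambda>j. Z (P j)"] by (simp add: sum_subtractf)
  then have "(\<Sum>j\<in>{..<n} - {i}. Z (P (Suc j mod n)) - Z (P j)) = - (Z (P (Suc i mod n)) - Z (P i))"
    using i by (simp add: sum_diff1)
  then show ?thesis unfolding Z_def same_edge_rho[OF i] by simp
qed

end

section \<open>The measure on geodesics in terms of two crossed edges\<close>

text \<open>The plane of \<open>p\<close> and \<open>v\<close> contains \<open>q\<close> and a point
  which, by \<open>sinK K r \<noteq> 0\<close>, is independent of \<open>q\<close>; so it is the
  plane of \<open>q\<close> and \<open>w\<close>.\<close>

lemma geodesic_eqI:
  assumes pv: "(p, v) \<in> unit_tangent K" and qw: "(q, w) \<in> unit_tangent K"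
    and q: "det3 p v q = 0" and y: "det3 p v (geo K q w r) = 0" and r: "sinK K r \<noteq> 0"
  shows "geodesic K p v = geodesic K q w"
proof -
  have "q \<in> surface K" using qw by (auto simp: unit_tangent_def)
  then have "q \<in> geodesic K p v" using geodesic_iff[OF pv] q by simp
  then obtain \<tau> where \<tau>: "q = geo K p v \<tau>" by (auto simp: geodesic_def)
  define w' where "w' = geo_vel K p v \<tau>"
  have qw': "(q, w') \<in> unit_tangent K" using geo_unit_tangent[OF pv, of \<tau>] \<tau> by (simp add: w'_def)
  have "det3 q w' (geo K q w r) = 0" using y det3_geo[of K p v \<tau>] \<tau> by (simp add: w'_def)
  moreover have "det3 q w' (geo K q w r) = sinK K r * det3 q w' w"
    by (simp add: geo_def det3_linear)
  ultimately have "det3 q w' w = 0" using r by simp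
  then have "w = w' \<or> w = - w'" by (rule unit_tangent_parallel[OF qw' qw])
  then have "geodesic K q w = geodesic K q w'" using geodesic_uminus by metis
  also have "\<dots> = geodesic K p v" unfolding \<tau> w'_def by (rule geodesic_shift)
  finally show ?thesis by simp
qed

lemma crossing_direction:
  assumes "orthonormal_frame K p v N"
  shows "(geo K p v l, cos a *\<^sub>R geo_vel K p v l + sin a *\<^sub>R N) \<in> unit_tangent K"
  using frame_unit_tangent[OF frame_transport[OF assms, of l], of "cos a" "sin a"] by simp

lemma crossing_eq:
  "crossing K p v N x = geodesic K (geo K p v (fst x)) (cos (snd x) *\<^sub>R geo_vel K p v (fst x) + sin (snd x) *\<^sub>R N)"
  by (simp add: crossing_def case_prod_beta)

lemma geodesicsI: "(p, v) \<in> unit_tangent K \<Longrightarrow> geodesic K p v \<in> geodesics K"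
  unfolding geodesics_def by blast

lemma crossing_in_geodesics:
  assumes "orthonormal_frame K p v N"
  shows "crossing K p v N x \<in> geodesics K"
  unfolding crossing_eq by (rule geodesicsI[OF crossing_direction[OF assms]])

text \<open>A plane that crosses the base geodesic at an angle in \<open>(0, pi)\<close> contains a
  second point of it only where \<open>sinK\<close> of the difference of the parameters vanishes, so
  \<open>k = l\<close>. Then equal planes give \<open>sin (b - a) = 0\<close>.\<close>

lemma crossing_inj:
  assumes fr: "orthonormal_frame K p v N" and det: "det3 p v N \<noteq> 0"
    and a: "0 < a" "a < pi" and b: "0 < b" "b < pi" and kl: "K > 0 \<Longrightarrow> \<bar>k - l\<bar> < pi / sqrt K"
    and eq: "crossing K p v N (k, a) = crossing K p v N (l, b)"
  shows "k = l \<and> a = b"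
proof -
  define q T q' T' where d: "q = geo K p v k" "T = geo_vel K p v k" "q' = geo K p v l" "T' = geo_vel K p v l"
  define u w where uw: "u = cos a *\<^sub>R T + sin a *\<^sub>R N" "w = cos b *\<^sub>R T' + sin b *\<^sub>R N"
  have u: "(q, u) \<in> unit_tangent K" and w: "(q', w) \<in> unit_tangent K"
    using crossing_direction[OF fr, of k a] crossing_direction[OF fr, of l b] by (simp_all add: d uw)
  have e: "geodesic K q u = geodesic K q' w" using eq by (simp add: crossing_eq d uw)
  have sa: "sin a > 0" "sin b > 0" using a b by (auto intro: sin_gt_zero)
  have det': "det3 q T N \<noteq> 0" using det det3_geo[of K p v k N] by (simp add: d)
  have on: "det3 q u (geo K q' w t) = 0" for t
  proof -
    have "geo K q' w t \<in> geodesic K q' w" unfolding geodesic_def by (rule rangeI)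
    then have "geo K q' w t \<in> geodesic K q u" using e by simp
    then show ?thesis using geodesic_iff[OF u geo_in_surface[OF w]] by blast
  qed
  have "q' = cosK K (l - k) *\<^sub>R q + sinK K (l - k) *\<^sub>R T"
  proof -
    have "q' = geo K q T (l - k)" using geo_add[of K p v k "l - k"] by (simp add: d)
    then show ?thesis by (simp add: geo_def)
  qed
  then have "det3 q u q' = sinK K (l - k) * (sin a * det3 q N T)"
    by (simp add: uw det3_linear)
  moreover have "det3 q u q' = 0" using on[of 0] by simp
  ultimately have "sinK K (l - k) = 0" using sa det' det3_swap(2)[of q N T] by simp
  then have "l - k = 0" using sinK_eq_0[of K "l - k"] kl by (simp add: abs_minus_commute)
  then have kl: "k = l" by simp
  then have qq: "q' = q" "T' = T" by (simp_all add: d)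
  obtain t where t: "0 < t" "sinK K t > 0" by (rule small_step[of 1 K]) auto
  have "det3 q u (geo K q w t) = sinK K t * det3 q u w" by (simp add: geo_def det3_linear)
  then have "det3 q u w = 0" using t on[of t] qq by simp
  moreover have "det3 q u w = (cos a * sin b - sin a * cos b) * det3 q T N"
    unfolding uw qq using det3_swap(2)[of q N T] by (simp add: det3_linear algebra_simps)
  ultimately have "sin (b - a) = 0" using det' by (simp add: sin_diff mult.commute)
  then have "b = a" using a b sin_eq_0_pi[of "b - a"] by linarith
  then show ?thesis using kl by simp
qed

text \<open>Substitution for nonnegative functions, from the theorem on absolutely integrable ones;
  the bounds on \<open>f\<close> and on the image provide integrability.\<close>

lemma nn_integral_image:
  fixes \<phi> \<phi>' f :: "real \<Rightarrow> real"
  assumes S: "S \<in> sets borel" "\<phi> ` S \<in> sets borel" "\<phi> ` S \<subseteq> {a..b}"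
    and d: "\<And>x. x \<in> S \<Longrightarrow> (\<phi> has_real_derivative \<phi>' x) (at x)" and inj: "inj_on \<phi> S"
    and f: "f \<in> borel_measurable borel" "\<And>x. x \<in> \<phi> ` S \<Longrightarrow> 0 \<le> f x" "\<And>x. f x \<le> 1"
  shows "(\<integral>\<^sup>+x. ennreal (f x) * indicator (\<phi> ` S) x \<partial>lborel) =
    (\<integral>\<^sup>+x. ennreal (\<bar>\<phi>' x\<bar> * f (\<phi> x)) * indicator S x \<partial>lborel)"
proof -
  have "emeasure lborel (\<phi> ` S) \<le> emeasure lborel {a..b}" using S by (intro emeasure_mono) auto
  also have "\<dots> < \<infinity>" by (simp add: emeasure_lborel_Icc_eq)
  finally have fin: "emeasure lborel (\<phi> ` S) < \<infinity>" .
  have "integrable lborel (\<lambda>x. indicator (\<phi> ` S) x *\<^sub>R f x)"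
  proof (rule integrableI_bounded_set[where A = "\<phi> ` S" and B = 1])
    show "(\<lambda>x. indicator (\<phi> ` S) x *\<^sub>R f x) \<in> borel_measurable lborel" using S f(1) by simp
    show "AE x in lborel. x \<in> \<phi> ` S \<longrightarrow> norm (indicator (\<phi> ` S) x *\<^sub>R f x) \<le> 1"
      using f(2,3) by (intro AE_I2) auto
  qed (use S fin in \<open>auto simp: indicator_def\<close>)
  then have 1: "f absolutely_integrable_on (\<phi> ` S)"
    unfolding set_integrable_def using S f(1) by (subst integrable_completion) auto
  have "(\<lambda>x. \<bar>\<phi>' x\<bar> * f (\<phi> x)) absolutely_integrable_on S \<and>
      integral S (\<lambda>x. \<bar>\<phi>' x\<bar> * f (\<phi> x)) = integral (\<phi> ` S) f \<longleftrightarrow>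
      f absolutely_integrable_on (\<phi> ` S) \<and> integral (\<phi> ` S) f = integral (\<phi> ` S) f"
  proof (rule has_absolute_integral_change_of_variables_1'[OF _ _ inj])
    show "S \<in> sets lebesgue" using S(1) by simp
    show "(\<phi> has_real_derivative \<phi>' x) (at x within S)" if "x \<in> S" for x
      by (rule has_field_derivative_at_within[OF d[OF that]])
  qed
  then have 4: "(\<lambda>x. \<bar>\<phi>' x\<bar> * f (\<phi> x)) absolutely_integrable_on S"
    "integral S (\<lambda>x. \<bar>\<phi>' x\<bar> * f (\<phi> x)) = integral (\<phi> ` S) f" using 1 by auto
  have 2: "((\<lambda>x. \<bar>\<phi>' x\<bar> * f (\<phi> x)) has_integral integral (\<phi> ` S) f) S"
    unfolding 4(2)[symmetric] using set_lebesgue_integral_eq_integral(1)[OF 4(1)] by (rule integrable_integral)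
  have 3: "(f has_integral integral (\<phi> ` S) f) (\<phi> ` S)"
    using set_lebesgue_integral_eq_integral(1)[OF 1] by (rule integrable_integral)
  show ?thesis
    using nn_integral_has_integral_lebesgue'[OF _ 3] nn_integral_has_integral_lebesgue'[OF _ 2] f(2) by simp
qed

text \<open>This extends measurability from compact sets, where \<open>meets\<close> can be handled
  directly, to continuous images of open sets.\<close>

lemma open_image_compacts:
  fixes U :: "(real \<times> real) set" and \<psi> :: "real \<times> real \<Rightarrow> pt \<times> pt"
  assumes "open U" "continuous_on U \<psi>"
  obtains C :: "nat \<Rightarrow> (pt \<times> pt) set" where "\<And>m. compact (C m)" "\<psi> ` U = (\<Union>m. C m)"
proof -
  obtain C where C: "\<And>m::nat. compact (C m)" "\<And>m. C m \<subseteq> U" "\<Union> (range C) = U"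
    by (rule open_Union_compact_subsets[OF assms(1)]) blast
  show thesis
  proof (rule that[of "\<lambda>m. \<psi> ` C m"])
    show "compact (\<psi> ` C m)" for m
      by (rule compact_continuous_image[OF continuous_on_subset[OF assms(2) C(2)] C(1)])
    show "\<psi> ` U = (\<Union>m. \<psi> ` C m)" using C(3) by blast
  qed
qed

locale polygon_measure = polygon_domain +
  fixes \<mu> :: "pt set measure"
  assumes inv: "invariant_measure K \<mu>"
begin

section \<open>The quotient \<sigma>-algebra\<close>

lemma space_\<mu>: "space \<mu> = geodesics K"
  and sets_\<mu>: "sets \<mu> = {A. A \<subseteq> geodesics K \<and> {(p, v). (p, v) \<in> unit_tangent K \<and> geodesic K p v \<in> A} \<in> sets borel}"
  and crossing_emeasure: "\<lbrakk>orthonormal_frame K p v N; B \<in> sets borel; B \<subseteq> UNIV \<times> {0<..<pi}; inj_on (crossing K p v N) B\<rbrakk> \<Longrightarrow>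
    emeasure \<mu> (crossing K p v N ` B) = (\<integral>\<^sup>+(l, a)\<in>B. ennreal (sin a) \<partial>lborel)"
proof -
  note i = inv[unfolded invariant_measure_def]
  show "space \<mu> = geodesics K" using i by (rule conjunct1)
  show "sets \<mu> = {A. A \<subseteq> geodesics K \<and> {(p, v). (p, v) \<in> unit_tangent K \<and> geodesic K p v \<in> A} \<in> sets borel}"
    using i[THEN conjunct2] by (rule conjunct1)
  show "emeasure \<mu> (crossing K p v N ` B) = (\<integral>\<^sup>+(l, a)\<in>B. ennreal (sin a) \<partial>lborel)"
    if "orthonormal_frame K p v N" "B \<in> sets borel" "B \<subseteq> UNIV \<times> {0<..<pi}" "inj_on (crossing K p v N) B"
    by (rule i[THEN conjunct2, THEN conjunct2, THEN conjunct2, rule_format]) (use that in blast)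
qed

text \<open>The unit tangent bundle is the preimage of the whole space of geodesics, which is
  measurable.\<close>

lemma unit_tangent_borel: "unit_tangent K \<in> sets borel"
proof -
  have "geodesics K \<in> sets \<mu>" using sets.top[of \<mu>] space_\<mu> by simp
  then have "{(p, v). (p, v) \<in> unit_tangent K \<and> geodesic K p v \<in> geodesics K} \<in> sets borel"
    unfolding sets_\<mu> by simp
  also have "{(p, v). (p, v) \<in> unit_tangent K \<and> geodesic K p v \<in> geodesics K} = unit_tangent K"
    using geodesicsI by auto
  finally show ?thesis .
qed

text \<open>
  These sets supply all the measurable sets that are needed: for compact \<open>S\<close>, the preimage of \<open>meets S\<close>
  in the unit tangent bundle is the projection of a closed set along \<open>S\<close>, hence closed.
\<close>

definition meets :: "(pt \<times> pt) set \<Rightarrow> pt set set" where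
  "meets S = {\<gamma> \<in> geodesics K. \<exists>z\<in>S. fst z \<in> \<gamma> \<and> snd z \<in> \<gamma>}"

lemma meets_compact:
  assumes S: "compact S" "S \<subseteq> surface K \<times> surface K"
  shows "meets S \<in> sets \<mu>"
proof -
  let ?T = "{w :: (pt \<times> pt) \<times> (pt \<times> pt). det3 (fst (snd w)) (snd (snd w)) (fst (fst w)) = 0 \<and>
    det3 (fst (snd w)) (snd (snd w)) (snd (fst w)) = 0}"
  have "closed ?T" by (intro closed_Collect_conj closed_Collect_eq continuous_intros)
  then have "closed {y. \<exists>x. x \<in> S \<and> (x, y) \<in> ?T}" by (rule closed_compact_projection[OF S(1)])
  then have b: "{y. \<exists>x. x \<in> S \<and> (x, y) \<in> ?T} \<in> sets borel" by (rule borel_closed)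
  have "(geodesic K (fst w) (snd w) \<in> meets S) = (\<exists>x. x \<in> S \<and> (x, w) \<in> ?T)" if pv: "w \<in> unit_tangent K" for w
  proof -
    have w: "(fst w, snd w) \<in> unit_tangent K" using pv by simp
    have "(fst z \<in> geodesic K (fst w) (snd w) \<and> snd z \<in> geodesic K (fst w) (snd w)) = ((z, w) \<in> ?T)" if "z \<in> S" for z
    proof -
      have "fst z \<in> surface K" "snd z \<in> surface K" using that S(2) by auto
      then show ?thesis using geodesic_iff[OF w] by simp
    qed
    then show ?thesis using geodesicsI[OF w] unfolding meets_def by blast
  qed
  then have "{(p, v). (p, v) \<in> unit_tangent K \<and> geodesic K p v \<in> meets S} = unit_tangent K \<inter> {y. \<exists>x. x \<in> S \<and> (x, y) \<in> ?T}"
    by (simp add: set_eq_iff split_beta cong: conj_cong)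
  also have "\<dots> \<in> sets borel" using unit_tangent_borel b by (rule sets.Int)
  finally show ?thesis unfolding sets_\<mu> by (simp add: meets_def)
qed

lemma meets_Union: "meets (\<Union>m. S m) = (\<Union>m. meets (S m))"
  unfolding meets_def by blast

lemma meets_open_image:
  fixes U :: "(real \<times> real) set"
  assumes "open U" "continuous_on U \<psi>" "\<psi> ` U \<subseteq> surface K \<times> surface K"
  shows "meets (\<psi> ` U) \<in> sets \<mu>"
proof -
  obtain C where C: "\<And>m::nat. compact (C m)" "\<psi> ` U = (\<Union>m. C m)"
    using open_image_compacts[OF assms(1,2)] by metis
  have "meets (C m) \<in> sets \<mu>" for m
  proof (rule meets_compact[OF C(1)])
    show "C m \<subseteq> surface K \<times> surface K" using C(2) assms(3) by blast
  qed
  then show ?thesis unfolding C(2) meets_Union by (intro sets.countable_UN) auto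
qed

text \<open>The chart lifts to a continuous map into the unit tangent bundle, whose quotient
  \<sigma>-algebra is that of \<open>\<mu>\<close>.\<close>

lemma crossing_measurable:
  assumes "orthonormal_frame K p v N"
  shows "crossing K p v N \<in> measurable borel \<mu>"
proof (rule measurableI)
  show "crossing K p v N x \<in> space \<mu>" for x
    using crossing_in_geodesics[OF assms] by (simp add: space_\<mu>)
  fix A assume A: "A \<in> sets \<mu>"
  let ?c = "\<lambda>x. (geo K p v (fst x), cos (snd x) *\<^sub>R geo_vel K p v (fst x) + sin (snd x) *\<^sub>R N)"
  have "continuous_on UNIV ?c" by (intro continuous_intros)
  then have "?c \<in> borel_measurable borel" by (rule borel_measurable_continuous_onI)
  moreover have "{(p, v). (p, v) \<in> unit_tangent K \<and> geodesic K p v \<in> A} \<in> sets borel" using A unfolding sets_\<mu> by simp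
  ultimately have "?c -` {(p, v). (p, v) \<in> unit_tangent K \<and> geodesic K p v \<in> A} \<inter> space borel \<in> sets borel"
    by (rule measurable_sets)
  also have "?c -` {(p, v). (p, v) \<in> unit_tangent K \<and> geodesic K p v \<in> A} \<inter> space borel = crossing K p v N -` A \<inter> space borel"
    using crossing_direction[OF assms] by (simp add: crossing_eq vimage_def)
  finally show "crossing K p v N -` A \<inter> space borel \<in> sets borel" .
qed

lemma nu_det: "i < n \<Longrightarrow> det3 (P i) (V i) (nu i) \<noteq> 0" "i < n \<Longrightarrow> orthonormal_frame K (P i) (V i) (nu i)"
  using edge_frame[of i 0] by simp_all

section \<open>Geodesics parametrized by their points on two edges\<close>

text \<open>For distinct edges and \<open>x = (s, t)\<close> in the rectangle, this is the geodesic
  through \<open>E i s\<close> and \<open>E j t\<close>. It is written in the crossing chart of edge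
  \<open>i\<close>, in which \<open>\<mu>\<close> is known.\<close>

definition Psi :: "nat \<Rightarrow> nat \<Rightarrow> real \<times> real \<Rightarrow> pt set" where
  "Psi i j x = crossing K (P i) (V i) (nu i) (fst x, ang i j (fst x) (snd x))"

definition rect :: "nat \<Rightarrow> nat \<Rightarrow> (real \<times> real) set" where
  "rect i j = {0<..<L i} \<times> {0<..<L j}"

definition G :: "nat \<Rightarrow> nat \<Rightarrow> pt set set" where "G i j = Psi i j ` rect i j"

lemma rect_iff: "x \<in> rect i j \<longleftrightarrow> 0 < fst x \<and> fst x < L i \<and> 0 < snd x \<and> snd x < L j"
  by (cases x) (auto simp: rect_def)

lemma open_rect: "open (rect i j)"
  unfolding rect_def by (intro open_Times open_greaterThanLessThan)

lemma Psi_measurable: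
  assumes "i < n"
  shows "Psi i j \<in> measurable borel \<mu>"
proof -
  have c: "(\<lambda>x::real \<times> real. cB i (fst x) (E j (snd x))) \<in> borel_measurable borel"
    "(\<lambda>x::real \<times> real. g i (E j (snd x))) \<in> borel_measurable borel"
    by (rule borel_measurable_continuous_onI, rule continuous_pair[OF continuous_on_fst[OF continuous_on_id] continuous_on_snd[OF continuous_on_id]])+
  have "(\<lambda>x::real \<times> real. arctan (cB i (fst x) (E j (snd x)) / g i (E j (snd x)))) \<in> borel_measurable borel"
    using c by (intro measurable_compose[OF _ borel_measurable_arctan] borel_measurable_divide) auto
  then have "(\<lambda>x::real \<times> real. ang i j (fst x) (snd x)) \<in> borel_measurable borel"
    unfolding ang_def by (intro borel_measurable_diff borel_measurable_const)
  moreover have "(\<lambda>x::real \<times> real. fst x) \<in> borel_measurable borel"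
    by (rule borel_measurable_continuous_onI) (intro continuous_intros)
  ultimately have "(\<lambda>x::real \<times> real. (fst x, ang i j (fst x) (snd x))) \<in> borel_measurable borel"
    by (rule borel_measurable_Pair[rotated])
  then show ?thesis
    unfolding Psi_def[abs_def] by (rule measurable_compose[OF _ crossing_measurable[OF nu_det(2)[OF assms]]])
qed

context
  fixes i j assumes i: "i < n" and j: "j < n" and ij: "i \<noteq> j"
begin

lemma Psi_facts:
  assumes x: "x \<in> rect i j"
  shows "Psi i j x = geodesic K (E i (fst x)) (dir i (fst x) (E j (snd x)))"
    "is_chord K D (Psi i j x) (E i (fst x)) (dir i (fst x) (E j (snd x))) (rho i (fst x) (E j (snd x)))"
    "\<And>\<tau> k. 0 < \<tau> \<Longrightarrow> \<tau> < rho i (fst x) (E j (snd x)) \<Longrightarrow> k < n \<Longrightarrow>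
       h k (geo K (E i (fst x)) (dir i (fst x) (E j (snd x))) \<tau>) > 0"
    "chord_length K D (Psi i j x) = rho i (fst x) (E j (snd x))"
    "cot (chord_angle1 K D (Psi i j x)) * cot (chord_angle2 K D (Psi i j x)) * cS i (fst x) (E j (snd x)) * wt i j (fst x) (snd x) =
       cB i (fst x) (E j (snd x)) / cS i (fst x) (E j (snd x)) * cR i j (fst x) (snd x)"
  using pair_chord[OF i _ _ j _ _ ij, of "fst x" "snd x"] x unfolding rect_iff Psi_def by simp_all

lemma cS_rect: "x \<in> rect i j \<Longrightarrow> cS i (fst x) (E j (snd x)) > 0"
  using cS_pos[OF i j] edge_sign(1)[OF i _ _ j] ij by (simp add: rect_iff)

lemma dir_rect:
  assumes x: "x \<in> rect i j"
  shows "(E i (fst x), dir i (fst x) (E j (snd x))) \<in> unit_tangent K"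
    "geo K (E i (fst x)) (dir i (fst x) (E j (snd x))) (rho i (fst x) (E j (snd x))) = E j (snd x)"
    "0 < rho i (fst x) (E j (snd x))" "K > 0 \<Longrightarrow> rho i (fst x) (E j (snd x)) < pi / sqrt K"
  using dir[OF i E_surface[OF j] cS_rect[OF x]] by simp_all

lemma Psi_ends:
  assumes x: "x \<in> rect i j"
  shows "E i (fst x) \<in> Psi i j x" "E j (snd x) \<in> Psi i j x"
proof -
  have "geo K (E i (fst x)) (dir i (fst x) (E j (snd x))) 0 \<in> Psi i j x"
    "geo K (E i (fst x)) (dir i (fst x) (E j (snd x))) (rho i (fst x) (E j (snd x))) \<in> Psi i j x"
    unfolding Psi_facts(1)[OF x] geodesic_def by (rule rangeI)+
  then show "E i (fst x) \<in> Psi i j x" "E j (snd x) \<in> Psi i j x" using dir_rect(2)[OF x] by simp_all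
qed

lemma Psi_unique:
  assumes x: "x \<in> rect i j" and p: "(p, v) \<in> unit_tangent K"
    "det3 p v (E i (fst x)) = 0" "det3 p v (E j (snd x)) = 0"
  shows "geodesic K p v = Psi i j x"
proof -
  note d = dir_rect[OF x]
  have "sinK K (rho i (fst x) (E j (snd x))) > 0" using sinK_pos d(3,4) by blast
  then show ?thesis
    unfolding Psi_facts(1)[OF x] by (intro geodesic_eqI[OF p(1) d(1) p(2), of "rho i (fst x) (E j (snd x))"]) (use p(3) d(2) in auto)
qed

text \<open>In the interior of the chord all \<open>h k\<close> are positive, so edges are met only
  at its two ends. The half-open range gives each boundary point a unique edge and
  parameter.\<close>

lemma Psi_edges:
  assumes x: "x \<in> rect i j" and k: "k < n" "0 \<le> a" "a < L k" and on: "E k a \<in> Psi i j x"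
  shows "k = i \<and> a = fst x \<or> k = j \<and> a = snd x"
proof -
  let ?r = "rho i (fst x) (E j (snd x))"
  have "E k a \<in> D" using k by (intro edge_in_D) auto
  then have "E k a \<in> Psi i j x \<inter> D" using on by blast
  then obtain \<tau> where \<tau>: "0 \<le> \<tau>" "\<tau> \<le> ?r" "E k a = geo K (E i (fst x)) (dir i (fst x) (E j (snd x))) \<tau>"
  proof -
    have "Psi i j x \<inter> D = geo K (E i (fst x)) (dir i (fst x) (E j (snd x))) ` {0..?r}"
      using Psi_facts(2)[OF x] unfolding is_chord_def by blast
    then have "E k a \<in> geo K (E i (fst x)) (dir i (fst x) (E j (snd x))) ` {0..?r}"
      using \<open>E k a \<in> Psi i j x \<inter> D\<close> by (simp only:)
    then show ?thesis using that by (elim imageE) (metis atLeastAtMost_iff)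
  qed
  have "\<not> (0 < \<tau> \<and> \<tau> < ?r)"
  proof
    assume "0 < \<tau> \<and> \<tau> < ?r"
    then have "h k (E k a) > 0" using Psi_facts(3)[OF x _ _ k(1), of \<tau>] \<tau>(3) by simp
    then show False by simp
  qed
  then have "\<tau> = 0 \<or> \<tau> = ?r" using \<tau> by linarith
  then have "E k a = E i (fst x) \<or> E k a = E j (snd x)" using \<tau>(3) dir_rect(2)[OF x] by auto
  then show ?thesis
    using simple[OF k(1) i k(2,3), of "fst x"] simple[OF k(1) j k(2,3), of "snd x"] x by (simp add: rect_iff) blast
qed

text \<open>Incidence with two points determines the geodesic, which makes images of open sets
  accessible to \<open>meets_open_image\<close>.\<close>

lemma G_meets: "W \<subseteq> rect i j \<Longrightarrow> Psi i j ` W = meets ((\<lambda>x. (E i (fst x), E j (snd x))) ` W)"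
proof -
  assume W: "W \<subseteq> rect i j"
  have "Psi i j x \<in> meets ((\<lambda>x. (E i (fst x), E j (snd x))) ` W)" if "x \<in> W" for x
  proof -
    have "Psi i j x \<in> geodesics K" unfolding Psi_def by (rule crossing_in_geodesics[OF nu_det(2)[OF i]])
    then show ?thesis using Psi_ends[of x] that W unfolding meets_def by force
  qed
  moreover have "\<gamma> \<in> Psi i j ` W" if g: "\<gamma> \<in> meets ((\<lambda>x. (E i (fst x), E j (snd x))) ` W)" for \<gamma>
  proof -
    obtain x where x: "x \<in> W" "E i (fst x) \<in> \<gamma>" "E j (snd x) \<in> \<gamma>" and "\<gamma> \<in> geodesics K" using g unfolding meets_def by auto
    then obtain p v where pv: "(p, v) \<in> unit_tangent K" "\<gamma> = geodesic K p v" unfolding geodesics_def by blast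
    have "geodesic K p v = Psi i j x"
      by (rule Psi_unique[OF _ pv(1)]) (use x W pv geodesic_iff[OF pv(1) E_surface] i j in auto)
    then show ?thesis using x(1) pv(2) by blast
  qed
  ultimately show ?thesis by blast
qed

lemma Psi_open_measurable:
  assumes "open W" "W \<subseteq> rect i j"
  shows "Psi i j ` W \<in> sets \<mu>"
  unfolding G_meets[OF assms(2)]
proof (rule meets_open_image[OF assms(1)])
  show "continuous_on W (\<lambda>x. (E i (fst x), E j (snd x)))" by (intro continuous_intros)
  show "(\<lambda>x. (E i (fst x), E j (snd x))) ` W \<subseteq> surface K \<times> surface K" using E_surface i j by auto
qed

lemma G_sets: "G i j \<in> sets \<mu>"
  unfolding G_def by (rule Psi_open_measurable[OF open_rect]) simp

text \<open>\<open>Psi i j\<close> is injective on the rectangle, so the superlevel sets of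
  \<open>F\<close> within \<open>G i j\<close> are the images of those of \<open>H\<close>, which
  are open.\<close>

lemma G_measurable:
  fixes F :: "pt set \<Rightarrow> real"
  assumes H: "continuous_on (rect i j) H" and F: "\<And>x. x \<in> rect i j \<Longrightarrow> F (Psi i j x) = H x"
  shows "(\<lambda>\<gamma>. indicator (G i j) \<gamma> * F \<gamma>) \<in> borel_measurable \<mu>"
proof (rule borel_measurableI_greater)
  fix y :: real
  let ?W = "{x \<in> rect i j. y < H x}"
  have "open (rect i j \<inter> H -` {y<..})"
    by (rule continuous_open_preimage[OF H open_rect open_greaterThan])
  also have "rect i j \<inter> H -` {y<..} = ?W" by auto
  finally have W: "Psi i j ` ?W \<in> sets \<mu>" by (rule Psi_open_measurable) auto
  have "{\<gamma> \<in> space \<mu>. y < indicator (G i j) \<gamma> * F \<gamma>} = (if y < 0 then space \<mu> - G i j else {}) \<union> Psi i j ` ?W"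
  proof (intro set_eqI)
    fix \<gamma>
    show "\<gamma> \<in> {\<gamma> \<in> space \<mu>. y < indicator (G i j) \<gamma> * F \<gamma>} \<longleftrightarrow> \<gamma> \<in> (if y < 0 then space \<mu> - G i j else {}) \<union> Psi i j ` ?W"
    proof (cases "\<gamma> \<in> G i j")
      case True
      then obtain x where x: "x \<in> rect i j" "\<gamma> = Psi i j x" unfolding G_def by blast
      have inj: "x' = x" if "x' \<in> rect i j" "Psi i j x' = \<gamma>" for x'
        using Psi_edges[OF x(1) i, of "fst x'"] Psi_edges[OF x(1) j, of "snd x'"] Psi_ends[OF that(1)] that x ij
        by (auto simp: rect_iff prod_eq_iff)
      have "\<gamma> \<in> space \<mu>" using True sets.sets_into_space[OF G_sets] by blast
      moreover have "\<gamma> \<in> Psi i j ` ?W \<longleftrightarrow> y < F \<gamma>" using inj x F[OF x(1)] by auto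
      ultimately show ?thesis using True by simp
    next
      case False
      then have "\<gamma> \<notin> Psi i j ` ?W" unfolding G_def by blast
      then show ?thesis using False by simp
    qed
  qed
  also have "\<dots> \<in> sets \<mu>" using W G_sets by auto
  finally show "{\<gamma> \<in> space \<mu>. y < indicator (G i j) \<gamma> * F \<gamma>} \<in> sets \<mu>" .
qed

end

end

context polygon_measure
begin

context
  fixes i j assumes i: "i < n" and j: "j < n" and ij: "i \<noteq> j"
begin

section \<open>The density of the measure in edge coordinates\<close>

definition W :: "real \<times> real \<Rightarrow> real" where
  "W x = indicator (rect i j) x * wt i j (fst x) (snd x)"

lemma wt_rect_pos: "x \<in> rect i j \<Longrightarrow> wt i j (fst x) (snd x) > 0"
  unfolding wt_def using edge_sign(2)[OF i _ _ j, of "fst x" "snd x"] cS_rect[OF i j ij, of x] ij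
  by (simp add: rect_iff)

lemma W_nonneg: "0 \<le> W x"
  unfolding W_def using wt_rect_pos[of x] by (cases "x \<in> rect i j") auto

lemma rect_continuous:
  "continuous_on (rect i j) (\<lambda>x. wt i j (fst x) (snd x))"
  "continuous_on (rect i j) (\<lambda>x. cB i (fst x) (E j (snd x)) / cS i (fst x) (E j (snd x)))"
  "continuous_on (rect i j) (\<lambda>x. cR i j (fst x) (snd x))"
  by (rule continuous_pair_div[OF continuous_on_fst[OF continuous_on_id] continuous_on_snd[OF continuous_on_id] cS_rect[OF i j ij]], assumption)+

lemma borel_rect:
  fixes H :: "real \<times> real \<Rightarrow> real"
  shows "continuous_on (rect i j) H \<Longrightarrow> (\<lambda>x. indicator (rect i j) x * H x) \<in> borel_measurable borel"
  using borel_measurable_continuous_on_indicator[of "rect i j" H] open_rect by simp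

lemma W_borel: "W \<in> borel_measurable borel"
  unfolding W_def[abs_def] by (rule borel_rect[OF rect_continuous(1)])

lemma crossing_inj_edge: "inj_on (crossing K (P i) (V i) (nu i)) ({0<..<L i} \<times> {0<..<pi})"
proof (rule inj_onI)
  fix x y assume x: "x \<in> {0<..<L i} \<times> {0<..<pi}" and y: "y \<in> {0<..<L i} \<times> {0<..<pi}"
    and eq: "crossing K (P i) (V i) (nu i) x = crossing K (P i) (V i) (nu i) y"
  have "fst x = fst y \<and> snd x = snd y"
  proof (rule crossing_inj[OF nu_det(2)[OF i] nu_det(1)[OF i]])
    show "\<bar>fst x - fst y\<bar> < pi / sqrt K" if "K > 0"
      using L_le[OF i that] x y by auto
  qed (use x y eq in auto)
  then show "x = y" by (simp add: prod_eq_iff)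
qed

text \<open>This description makes the image measurable: it is a section of the preimage of
  \<open>G i j\<close> under the crossing chart.\<close>

lemma ang_image:
  assumes l: "0 < l" "l < L i"
  shows "ang i j l ` {0<..<L j} = {a. 0 < a \<and> a < pi \<and> crossing K (P i) (V i) (nu i) (l, a) \<in> G i j}"
proof (intro equalityI subsetI)
  fix a assume "a \<in> ang i j l ` {0<..<L j}"
  then obtain t where t: "0 < t" "t < L j" "a = ang i j l t" by auto
  then have "crossing K (P i) (V i) (nu i) (l, a) = Psi i j (l, t)" by (simp add: Psi_def)
  then show "a \<in> {a. 0 < a \<and> a < pi \<and> crossing K (P i) (V i) (nu i) (l, a) \<in> G i j}"
    using t l ang_range unfolding G_def by (auto simp: rect_iff)
next
  fix a assume "a \<in> {a. 0 < a \<and> a < pi \<and> crossing K (P i) (V i) (nu i) (l, a) \<in> G i j}"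
  then have a: "0 < a" "a < pi" "crossing K (P i) (V i) (nu i) (l, a) \<in> G i j" by auto
  then obtain x where x: "x \<in> rect i j" "crossing K (P i) (V i) (nu i) (l, a) = Psi i j x" unfolding G_def by blast
  have "crossing K (P i) (V i) (nu i) (l, a) = crossing K (P i) (V i) (nu i) (fst x, ang i j (fst x) (snd x))"
    using x(2) by (simp add: Psi_def)
  then have "(l, a) = (fst x, ang i j (fst x) (snd x))"
    by (rule inj_onD[OF crossing_inj_edge]) (use a l x(1) ang_range in \<open>auto simp: rect_iff\<close>)
  then show "a \<in> ang i j l ` {0<..<L j}" using x(1) by (auto simp: rect_iff)
qed

lemma ang_inj:
  assumes l: "0 < l" "l < L i"
  shows "inj_on (ang i j l) {0<..<L j}"
proof (rule inj_onI)
  fix t t' assume t: "t \<in> {0<..<L j}" "t' \<in> {0<..<L j}" "ang i j l t = ang i j l t'"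
  have r: "(l, t) \<in> rect i j" "(l, t') \<in> rect i j" using t l by (auto simp: rect_iff)
  have "Psi i j (l, t) = Psi i j (l, t')" using t(3) by (simp add: Psi_def)
  then have "E j t' \<in> Psi i j (l, t)" using Psi_ends(2)[OF i j ij r(2)] by simp
  then show "t = t'" using Psi_edges[OF i j ij r(1) j, of t'] t ij by auto
qed

text \<open>Substitution of \<open>a = ang i j l t\<close> for fixed \<open>l\<close>: the factor
  \<open>|g j| / cS\<^sup>2\<close> from \<open>deriv_ang\<close> and
  \<open>sin a = |g i| / cS\<close> multiply to \<open>wt\<close>, as \<open>g i\<close> and
  \<open>g j\<close> have equal signs.\<close>

lemma inner_integral:
  assumes l: "0 < l" "l < L i" and A: "A \<in> sets \<mu>"
  shows "(\<integral>\<^sup>+a. ennreal (sin a) * indicator ({0<..<L i} \<times> {0<..<pi} \<inter> crossing K (P i) (V i) (nu i) -` (A \<inter> G i j)) (l, a) \<partial>lborel)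
    = (\<integral>\<^sup>+t. ennreal (W (l, t)) * indicator A (Psi i j (l, t)) \<partial>lborel)"
proof -
  let ?c = "crossing K (P i) (V i) (nu i)" and ?S = "{0<..<L j}" and ?\<phi> = "ang i j l"
  define f where "f a = indicator A (?c (l, a)) * sin a" for a
  have cm: "(\<lambda>a. ?c (l, a)) \<in> measurable borel \<mu>"
  proof -
    have "(\<lambda>a::real. (l, a)) \<in> borel_measurable borel"
      by (rule borel_measurable_continuous_onI) (intro continuous_intros)
    then show ?thesis by (rule measurable_compose[OF _ crossing_measurable[OF nu_det(2)[OF i]]])
  qed
  have im: "?\<phi> ` ?S = {0<..<pi} \<inter> (\<lambda>a. ?c (l, a)) -` G i j"
    unfolding ang_image[OF l] by auto
  have imb: "?\<phi> ` ?S \<in> sets borel"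
    unfolding im using measurable_sets[OF cm G_sets[OF i j ij]] by auto
  have fm: "f \<in> borel_measurable borel"
    unfolding f_def[abs_def]
    by (intro borel_measurable_times measurable_compose[OF cm borel_measurable_indicator[OF A]] borel_measurable_continuous_onI continuous_intros)
  have sg: "g j (E i l) \<noteq> 0" using edge_sign(1)[OF i l j] ij by auto
  have S: "cS i l (E j t) > 0" for t by (rule cS_pos[OF i j sg])
  have "(\<integral>\<^sup>+a. ennreal (sin a) * indicator ({0<..<L i} \<times> {0<..<pi} \<inter> ?c -` (A \<inter> G i j)) (l, a) \<partial>lborel)
    = (\<integral>\<^sup>+a. ennreal (f a) * indicator (?\<phi> ` ?S) a \<partial>lborel)"
    by (intro nn_integral_cong) (use l in \<open>auto simp: im f_def indicator_def\<close>)
  also have "\<dots> = (\<integral>\<^sup>+t. ennreal (\<bar>g j (E i l) / (cS i l (E j t))\<^sup>2\<bar> * f (?\<phi> t)) * indicator ?S t \<partial>lborel)"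
  proof (rule nn_integral_image[OF _ imb _ _ ang_inj[OF l] fm])
    show "?\<phi> ` ?S \<subseteq> {0..pi}" using im by auto
    show "(?\<phi> has_real_derivative g j (E i l) / (cS i l (E j t))\<^sup>2) (at t)" if "t \<in> ?S" for t
      by (rule deriv_ang[OF i j]) (use edge_sign(2)[OF i l j, of t] that ij in auto)
    show "0 \<le> f a" if "a \<in> ?\<phi> ` ?S" for a
      using that sin_gt_zero[of a] unfolding im f_def by auto
    show "f a \<le> 1" for a unfolding f_def by (auto simp: indicator_def)
  qed simp
  also have "\<dots> = (\<integral>\<^sup>+t. ennreal (W (l, t)) * indicator A (Psi i j (l, t)) \<partial>lborel)"
  proof (rule nn_integral_cong)
    fix t
    show "ennreal (\<bar>g j (E i l) / (cS i l (E j t))\<^sup>2\<bar> * f (?\<phi> t)) * indicator ?S t = ennreal (W (l, t)) * indicator A (Psi i j (l, t))"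
    proof (cases "t \<in> ?S")
      case False
      then show ?thesis by (simp add: W_def rect_def)
    next
      case True
      have CD: "g i (E j t) * g j (E i l) > 0" using edge_sign(2)[OF i l j, of t] True ij by auto
      then have C: "g i (E j t) \<noteq> 0" by auto
      have "\<bar>g j (E i l) / (cS i l (E j t))\<^sup>2\<bar> * sin (?\<phi> t) = \<bar>g i (E j t) * g j (E i l)\<bar> / (cS i l (E j t)) ^ 3"
        using S[of t] by (simp add: ang_direction(1)[OF C] abs_mult power2_eq_square power3_eq_cube)
      also have "\<dots> = wt i j l t" using CD by (simp add: wt_def)
      finally have "\<bar>g j (E i l) / (cS i l (E j t))\<^sup>2\<bar> * f (?\<phi> t) = indicator A (Psi i j (l, t)) * W (l, t)"
        using True l by (auto simp: f_def Psi_def W_def rect_iff indicator_def)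
      then show ?thesis using True by (simp add: indicator_def)
    qed
  qed
  finally show ?thesis .
qed

text \<open>The crossing chart gives the measure as an integral of \<open>sin a\<close>; by Tonelli
  the integral over the angle is taken first and rewritten in \<open>t\<close>. Finiteness holds
  since the chart is used on a bounded rectangle, where \<open>sin a \<le> 1\<close>.\<close>

lemma G_emeasure:
  assumes A: "A \<in> sets \<mu>"
  shows "emeasure \<mu> (A \<inter> G i j) = (\<integral>\<^sup>+x. ennreal (W x) * indicator A (Psi i j x) \<partial>lborel)"
    "emeasure \<mu> (A \<inter> G i j) < \<infinity>"
proof -
  let ?c = "crossing K (P i) (V i) (nu i)" and ?R = "{0<..<L i} \<times> {0<..<pi}"
  let ?B = "?R \<inter> ?c -` (A \<inter> G i j)"
  have Rb: "?R \<in> sets borel" by (intro borel_open open_Times open_greaterThanLessThan)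
  have "?c -` (A \<inter> G i j) \<inter> space borel \<in> sets borel"
    using A G_sets[OF i j ij] by (intro measurable_sets[OF crossing_measurable[OF nu_det(2)[OF i]]]) auto
  then have Bb: "?B \<in> sets borel" using Rb by simp
  have im: "?c ` ?B = A \<inter> G i j"
  proof (intro equalityI subsetI)
    fix \<gamma> assume g: "\<gamma> \<in> A \<inter> G i j"
    then obtain x where x: "x \<in> rect i j" "\<gamma> = Psi i j x" unfolding G_def by blast
    have "(fst x, ang i j (fst x) (snd x)) \<in> ?R" using x(1) ang_range by (simp add: rect_iff)
    moreover have "?c (fst x, ang i j (fst x) (snd x)) = \<gamma>" using x(2) by (simp add: Psi_def)
    ultimately show "\<gamma> \<in> ?c ` ?B" using g by (intro image_eqI[of _ _ "(fst x, ang i j (fst x) (snd x))"]) auto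
  qed auto
  have "emeasure \<mu> (?c ` ?B) = (\<integral>\<^sup>+(l, a)\<in>?B. ennreal (sin a) \<partial>lborel)"
  proof (rule crossing_emeasure[OF nu_det(2)[OF i] Bb])
    show "?B \<subseteq> UNIV \<times> {0<..<pi}" by (rule order_trans[OF Int_lower1 Sigma_mono]) simp_all
    show "inj_on ?c ?B" by (rule inj_on_subset[OF crossing_inj_edge Int_lower1])
  qed
  then have e: "emeasure \<mu> (A \<inter> G i j) = (\<integral>\<^sup>+(l, a)\<in>?B. ennreal (sin a) \<partial>lborel)"
    by (simp only: im)
  have m1: "(\<lambda>x::real \<times> real. ennreal (sin (snd x)) * indicator ?B x) \<in> borel_measurable (lborel \<Otimes>\<^sub>M lborel)"
  proof -
    have "(\<lambda>x::real \<times> real. sin (snd x)) \<in> borel_measurable borel"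
      by (rule borel_measurable_continuous_onI) (intro continuous_intros)
    then have "(\<lambda>x::real \<times> real. ennreal (sin (snd x)) * indicator ?B x) \<in> borel_measurable borel"
      using Bb by (intro borel_measurable_times_ennreal measurable_compose[OF _ measurable_ennreal] borel_measurable_indicator) auto
    then show ?thesis by (simp add: lborel_prod)
  qed
  have m2: "(\<lambda>x. ennreal (W x) * indicator A (Psi i j x)) \<in> borel_measurable (lborel \<Otimes>\<^sub>M lborel)"
  proof -
    have "(\<lambda>x. ennreal (W x) * indicator A (Psi i j x)) \<in> borel_measurable borel"
      by (intro borel_measurable_times_ennreal measurable_compose[OF W_borel measurable_ennreal]
          measurable_compose[OF Psi_measurable[OF i] borel_measurable_indicator[OF A]])
    then show ?thesis by (simp add: lborel_prod)
  qed
  have "emeasure \<mu> (A \<inter> G i j) = (\<integral>\<^sup>+x. ennreal (sin (snd x)) * indicator ?B x \<partial>(lborel \<Otimes>\<^sub>M lborel))"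
    unfolding e lborel_prod by (simp add: case_prod_beta)
  also have "\<dots> = (\<integral>\<^sup>+l. \<integral>\<^sup>+a. ennreal (sin a) * indicator ?B (l, a) \<partial>lborel \<partial>lborel)"
    using lborel.nn_integral_fst[OF m1] by simp
  also have "\<dots> = (\<integral>\<^sup>+l. \<integral>\<^sup>+t. ennreal (W (l, t)) * indicator A (Psi i j (l, t)) \<partial>lborel \<partial>lborel)"
  proof (rule nn_integral_cong)
    fix l
    show "(\<integral>\<^sup>+a. ennreal (sin a) * indicator ?B (l, a) \<partial>lborel) = (\<integral>\<^sup>+t. ennreal (W (l, t)) * indicator A (Psi i j (l, t)) \<partial>lborel)"
    proof (cases "0 < l \<and> l < L i")
      case True
      then show ?thesis using inner_integral[OF _ _ A] by simp
    next
      case False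
      then have "W (l, t) = 0" "indicator ?B (l, t) = (0 :: ennreal)" for t by (auto simp: W_def rect_def)
      then show ?thesis by simp
    qed
  qed
  also have "\<dots> = (\<integral>\<^sup>+x. ennreal (W x) * indicator A (Psi i j x) \<partial>(lborel \<Otimes>\<^sub>M lborel))"
    using lborel.nn_integral_fst[OF m2] by simp
  finally show "emeasure \<mu> (A \<inter> G i j) = (\<integral>\<^sup>+x. ennreal (W x) * indicator A (Psi i j x) \<partial>lborel)"
    by (simp only: lborel_prod)
  have "emeasure \<mu> (A \<inter> G i j) \<le> (\<integral>\<^sup>+x. indicator ?R x \<partial>lborel)"
    unfolding e by (rule nn_integral_mono) (auto simp: indicator_def case_prod_beta)
  also have "\<dots> = emeasure lborel ?R" using Rb by simp
  also have "\<dots> = emeasure (lborel \<Otimes>\<^sub>M lborel) ?R" by (simp only: lborel_prod)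
  also have "\<dots> = emeasure lborel {0<..<L i} * emeasure lborel {0<..<pi}"
    by (rule lborel.emeasure_pair_measure_Times) auto
  also have "\<dots> < \<infinity>" using L_pos[OF i] by (simp add: ennreal_mult[symmetric] less_top)
  finally show "emeasure \<mu> (A \<inter> G i j) < \<infinity>" .
qed

text \<open>The density can be unbounded near the common vertex of adjacent edges, but its integral
  is the measure of \<open>G i j\<close>, which is finite.\<close>

lemma W_integrable: "integrable lborel W"
proof (rule integrableI_nonneg)
  have "space \<mu> \<in> sets \<mu>" by simp
  from G_emeasure[OF this] have "(\<integral>\<^sup>+x. ennreal (W x) * indicator (space \<mu>) (Psi i j x) \<partial>lborel) < \<infinity>" by simp
  moreover have "Psi i j x \<in> space \<mu>" for x
    using measurable_space[OF Psi_measurable[OF i], of x] by simp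
  ultimately show "(\<integral>\<^sup>+x. ennreal (W x) \<partial>lborel) < \<infinity>" by simp
qed (use W_borel W_nonneg in auto)

lemma pushforward:
  "distr (density lborel (\<lambda>x. ennreal (W x))) \<mu> (Psi i j) = density \<mu> (\<lambda>\<gamma>. ennreal (indicator (G i j) \<gamma>))"
proof (rule measure_eqI)
  fix A assume "A \<in> sets (distr (density lborel (\<lambda>x. ennreal (W x))) \<mu> (Psi i j))"
  then have A: "A \<in> sets \<mu>" by simp
  have PA: "Psi i j -` A \<inter> space borel \<in> sets borel" by (rule measurable_sets[OF Psi_measurable[OF i] A])
  have "emeasure (distr (density lborel (\<lambda>x. ennreal (W x))) \<mu> (Psi i j)) A = emeasure (density lborel (\<lambda>x. ennreal (W x))) (Psi i j -` A)"
    using A Psi_measurable[OF i, of j] by (subst emeasure_distr) auto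
  also have "\<dots> = (\<integral>\<^sup>+x. ennreal (W x) * indicator (Psi i j -` A) x \<partial>lborel)"
    using PA W_borel by (subst emeasure_density) auto
  also have "\<dots> = emeasure \<mu> (A \<inter> G i j)"
    unfolding G_emeasure(1)[OF A] by (intro nn_integral_cong) (auto simp: indicator_def)
  also have "\<dots> = (\<integral>\<^sup>+\<gamma>. indicator (A \<inter> G i j) \<gamma> \<partial>\<mu>)" using A G_sets[OF i j ij] by simp
  also have "\<dots> = (\<integral>\<^sup>+\<gamma>. ennreal (indicator (G i j) \<gamma>) * indicator A \<gamma> \<partial>\<mu>)"
    by (intro nn_integral_cong) (auto simp: indicator_def)
  also have "\<dots> = emeasure (density \<mu> (\<lambda>\<gamma>. ennreal (indicator (G i j) \<gamma>))) A"
    using A G_sets[OF i j ij] by (subst emeasure_density) auto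
  finally show "emeasure (distr (density lborel (\<lambda>x. ennreal (W x))) \<mu> (Psi i j)) A =
    emeasure (density \<mu> (\<lambda>\<gamma>. ennreal (indicator (G i j) \<gamma>))) A" .
qed simp

lemma G_integral:
  fixes F :: "pt set \<Rightarrow> real"
  assumes H: "continuous_on (rect i j) H" and F: "\<And>x. x \<in> rect i j \<Longrightarrow> F (Psi i j x) = H x"
    and int: "integrable lborel (\<lambda>x. indicator (rect i j) x * (H x * wt i j (fst x) (snd x)))"
  shows "integrable \<mu> (\<lambda>\<gamma>. indicator (G i j) \<gamma> * F \<gamma>)"
    "(\<integral>\<gamma>. indicator (G i j) \<gamma> * F \<gamma> \<partial>\<mu>) = (\<integral>x. indicator (rect i j) x * (H x * wt i j (fst x) (snd x)) \<partial>lborel)"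
proof -
  define F0 where "F0 \<gamma> = indicator (G i j) \<gamma> * F \<gamma>" for \<gamma>
  have m: "F0 \<in> borel_measurable \<mu>" unfolding F0_def[abs_def] by (rule G_measurable[OF i j ij H F])
  have idem: "indicator (G i j) \<gamma> *\<^sub>R F0 \<gamma> = F0 \<gamma>" for \<gamma> by (simp add: F0_def indicator_def)
  have WF: "W x *\<^sub>R F0 (Psi i j x) = indicator (rect i j) x * (H x * wt i j (fst x) (snd x))" for x
  proof (cases "x \<in> rect i j")
    case True
    then have "Psi i j x \<in> G i j" unfolding G_def by blast
    then show ?thesis using True F[OF True] by (simp add: W_def F0_def)
  qed (simp add: W_def)
  have Pm: "Psi i j \<in> measurable (density lborel (\<lambda>x. ennreal (W x))) \<mu>"
    using Psi_measurable[OF i] by simp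
  have PF: "(\<lambda>x. F0 (Psi i j x)) \<in> borel_measurable lborel"
    using measurable_compose[OF Psi_measurable[OF i] m] by simp
  have Gm: "(\<lambda>\<gamma>. indicator (G i j) \<gamma> :: real) \<in> borel_measurable \<mu>" using G_sets[OF i j ij] by simp
  have "integrable \<mu> F0 \<longleftrightarrow> integrable (density \<mu> (\<lambda>\<gamma>. ennreal (indicator (G i j) \<gamma>))) F0"
    using integrable_density[OF m Gm] by (simp add: idem del: real_scaleR_def)
  also have "\<dots> \<longleftrightarrow> integrable (density lborel (\<lambda>x. ennreal (W x))) (\<lambda>x. F0 (Psi i j x))"
    unfolding pushforward[symmetric] by (rule integrable_distr_eq[OF Pm m])
  also have "\<dots> \<longleftrightarrow> integrable lborel (\<lambda>x. W x *\<^sub>R F0 (Psi i j x))"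
    using W_borel W_nonneg by (intro integrable_density[OF PF]) auto
  finally have "integrable \<mu> F0" using int unfolding WF by simp
  then show "integrable \<mu> (\<lambda>\<gamma>. indicator (G i j) \<gamma> * F \<gamma>)" by (simp only: F0_def[abs_def])
  have "(\<integral>\<gamma>. F0 \<gamma> \<partial>\<mu>) = (\<integral>\<gamma>. F0 \<gamma> \<partial>density \<mu> (\<lambda>\<gamma>. ennreal (indicator (G i j) \<gamma>)))"
    using integral_density[OF m Gm] by (simp add: idem del: real_scaleR_def)
  also have "\<dots> = (\<integral>x. F0 (Psi i j x) \<partial>density lborel (\<lambda>x. ennreal (W x)))"
    unfolding pushforward[symmetric] by (rule integral_distr[OF Pm m])
  also have "\<dots> = (\<integral>x. W x *\<^sub>R F0 (Psi i j x) \<partial>lborel)"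
    using W_borel W_nonneg by (intro integral_density[OF PF]) auto
  finally have "(\<integral>\<gamma>. F0 \<gamma> \<partial>\<mu>) = (\<integral>x. indicator (rect i j) x * (H x * wt i j (fst x) (snd x)) \<partial>lborel)"
    unfolding WF .
  then show "(\<integral>\<gamma>. indicator (G i j) \<gamma> * F \<gamma> \<partial>\<mu>) = (\<integral>x. indicator (rect i j) x * (H x * wt i j (fst x) (snd x)) \<partial>lborel)"
    by (simp only: F0_def[abs_def])
qed

end

end

section \<open>Geodesics through a vertex\<close>

text \<open>The pieces may overlap, since superlevel sets are just united.\<close>

lemma borel_measurable_cover:
  fixes F :: "'a \<Rightarrow> real"
  assumes I: "finite I" and A: "\<And>k. k \<in> I \<Longrightarrow> A k \<in> sets M" and U: "(\<Union>k\<in>I. A k) = B"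
    and F: "\<And>k. k \<in> I \<Longrightarrow> (\<lambda>x. indicator (A k) x * F x) \<in> borel_measurable M"
  shows "(\<lambda>x. indicator B x * F x) \<in> borel_measurable M"
proof (rule borel_measurableI_greater)
  fix y :: real
  have B: "B \<in> sets M" unfolding U[symmetric] using I A by (rule sets.finite_UN)
  have "{x \<in> space M. y < indicator B x * F x} =
    (if y < 0 then space M - B else {}) \<union> (\<Union>k\<in>I. A k \<inter> {x \<in> space M. y < indicator (A k) x * F x})"
  proof (intro set_eqI)
    fix x
    show "x \<in> {x \<in> space M. y < indicator B x * F x} \<longleftrightarrow>
      x \<in> (if y < 0 then space M - B else {}) \<union> (\<Union>k\<in>I. A k \<inter> {x \<in> space M. y < indicator (A k) x * F x})"
    proof (cases "x \<in> B")
      case True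
      then obtain k where "k \<in> I" "x \<in> A k" using U by blast
      then show ?thesis using True by auto
    next
      case False
      then show ?thesis using U by auto
    qed
  qed
  also have "\<dots> \<in> sets M"
  proof (rule sets.Un)
    show "(if y < 0 then space M - B else {}) \<in> sets M" using B by auto
    have "A k \<inter> {x \<in> space M. y < indicator (A k) x * F x} \<in> sets M" if "k \<in> I" for k
      using borel_measurable_less[OF borel_measurable_const F[OF that], of y] A[OF that] by auto
    then show "(\<Union>k\<in>I. A k \<inter> {x \<in> space M. y < indicator (A k) x * F x}) \<in> sets M"
      using I by (intro sets.finite_UN) auto
  qed
  finally show "{x \<in> space M. y < indicator B x * F x} \<in> sets M" .
qed

context polygon_measure
begin

definition Nv :: "nat \<Rightarrow> pt set set" where "Nv k = {\<gamma> \<in> geodesics K. P k \<in> \<gamma>}"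

lemma Nv_form:
  assumes "\<gamma> \<in> Nv k"
  obtains u where "(P k, u) \<in> unit_tangent K" "\<gamma> = geodesic K (P k) u"
proof -
  obtain p v where pv: "(p, v) \<in> unit_tangent K" "\<gamma> = geodesic K p v" "P k \<in> geodesic K p v"
    using assms unfolding Nv_def geodesics_def by blast
  then obtain \<tau> where \<tau>: "P k = geo K p v \<tau>" by (auto simp: geodesic_def)
  show thesis
    by (rule that[of "geo_vel K p v \<tau>"]) (use geo_unit_tangent[OF pv(1), of \<tau>] pv(2) \<tau> geodesic_shift in simp_all)
qed

lemma meets_vertex: "meets ({P k} \<times> Y) = {\<gamma> \<in> Nv k. \<exists>y\<in>Y. y \<in> \<gamma>}"
  unfolding meets_def Nv_def by auto

lemma vertex_surface: "k < n \<Longrightarrow> P k \<in> surface K"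
  using P_in_D D_surface by blast

lemma meets_vertex_sets:
  assumes "k < n" "compact Y" "Y \<subseteq> surface K"
  shows "{\<gamma> \<in> Nv k. \<exists>y\<in>Y. y \<in> \<gamma>} \<in> sets \<mu>"
  unfolding meets_vertex[symmetric]
  by (rule meets_compact) (use assms vertex_surface in \<open>auto intro!: compact_Times\<close>)

lemma Nv_sets:
  assumes "k < n"
  shows "Nv k \<in> sets \<mu>"
proof -
  have "{\<gamma> \<in> Nv k. \<exists>y\<in>{P k}. y \<in> \<gamma>} \<in> sets \<mu>"
    by (rule meets_vertex_sets[OF assms]) (use vertex_surface[OF assms] in auto)
  also have "{\<gamma> \<in> Nv k. \<exists>y\<in>{P k}. y \<in> \<gamma>} = Nv k" by (auto simp: Nv_def)
  finally show ?thesis .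
qed

lemma geodesic_same_direction:
  assumes "(p, u) \<in> unit_tangent K" "(p, v) \<in> unit_tangent K" "geodesic K p u = geodesic K p v"
  shows "det3 p v u = 0"
proof -
  obtain t where t: "0 < t" "sinK K t > 0" by (rule small_step[of 1 K]) auto
  have "geo K p u t \<in> geodesic K p u" unfolding geodesic_def by (rule rangeI)
  then have "det3 p v (geo K p u t) = 0"
    using geodesic_iff[OF assms(2) geo_in_surface[OF assms(1)], of t] assms(3) by simp
  then show ?thesis using t by (simp add: geo_def det3_linear)
qed

text \<open>Apart from the line of edge \<open>k\<close>, these geodesics cross it at parameter
  \<open>0\<close>, which is a null set in the chart. The line itself would have angle
  \<open>0\<close>, outside this chart; with the frame vectors exchanged it is crossed at a right
  angle.\<close>

lemma Nv_null:
  assumes k: "k < n"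
  shows "Nv k \<in> null_sets \<mu>"
proof -
  let ?g = "geodesic K (P k) (V k)"
  note fr = nu_det(2)[OF k] and det = edge_frame(2)[OF k, of 0, simplified]
  obtain \<tau> where \<tau>: "0 < \<tau>" "sinK K \<tau> > 0" by (rule small_step[of 1 K]) auto
  have "{\<gamma> \<in> Nv k. \<exists>y\<in>{E k \<tau>}. y \<in> \<gamma>} \<in> sets \<mu>"
    by (rule meets_vertex_sets[OF k]) (use E_surface[OF k] in auto)
  also have "{\<gamma> \<in> Nv k. \<exists>y\<in>{E k \<tau>}. y \<in> \<gamma>} = {?g}"
  proof (intro equalityI subsetI)
    fix \<gamma> assume "\<gamma> \<in> {\<gamma> \<in> Nv k. \<exists>y\<in>{E k \<tau>}. y \<in> \<gamma>}"
    then obtain p v where pv: "(p, v) \<in> unit_tangent K" "\<gamma> = geodesic K p v" "P k \<in> \<gamma>" "E k \<tau> \<in> \<gamma>"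
      unfolding Nv_def geodesics_def by blast
    have "det3 p v (P k) = 0" "det3 p v (E k \<tau>) = 0"
      using geodesic_iff[OF pv(1) vertex_surface[OF k]] geodesic_iff[OF pv(1) E_surface[OF k]] pv by simp_all
    then have "geodesic K p v = ?g" using geodesic_eqI[OF pv(1) vertex_unit_tangent[OF k], of \<tau>] \<tau> by simp
    then show "\<gamma> \<in> {?g}" using pv(2) by simp
  next
    fix \<gamma> assume "\<gamma> \<in> {?g}"
    moreover have "geo K (P k) (V k) 0 \<in> ?g" "geo K (P k) (V k) \<tau> \<in> ?g" unfolding geodesic_def by (rule rangeI)+
    ultimately show "\<gamma> \<in> {\<gamma> \<in> Nv k. \<exists>y\<in>{E k \<tau>}. y \<in> \<gamma>}"
      using geodesicsI[OF vertex_unit_tangent[OF k]] by (simp add: Nv_def)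
  qed
  finally have gs: "{?g} \<in> sets \<mu>" .
  let ?B = "{0::real} \<times> {0<..<pi}"
  let ?c = "crossing K (P k) (V k) (nu k)"
  have im: "?c ` ?B = Nv k - {?g}"
  proof (intro equalityI subsetI)
    fix \<gamma> assume "\<gamma> \<in> ?c ` ?B"
    then obtain a where a: "0 < a" "a < pi" "\<gamma> = ?c (0, a)" by auto
    define u where "u = cos a *\<^sub>R V k + sin a *\<^sub>R nu k"
    have u: "(P k, u) \<in> unit_tangent K" using crossing_direction[OF fr, of 0 a] by (simp add: u_def)
    have \<gamma>: "\<gamma> = geodesic K (P k) u" using a(3) by (simp add: crossing_eq u_def)
    have "geo K (P k) u 0 \<in> \<gamma>" unfolding \<gamma> geodesic_def by (rule rangeI)
    then have "\<gamma> \<in> Nv k" using \<gamma> geodesicsI[OF u] by (simp add: Nv_def)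
    moreover have "\<gamma> \<noteq> ?g"
    proof
      assume "\<gamma> = ?g"
      then have "det3 (P k) (V k) u = 0" using geodesic_same_direction[OF u vertex_unit_tangent[OF k]] \<gamma> by simp
      then show False using det sin_gt_zero[OF a(1,2)] by (simp add: u_def det3_linear)
    qed
    ultimately show "\<gamma> \<in> Nv k - {?g}" by simp
  next
    fix \<gamma> assume g: "\<gamma> \<in> Nv k - {?g}"
    then have "\<gamma> \<in> Nv k" by simp
    then obtain u where u: "(P k, u) \<in> unit_tangent K" "\<gamma> = geodesic K (P k) u" by (rule Nv_form)
    define b c where bc: "b = det3 (P k) u (nu k)" "c = det3 (P k) (V k) u"
    have uc: "u = b *\<^sub>R V k + c *\<^sub>R nu k" "b\<^sup>2 + c\<^sup>2 = 1"
      using unit_tangent_components(1,2)[OF fr det u(1)] by (simp_all add: bc)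
    have c: "c \<noteq> 0"
    proof
      assume "c = 0"
      then have "u = V k \<or> u = - V k" using unit_tangent_parallel[OF vertex_unit_tangent[OF k] u(1)] by (simp add: bc)
      then have "\<gamma> = ?g" using u(2) geodesic_uminus by metis
      then show False using g by simp
    qed
    define a where "a = arccos (sgn c * b)"
    have "b\<^sup>2 < 1" using uc(2) c by (smt (verit) zero_less_power2)
    then have "\<bar>b\<bar> < 1" by (simp add: abs_square_less_1)
    then have b: "- 1 < sgn c * b" "sgn c * b < 1" by (auto simp: sgn_if)
    have a: "0 < a" "a < pi" using arccos_lt_bounded[OF b] by (simp_all add: a_def)
    have "cos a = sgn c * b" using b by (simp add: a_def)
    moreover have "sin a = sgn c * c"
    proof -
      have "1 - (sgn c * b)\<^sup>2 = (sgn c * c)\<^sup>2" using uc(2) c by (simp add: sgn_if)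
      moreover have "sgn c * c \<ge> 0" by (simp add: sgn_if)
      ultimately show ?thesis using b by (simp add: a_def sin_arccos)
    qed
    ultimately have "cos a *\<^sub>R V k + sin a *\<^sub>R nu k = sgn c *\<^sub>R u" by (simp add: uc(1) scaleR_add_right)
    then have "?c (0, a) = geodesic K (P k) (sgn c *\<^sub>R u)" by (simp add: crossing_eq)
    also have "\<dots> = \<gamma>" using c u(2) geodesic_uminus by (simp add: sgn_if)
    finally show "\<gamma> \<in> ?c ` ?B" using a by (intro image_eqI[of _ _ "(0, a)"]) auto
  qed
  have null: "(\<integral>\<^sup>+(l, a)\<in>{0::real} \<times> A. ennreal (sin a) \<partial>lborel) = 0" if A: "A \<in> sets borel" for A :: "real set"
  proof -
    have "emeasure (lborel \<Otimes>\<^sub>M lborel) ({0::real} \<times> A) = emeasure lborel {0::real} * emeasure lborel A"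
      using A by (intro lborel.emeasure_pair_measure_Times) auto
    then have "emeasure lborel ({0::real} \<times> A) = 0" by (simp add: lborel_prod)
    moreover have "{0::real} \<times> A \<in> sets lborel" using A by (simp add: borel_Times)
    ultimately have "{0::real} \<times> A \<in> null_sets lborel" by (rule null_setsI)
    then show ?thesis by (rule nn_integral_null_set)
  qed
  have "emeasure \<mu> (?c ` ?B) = (\<integral>\<^sup>+(l, a)\<in>?B. ennreal (sin a) \<partial>lborel)"
  proof (rule crossing_emeasure[OF fr])
    show "?B \<in> sets borel" by (rule borel_Times) auto
    show "?B \<subseteq> UNIV \<times> {0<..<pi}" by (rule Sigma_mono) simp_all
    show "inj_on ?c ?B"
    proof (rule inj_onI)
      fix x y assume x: "x \<in> ?B" and y: "y \<in> ?B" and eq: "?c x = ?c y"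
      have "fst x = fst y \<and> snd x = snd y"
        by (rule crossing_inj[OF fr nu_det(1)[OF k]]) (use x y eq in auto)
      then show "x = y" by (simp add: prod_eq_iff)
    qed
  qed
  then have 1: "emeasure \<mu> (Nv k - {?g}) = 0" unfolding im using null by simp
  have fr2: "orthonormal_frame K (P k) (nu k) (V k)"
    using fr riem_sym[of K "V k" "nu k"] by (auto simp: orthonormal_frame_def)
  have "emeasure \<mu> (crossing K (P k) (nu k) (V k) ` ({0} \<times> {pi / 2})) = (\<integral>\<^sup>+(l, a)\<in>{0::real} \<times> {pi / 2}. ennreal (sin a) \<partial>lborel)"
    by (rule crossing_emeasure[OF fr2]) (auto intro!: borel_Times)
  also have "crossing K (P k) (nu k) (V k) ` ({0} \<times> {pi / 2}) = {?g}" by (simp add: crossing_eq)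
  also have "(\<integral>\<^sup>+(l, a)\<in>{0::real} \<times> {pi / 2}. ennreal (sin a) \<partial>lborel) = 0" by (rule null) simp
  finally have 2: "emeasure \<mu> {?g} = 0" .
  have "(Nv k - {?g}) \<union> {?g} \<in> null_sets \<mu>"
    using 1 2 gs Nv_sets[OF k] by (intro null_sets.Un null_setsI) auto
  moreover have "Nv k \<subseteq> (Nv k - {?g}) \<union> {?g}" by blast
  ultimately show ?thesis using null_sets_subset Nv_sets[OF k] by blast
qed

text \<open>
  \<open>\<mu>\<close> need not be complete, so measurability is not automatic on the null set of geodesics through a
  vertex. If \<open>D\<close> contains two antipodal vertices, then it is a lune, and a geodesic which meets \<open>D\<close> only
  in these has no chord; its \<open>chord_length\<close> is the junk value \<open>THE r. False\<close>.
\<close>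

lemma Nv_chord_measurable:
  assumes k: "k < n"
  shows "(\<lambda>\<gamma>. indicator (Nv k) \<gamma> * chord_length K D \<gamma>) \<in> borel_measurable \<mu>"
proof (cases "- P k \<in> D")
  case True
  \<comment> \<open>A compact exhaustion of \<open>D\<close> without \<open>P k\<close> and
    \<open>- P k\<close>, so that meeting a further point of \<open>D\<close> is a measurable
    condition.\<close>
  define Y where "Y m = D \<inter> {y. dist y (P k) \<ge> inverse (real (Suc m)) \<and> dist y (- P k) \<ge> inverse (real (Suc m))}" for m
  define A where "A = (\<Union>m. {\<gamma> \<in> Nv k. \<exists>y\<in>Y m. y \<in> \<gamma>})"
  have cY: "compact (Y m)" for m
    unfolding Y_def by (intro compact_Int_closed D_compact closed_Collect_conj closed_Collect_le continuous_intros)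
  have "{\<gamma> \<in> Nv k. \<exists>y\<in>Y m. y \<in> \<gamma>} \<in> sets \<mu>" for m
    by (rule meets_vertex_sets[OF k cY]) (use D_surface in \<open>auto simp: Y_def\<close>)
  then have As: "A \<in> sets \<mu>" unfolding A_def by (intro sets.countable_UN) auto
  have Aiff: "\<gamma> \<in> A \<longleftrightarrow> \<gamma> \<in> Nv k \<and> (\<exists>y\<in>\<gamma>. y \<in> D \<and> y \<noteq> P k \<and> y \<noteq> - P k)" for \<gamma>
  proof -
    have "(\<exists>m. y \<in> Y m) \<longleftrightarrow> y \<in> D \<and> y \<noteq> P k \<and> y \<noteq> - P k" for y
    proof
      assume "\<exists>m. y \<in> Y m"
      then obtain m where "y \<in> D" "inverse (real (Suc m)) \<le> dist y (P k)" "inverse (real (Suc m)) \<le> dist y (- P k)" by (auto simp: Y_def)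
      moreover have "0 < inverse (real (Suc m))" by simp
      ultimately have "dist y (P k) > 0" "dist y (- P k) > 0" by linarith+
      then show "y \<in> D \<and> y \<noteq> P k \<and> y \<noteq> - P k" using \<open>y \<in> D\<close> by auto
    next
      assume y: "y \<in> D \<and> y \<noteq> P k \<and> y \<noteq> - P k"
      then have "0 < min (dist y (P k)) (dist y (- P k))" by simp
      then obtain m where "inverse (real (Suc m)) < min (dist y (P k)) (dist y (- P k))" using reals_Archimedean by blast
      then show "\<exists>m. y \<in> Y m" using y by (intro exI[of _ m]) (simp add: Y_def)
    qed
    then show ?thesis unfolding A_def by blast
  qed
  have val: "indicator (Nv k) \<gamma> * chord_length K D \<gamma> =
      indicator A \<gamma> * (pi / sqrt K) + indicator (Nv k - A) \<gamma> * (THE r. False)" for \<gamma>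
  proof (cases "\<gamma> \<in> Nv k")
    case N: True
    then obtain u where u: "(P k, u) \<in> unit_tangent K" "\<gamma> = geodesic K (P k) u" by (rule Nv_form)
    show ?thesis
    proof (cases "\<gamma> \<in> A")
      case A: True
      then obtain y where "y \<in> \<gamma>" "y \<in> D" "y \<noteq> P k" "y \<noteq> - P k" using Aiff by blast
      then have "chord_length K D \<gamma> = pi / sqrt K" using lune_chord[OF k True u(1)] u(2) by simp
      then show ?thesis using N A by simp
    next
      case False
      have "chord_length K D \<gamma> = (THE r. False)"
        by (rule lune_no_chord[OF k True]) (use N False Aiff in \<open>auto simp: Nv_def\<close>)
      then show ?thesis using N False by simp
    qed
  next
    case False
    then have "\<gamma> \<notin> A" using Aiff by blast
    then show ?thesis using False by simp
  qed
  show ?thesis unfolding val using As Nv_sets[OF k] by simp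
next
  case False
  define C where "C m = (if K > 0 then pi / sqrt K else real m)" for m :: nat
  \<comment> \<open>The points of \<open>D\<close> at polar distance between \<open>c\<close> and
    \<open>C m\<close> from \<open>P k\<close>. For \<open>c > 0\<close>, a chord starting at
    \<open>P k\<close> has length at least \<open>c\<close> iff it contains such a point for some
    \<open>m\<close>; for \<open>K > 0\<close> half a period bounds all these chords.\<close>
  define Y where "Y c m = D \<inter> (\<lambda>x. geo K (P k) (cos (fst x) *\<^sub>R V k + sin (fst x) *\<^sub>R nu k) (snd x)) ` ({0..2 * pi} \<times> {c..C m})" for c m
  note fr = nu_det(2)[OF k] and det = edge_frame(2)[OF k, of 0, simplified]
  have sets: "{\<gamma> \<in> Nv k. \<exists>y\<in>Y c m. y \<in> \<gamma>} \<in> sets \<mu>" for c m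
  proof (rule meets_vertex_sets[OF k])
    have "compact ((\<lambda>x. geo K (P k) (cos (fst x) *\<^sub>R V k + sin (fst x) *\<^sub>R nu k) (snd x)) ` ({0..2 * pi} \<times> {c..C m}))"
      by (intro compact_continuous_image compact_Times continuous_intros compact_Icc)
    then show "compact (Y c m)" unfolding Y_def by (intro compact_Int D_compact)
    show "Y c m \<subseteq> surface K" using D_surface by (auto simp: Y_def)
  qed
  have level: "{\<gamma> \<in> Nv k. c \<le> chord_length K D \<gamma>} = (\<Union>m. {\<gamma> \<in> Nv k. \<exists>y\<in>Y c m. y \<in> \<gamma>})" if c: "c > 0" for c
  proof -
    have "c \<le> chord_length K D \<gamma> \<longleftrightarrow> (\<exists>m. \<exists>y\<in>Y c m. y \<in> \<gamma>)" if N: "\<gamma> \<in> Nv k" for \<gamma>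
    proof -
      obtain u where u: "(P k, u) \<in> unit_tangent K" "\<gamma> = geodesic K (P k) u" by (rule Nv_form[OF N])
      obtain v r where vr: "0 \<le> r" "K > 0 \<Longrightarrow> r < pi / sqrt K" "is_chord K D \<gamma> (P k) v r"
        using vertex_geodesic_chord[OF k u(1) False] u(2) by metis
      have v: "(P k, v) \<in> unit_tangent K" and gD: "\<gamma> \<inter> D = geo K (P k) v ` {0..r}"
        using vr(3) unfolding is_chord_def by blast+
      have len: "chord_length K D \<gamma> = r"
      proof (rule chord_length_eq[OF vr(3)])
        assume K: "K > 0"
        have "2 * pi / sqrt K = pi / sqrt K + pi / sqrt K" by simp
        then show "r < 2 * pi / sqrt K" using vr(1,2) K by force
      qed
      show ?thesis
      proof
        assume "c \<le> chord_length K D \<gamma>"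
        then have cr: "c \<le> r" using len by simp
        obtain m where m: "r \<le> real m" using real_arch_simple by blast
        have rC: "r \<le> C m" using m vr(2) by (auto simp: C_def)
        obtain a where a: "0 \<le> a" "a \<le> 2 * pi" "det3 (P k) v (nu k) = cos a" "det3 (P k) (V k) v = sin a"
          using sincos_total_2pi_le[OF unit_tangent_components(2)[OF fr det v]] by blast
        have "v = cos a *\<^sub>R V k + sin a *\<^sub>R nu k"
          using unit_tangent_components(1)[OF fr det v] a by simp
        then have "geo K (P k) v r \<in> (\<lambda>x. geo K (P k) (cos (fst x) *\<^sub>R V k + sin (fst x) *\<^sub>R nu k) (snd x)) ` ({0..2 * pi} \<times> {c..C m})"
          using a cr rC by (intro image_eqI[of _ _ "(a, r)"]) auto
        moreover have "geo K (P k) v r \<in> \<gamma> \<inter> D" unfolding gD using vr(1) by (intro imageI) simp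
        ultimately show "\<exists>m. \<exists>y\<in>Y c m. y \<in> \<gamma>" unfolding Y_def by blast
      next
        assume "\<exists>m. \<exists>y\<in>Y c m. y \<in> \<gamma>"
        then obtain m y where y: "y \<in> Y c m" "y \<in> \<gamma>" by blast
        then obtain a b where ab: "c \<le> b" "b \<le> C m" "y = geo K (P k) (cos a *\<^sub>R V k + sin a *\<^sub>R nu k) b" by (auto simp: Y_def)
        define w where "w = cos a *\<^sub>R V k + sin a *\<^sub>R nu k"
        have w: "(P k, w) \<in> unit_tangent K" using crossing_direction[OF fr, of 0 a] by (simp add: w_def)
        have yD: "y \<in> \<gamma> \<inter> D" using y by (simp add: Y_def)
        then obtain r1 where r1: "0 \<le> r1" "r1 \<le> r" "y = geo K (P k) v r1" unfolding gD by auto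
        have "w = v \<and> b = r1"
        proof (rule geo_polar_unique[OF w v])
          show "geo K (P k) w b = geo K (P k) v r1" using ab(3) r1(3) by (simp add: w_def)
          show "0 < b" using ab c by simp
          show "b < pi / sqrt K" if K: "K > 0"
          proof -
            have "b \<noteq> pi / sqrt K"
            proof
              assume "b = pi / sqrt K"
              then have "y = - P k" using ab(3) K by (simp add: geo_def half_period)
              then show False using False yD by simp
            qed
            then show ?thesis using ab(2) K by (simp add: C_def)
          qed
          show "r1 \<le> pi / sqrt K" if "K > 0" using r1(2) vr(2)[OF that] by simp
        qed (rule r1(1))
        then show "c \<le> chord_length K D \<gamma>" using ab r1 len by simp
      qed
    qed
    then show ?thesis by blast
  qed
  have nonneg: "0 \<le> indicator (Nv k) \<gamma> * chord_length K D \<gamma>" for \<gamma>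
  proof (cases "\<gamma> \<in> Nv k")
    case N: True
    obtain u where u: "(P k, u) \<in> unit_tangent K" "\<gamma> = geodesic K (P k) u" by (rule Nv_form[OF N])
    obtain v r where vr: "0 \<le> r" "K > 0 \<Longrightarrow> r < pi / sqrt K" "is_chord K D \<gamma> (P k) v r"
      using vertex_geodesic_chord[OF k u(1) False] u(2) by metis
    have "chord_length K D \<gamma> = r"
    proof (rule chord_length_eq[OF vr(3)])
      assume K: "K > 0"
      have "2 * pi / sqrt K = pi / sqrt K + pi / sqrt K" by simp
      then show "r < 2 * pi / sqrt K" using vr(1,2) K by force
    qed
    then show ?thesis using vr(1) N by simp
  qed simp
  show ?thesis
  proof (rule borel_measurableI_ge)
    fix c :: real
    show "{\<gamma> \<in> space \<mu>. c \<le> indicator (Nv k) \<gamma> * chord_length K D \<gamma>} \<in> sets \<mu>"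
    proof (cases "c > 0")
      case True
      have "{\<gamma> \<in> space \<mu>. c \<le> indicator (Nv k) \<gamma> * chord_length K D \<gamma>} = {\<gamma> \<in> Nv k. c \<le> chord_length K D \<gamma>}"
        using True by (auto simp: indicator_def Nv_def space_\<mu> split: if_splits)
      also have "\<dots> \<in> sets \<mu>" unfolding level[OF True] using sets by (intro sets.countable_UN) auto
      finally show ?thesis .
    next
      case False
      then have "c \<le> indicator (Nv k) \<gamma> * chord_length K D \<gamma>" for \<gamma> using nonneg[of \<gamma>] by linarith
      then have "{\<gamma> \<in> space \<mu>. c \<le> indicator (Nv k) \<gamma> * chord_length K D \<gamma>} = space \<mu>" by simp
      then show ?thesis by simp
    qed
  qed
qed

end

section \<open>Integration over all chords\<close>

lemma integral_reflect_interval: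
  fixes f :: "real \<Rightarrow> real"
  assumes f: "continuous_on UNIV f" and l: "0 \<le> l"
  shows "(\<integral>s. indicator {0<..<l} s *\<^sub>R (f s + f (l - s)) \<partial>lborel) = 2 * integral {0..l} f"
proof -
  have c1: "continuous_on S f" for S by (rule continuous_on_subset[OF f]) simp
  have c2: "continuous_on S (\<lambda>s. f (l - s))" for S
    by (rule continuous_on_compose2[OF f]) (auto intro!: continuous_intros)
  have c: "continuous_on S (\<lambda>s. f s + f (l - s))" for S by (intro continuous_on_add c1 c2)
  have "integral {0..l} (\<lambda>s. f (l - s)) = integral {- 0..- (- l)} (\<lambda>s. f (- s + l))" by simp
  also have "\<dots> = integral {- l..0} (\<lambda>s. f (s + l))"
    using Henstock_Kurzweil_Integration.integral_reflect_real[of 0 "- l" "\<lambda>s. f (s + l)"] by simp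
  also have "\<dots> = integral {0..l} f"
    using integral_shift[of "- l" l 0 f] c1 by (simp add: o_def)
  finally have r: "integral {0..l} (\<lambda>s. f (l - s)) = integral {0..l} f" .
  have i: "set_integrable lborel {0..l} (\<lambda>s. f s + f (l - s))" by (rule borel_integrable_atLeastAtMost'[OF c])
  have "(\<integral>s. indicator {0<..<l} s *\<^sub>R (f s + f (l - s)) \<partial>lborel) = (\<integral>s. indicator {0..l} s *\<^sub>R (f s + f (l - s)) \<partial>lborel)"
  proof (rule integral_cong_AE)
    show "(\<lambda>t. indicator {0<..<l} t *\<^sub>R (f t + f (l - t))) \<in> borel_measurable lborel"
      using borel_measurable_continuous_on_indicator[OF _ c, of "{0<..<l}"] by (simp del: real_scaleR_def)
    show "(\<lambda>t. indicator {0..l} t *\<^sub>R (f t + f (l - t))) \<in> borel_measurable lborel"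
      using borel_measurable_continuous_on_indicator[OF _ c, of "{0..l}"] by (simp del: real_scaleR_def)
    have "AE t in lborel. t \<noteq> 0 \<and> t \<noteq> l" using AE_lborel_singleton[of 0] AE_lborel_singleton[of l] by eventually_elim simp
    then show "AE t in lborel. indicator {0<..<l} t *\<^sub>R (f t + f (l - t)) = indicator {0..l} t *\<^sub>R (f t + f (l - t))"
      by eventually_elim (auto simp: indicator_def)
  qed
  also have "\<dots> = integral {0..l} (\<lambda>s. f s + f (l - s))"
    using set_borel_integral_eq_integral(2)[OF i] by (simp add: set_lebesgue_integral_def)
  also have "\<dots> = integral {0..l} f + integral {0..l} (\<lambda>s. f (l - s))"
    by (rule Henstock_Kurzweil_Integration.integral_add) (intro integrable_continuous_interval c1 c2)+
  finally show ?thesis using r by simp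
qed

context polygon_measure
begin

section \<open>Counting chords by ordered pairs of edges\<close>

definition Pairs :: "(nat \<times> nat) set" where "Pairs = {(i, j). i < n \<and> j < n \<and> i \<noteq> j}"

lemma finite_Pairs: "finite Pairs"
  by (rule finite_subset[of _ "{..<n} \<times> {..<n}"]) (auto simp: Pairs_def)

lemma meeting_cover:
  assumes "\<gamma> \<in> geodesics_meeting K D"
  shows "(\<exists>k<n. \<gamma> \<in> Nv k) \<or> (\<exists>(i, j)\<in>Pairs. \<gamma> \<in> G i j)"
proof (rule disjCI)
  assume no: "\<not> (\<exists>(i, j)\<in>Pairs. \<gamma> \<in> G i j)"
  obtain p v x where pv: "(p, v) \<in> unit_tangent K" "\<gamma> = geodesic K p v" and x: "x \<in> \<gamma>" "x \<in> D" and g: "\<gamma> \<in> geodesics K"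
    using assms unfolding geodesics_meeting_def geodesics_def by blast
  obtain \<tau> where \<tau>: "x = geo K p v \<tau>" using x(1) pv(2) by (auto simp: geodesic_def)
  define w where "w = geo_vel K p v \<tau>"
  have w: "(x, w) \<in> unit_tangent K" using geo_unit_tangent[OF pv(1), of \<tau>] \<tau> by (simp add: w_def)
  have \<gamma>: "\<gamma> = geodesic K x w" using pv(2) geodesic_shift \<tau> by (simp add: w_def)
  show "\<exists>k<n. \<gamma> \<in> Nv k"
  proof (rule ccontr)
    assume nv: "\<not> (\<exists>k<n. \<gamma> \<in> Nv k)"
    have "det3 x w (P k) \<noteq> 0" if "k < n" for k
      using nv that geodesic_iff[OF w vertex_surface[OF that]] g \<gamma> by (auto simp: Nv_def)
    then obtain i j s t where ij: "i < n" "j < n" "i \<noteq> j" "0 < s" "s < L i" "0 < t" "t < L j"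
      "det3 x w (E i s) = 0" "det3 x w (E j t) = 0"
      using meets_two_edges[OF w x(2)] by blast
    have r: "(s, t) \<in> rect i j" using ij by (simp add: rect_iff)
    have "\<gamma> = Psi i j (s, t)"
      unfolding \<gamma> by (rule Psi_unique[OF ij(1-3) r w]) (use ij in simp_all)
    then have "\<gamma> \<in> G i j" using r unfolding G_def by blast
    then show False using no ij by (auto simp: Pairs_def)
  qed
qed

lemma G_subset: "(i, j) \<in> Pairs \<Longrightarrow> G i j \<subseteq> geodesics_meeting K D"
proof
  fix \<gamma> assume p: "(i, j) \<in> Pairs" and g: "\<gamma> \<in> G i j"
  then have ij: "i < n" "j < n" "i \<noteq> j" by (auto simp: Pairs_def)
  obtain x where x: "x \<in> rect i j" "\<gamma> = Psi i j x" using g unfolding G_def by blast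
  have "\<gamma> \<in> geodesics K" using x(2) crossing_in_geodesics[OF nu_det(2)[OF ij(1)]] by (simp add: Psi_def)
  moreover have "E i (fst x) \<in> \<gamma>" using Psi_ends(1)[OF ij x(1)] x(2) by simp
  moreover have "E i (fst x) \<in> D" by (rule edge_in_D) (use ij x in \<open>auto simp: rect_iff\<close>)
  ultimately show "\<gamma> \<in> geodesics_meeting K D" unfolding geodesics_meeting_def by blast
qed

lemma Nv_subset: "k < n \<Longrightarrow> Nv k \<subseteq> geodesics_meeting K D"
  using P_in_D unfolding geodesics_meeting_def Nv_def by blast

text \<open>The ends of the chord are the only boundary points on the geodesic, so the edges are
  determined up to order.\<close>

lemma G_count:
  assumes "(i, j) \<in> Pairs" "\<gamma> \<in> G i j"
  shows "{q \<in> Pairs. \<gamma> \<in> G (fst q) (snd q)} = {(i, j), (j, i)}"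
proof -
  have ij: "i < n" "j < n" "i \<noteq> j" using assms(1) by (auto simp: Pairs_def)
  obtain x where x: "x \<in> rect i j" "\<gamma> = Psi i j x" using assms(2) unfolding G_def by blast
  have "q = (i, j) \<or> q = (j, i)" if q: "q \<in> Pairs" "\<gamma> \<in> G (fst q) (snd q)" for q
  proof -
    obtain k l where kl: "q = (k, l)" by (cases q)
    have k: "k < n" "l < n" "k \<noteq> l" using q(1) kl by (auto simp: Pairs_def)
    obtain y where y: "y \<in> rect k l" "\<gamma> = Psi k l y" using q(2) kl unfolding G_def by auto
    note e = Psi_ends[OF k y(1)]
    have "k = i \<or> k = j" using Psi_edges[OF ij x(1) k(1), of "fst y"] e(1) x(2) y by (auto simp: rect_iff)
    moreover have "l = i \<or> l = j" using Psi_edges[OF ij x(1) k(2), of "snd y"] e(2) x(2) y by (auto simp: rect_iff)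
    ultimately show ?thesis using k(3) kl by auto
  qed
  moreover have "\<gamma> \<in> G j i"
  proof -
    have r: "(snd x, fst x) \<in> rect j i" using x(1) by (simp add: rect_iff)
    obtain p v where pv: "(p, v) \<in> unit_tangent K" "\<gamma> = geodesic K p v"
      using assms G_subset[OF assms(1)] unfolding geodesics_meeting_def geodesics_def by blast
    have "det3 p v (E i (fst x)) = 0" "det3 p v (E j (snd x)) = 0"
      using Psi_ends[OF ij x(1)] x(2) pv geodesic_iff[OF pv(1) E_surface] ij by auto
    then have "geodesic K p v = Psi j i (snd x, fst x)"
      by (intro Psi_unique[OF ij(2,1) ij(3)[symmetric] r pv(1)]) auto
    then show ?thesis using pv(2) r unfolding G_def by blast
  qed
  moreover have "(j, i) \<in> Pairs" using ij by (simp add: Pairs_def)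
  ultimately show ?thesis using assms by auto
qed

lemma indicator_sum:
  assumes "\<And>k. k < n \<Longrightarrow> \<gamma> \<notin> Nv k"
  shows "2 * indicator (geodesics_meeting K D) \<gamma> = (\<Sum>q\<in>Pairs. indicator (G (fst q) (snd q)) \<gamma> :: real)"
proof (cases "\<gamma> \<in> geodesics_meeting K D")
  case True
  then obtain i j where ij: "(i, j) \<in> Pairs" "\<gamma> \<in> G i j" using meeting_cover[OF True] assms by blast
  have "(\<Sum>q\<in>Pairs. indicator (G (fst q) (snd q)) \<gamma> :: real) = (\<Sum>q\<in>{q \<in> Pairs. \<gamma> \<in> G (fst q) (snd q)}. 1)"
    by (rule sum.mono_neutral_cong_right[OF finite_Pairs]) auto
  also have "\<dots> = 2" unfolding G_count[OF ij] using ij(1) by (simp add: Pairs_def)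
  finally show ?thesis using True by simp
next
  case False
  then have "indicator (G (fst q) (snd q)) \<gamma> = (0::real)" if "q \<in> Pairs" for q
    using G_subset[of "fst q" "snd q"] that by (auto simp: indicator_def)
  then show ?thesis using False by simp
qed

text \<open>Almost every geodesic misses the vertices, so only the sets \<open>G i j\<close>
  contribute to the integral; \<open>N\<close> supplies the measurability of \<open>F\<close> on the
  remaining null set.\<close>

lemma meeting_integral:
  fixes F :: "pt set \<Rightarrow> real"
  assumes N: "\<And>k. k < n \<Longrightarrow> (\<lambda>\<gamma>. indicator (Nv k) \<gamma> * F \<gamma>) \<in> borel_measurable \<mu>"
    and G: "\<And>i j. (i, j) \<in> Pairs \<Longrightarrow> integrable \<mu> (\<lambda>\<gamma>. indicator (G i j) \<gamma> * F \<gamma>)"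
  shows "integrable \<mu> (\<lambda>\<gamma>. indicator (geodesics_meeting K D) \<gamma> * F \<gamma>)"
    "2 * (\<integral>\<gamma>. indicator (geodesics_meeting K D) \<gamma> * F \<gamma> \<partial>\<mu>) =
      (\<Sum>q\<in>Pairs. \<integral>\<gamma>. indicator (G (fst q) (snd q)) \<gamma> * F \<gamma> \<partial>\<mu>)"
proof -
  define A where "A c = (case c of Inl q \<Rightarrow> G (fst q) (snd q) | Inr k \<Rightarrow> Nv k)" for c :: "(nat \<times> nat) + nat"
  define I where "I = Inl ` Pairs \<union> Inr ` {..<n}"
  have m: "(\<lambda>\<gamma>. indicator (geodesics_meeting K D) \<gamma> * F \<gamma>) \<in> borel_measurable \<mu>"
  proof (rule borel_measurable_cover[where I = I and A = A])
    show "finite I" unfolding I_def using finite_Pairs by simp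
    show "A c \<in> sets \<mu>" if "c \<in> I" for c
      using that G_sets Nv_sets by (auto simp: I_def A_def Pairs_def)
    show "(\<Union>c\<in>I. A c) = geodesics_meeting K D"
    proof
      show "(\<Union>c\<in>I. A c) \<subseteq> geodesics_meeting K D"
        using G_subset Nv_subset by (fastforce simp: I_def A_def)
      show "geodesics_meeting K D \<subseteq> (\<Union>c\<in>I. A c)"
        using meeting_cover by (fastforce simp: I_def A_def)
    qed
    show "(\<lambda>x. indicator (A c) x * F x) \<in> borel_measurable \<mu>" if c: "c \<in> I" for c
    proof (cases c)
      case (Inl q)
      then have "(fst q, snd q) \<in> Pairs" using c by (auto simp: I_def)
      from borel_measurable_integrable[OF G[OF this]] show ?thesis using Inl by (simp add: A_def)
    next
      case (Inr k)
      then show ?thesis using c N by (auto simp: I_def A_def)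
    qed
  qed
  have gi: "integrable \<mu> (\<lambda>\<gamma>. indicator (G (fst q) (snd q)) \<gamma> * F \<gamma>)" if "q \<in> Pairs" for q
    using G[of "fst q" "snd q"] that by simp
  have si: "integrable \<mu> (\<lambda>\<gamma>. \<Sum>q\<in>Pairs. indicator (G (fst q) (snd q)) \<gamma> * F \<gamma>)"
    by (rule Bochner_Integration.integrable_sum) (rule gi)
  have "AE \<gamma> in \<mu>. \<forall>k\<in>{..<n}. \<gamma> \<notin> Nv k"
    by (rule AE_finite_allI) (auto intro: AE_not_in Nv_null)
  then have ae: "AE \<gamma> in \<mu>. (\<Sum>q\<in>Pairs. indicator (G (fst q) (snd q)) \<gamma> * F \<gamma>) = 2 * (indicator (geodesics_meeting K D) \<gamma> * F \<gamma>)"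
  proof eventually_elim
    case (elim \<gamma>)
    have "(\<Sum>q\<in>Pairs. indicator (G (fst q) (snd q)) \<gamma> * F \<gamma>) = (\<Sum>q\<in>Pairs. indicator (G (fst q) (snd q)) \<gamma>) * F \<gamma>"
      by (rule sum_distrib_right[symmetric])
    then show ?case using indicator_sum[of \<gamma>] elim by simp
  qed
  have m2: "(\<lambda>\<gamma>. 2 * (indicator (geodesics_meeting K D) \<gamma> * F \<gamma>)) \<in> borel_measurable \<mu>"
    by (intro borel_measurable_times borel_measurable_const m)
  have "integrable \<mu> (\<lambda>\<gamma>. 2 * (indicator (geodesics_meeting K D) \<gamma> * F \<gamma>))"
    by (rule integrable_cong_AE_imp[OF si m2]) (use ae in \<open>eventually_elim, simp\<close>)
  then show "integrable \<mu> (\<lambda>\<gamma>. indicator (geodesics_meeting K D) \<gamma> * F \<gamma>)" by simp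
  have "2 * (\<integral>\<gamma>. indicator (geodesics_meeting K D) \<gamma> * F \<gamma> \<partial>\<mu>) = (\<integral>\<gamma>. 2 * (indicator (geodesics_meeting K D) \<gamma> * F \<gamma>) \<partial>\<mu>)"
    by simp
  also have "\<dots> = (\<integral>\<gamma>. (\<Sum>q\<in>Pairs. indicator (G (fst q) (snd q)) \<gamma> * F \<gamma>) \<partial>\<mu>)"
    by (rule integral_cong_AE[OF m2 borel_measurable_integrable[OF si]]) (use ae in \<open>eventually_elim, simp\<close>)
  also have "\<dots> = (\<Sum>q\<in>Pairs. \<integral>\<gamma>. indicator (G (fst q) (snd q)) \<gamma> * F \<gamma> \<partial>\<mu>)"
    by (rule Bochner_Integration.integral_sum) (rule gi)
  finally show "2 * (\<integral>\<gamma>. indicator (geodesics_meeting K D) \<gamma> * F \<gamma> \<partial>\<mu>) =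
      (\<Sum>q\<in>Pairs. \<integral>\<gamma>. indicator (G (fst q) (snd q)) \<gamma> * F \<gamma> \<partial>\<mu>)" .
qed

context
  fixes f f' :: "real \<Rightarrow> real"
  assumes f: "\<And>x. (f has_real_derivative f' x) (at x)" and f': "continuous_on UNIV f'"
begin

lemma f_continuous: "continuous_on UNIV f"
  by (rule DERIV_continuous_on) (rule f)

abbreviation F1 :: "pt set \<Rightarrow> real" where "F1 \<gamma> \<equiv> f (chord_length K D \<gamma>)"
abbreviation F2 :: "pt set \<Rightarrow> real" where
  "F2 \<gamma> \<equiv> f' (chord_length K D \<gamma>) * sinK K (chord_length K D \<gamma>) * cot (chord_angle1 K D \<gamma>) * cot (chord_angle2 K D \<gamma>)"

text \<open>Through a vertex the angles have a constant default value, so both integrands are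
  continuous functions of the chord length there.\<close>

lemma vertex_measurable:
  assumes k: "k < n"
  shows "(\<lambda>\<gamma>. indicator (Nv k) \<gamma> * F1 \<gamma>) \<in> borel_measurable \<mu>"
    "(\<lambda>\<gamma>. indicator (Nv k) \<gamma> * F2 \<gamma>) \<in> borel_measurable \<mu>"
proof -
  define c :: "real \<times> real" where "c = (SOME (a1, a2). False)"
  define l where "l \<gamma> = indicator (Nv k) \<gamma> * chord_length K D \<gamma>" for \<gamma>
  have l: "l \<in> borel_measurable \<mu>" unfolding l_def[abs_def] by (rule Nv_chord_measurable[OF k])
  have comp: "(\<lambda>\<gamma>. \<phi> (l \<gamma>)) \<in> borel_measurable \<mu>" if "continuous_on UNIV \<phi>" for \<phi> :: "real \<Rightarrow> real"
    by (rule measurable_compose[OF l borel_measurable_continuous_onI[OF that]])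
  have i: "(\<lambda>\<gamma>. indicator (Nv k) \<gamma> :: real) \<in> borel_measurable \<mu>" using Nv_sets[OF k] by simp
  have e1: "indicator (Nv k) \<gamma> * F1 \<gamma> = indicator (Nv k) \<gamma> * f (l \<gamma>)" for \<gamma>
    by (cases "\<gamma> \<in> Nv k") (simp_all add: l_def)
  show "(\<lambda>\<gamma>. indicator (Nv k) \<gamma> * F1 \<gamma>) \<in> borel_measurable \<mu>"
    unfolding e1 by (intro borel_measurable_times i comp f_continuous)
  have e2: "indicator (Nv k) \<gamma> * F2 \<gamma> = indicator (Nv k) \<gamma> * (f' (l \<gamma>) * sinK K (l \<gamma>) * cot (fst c) * cot (snd c))" for \<gamma>
  proof (cases "\<gamma> \<in> Nv k")
    case True
    then have "chord_angles K D \<gamma> = c" unfolding c_def by (intro chord_angles_vertex[OF k]) (simp add: Nv_def)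
    then show ?thesis using True by (simp add: l_def chord_angle1_def chord_angle2_def)
  qed simp
  show "(\<lambda>\<gamma>. indicator (Nv k) \<gamma> * F2 \<gamma>) \<in> borel_measurable \<mu>"
    unfolding e2 by (intro borel_measurable_times borel_measurable_const i comp f' continuous_on_sinK continuous_on_id)
qed

text \<open>The integrand with \<open>f\<close> is dominated by a multiple of the integrable
  density; the one with \<open>f'\<close>, multiplied by the density, is bounded on a bounded
  rectangle. So both may be integrated over \<open>t\<close> first, where
  \<open>edge_integral\<close> applies.\<close>

lemma pair_integrals:
  assumes i: "i < n" and j: "j < n" and ij: "i \<noteq> j"
  defines "Z \<equiv> \<lambda>s y. - f (rho i s y) * (cB i s y / cS i s y)"
  shows "integrable \<mu> (\<lambda>\<gamma>. indicator (G i j) \<gamma> * F1 \<gamma>)" "integrable \<mu> (\<lambda>\<gamma>. indicator (G i j) \<gamma> * F2 \<gamma>)"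
    "integrable lborel (\<lambda>s. indicator {0<..<L i} s *\<^sub>R (Z s (P (Suc j mod n)) - Z s (P j)))"
    "(\<integral>\<gamma>. indicator (G i j) \<gamma> * F1 \<gamma> \<partial>\<mu>) - (\<integral>\<gamma>. indicator (G i j) \<gamma> * F2 \<gamma> \<partial>\<mu>) =
      (\<integral>s. indicator {0<..<L i} s *\<^sub>R (Z s (P (Suc j mod n)) - Z s (P j)) \<partial>lborel)"
proof -
  let ?r = "\<lambda>x. rho i (fst x) (E j (snd x))"
  let ?b = "\<lambda>x. cB i (fst x) (E j (snd x)) / cS i (fst x) (E j (snd x)) * cR i j (fst x) (snd x)"
  let ?w = "\<lambda>x. wt i j (fst x) (snd x)"
  let ?I = "indicator (rect i j) :: real \<times> real \<Rightarrow> real"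
  note S = cS_rect[OF i j ij] and wp = wt_rect_pos[OF i j ij] and rc = rect_continuous[OF i j ij]
  have cr: "continuous_on X ?r" for X
    by (rule continuous_rho[OF i j continuous_on_fst[OF continuous_on_id] continuous_on_snd[OF continuous_on_id]])
  have bound: "\<exists>M. \<forall>x\<in>rect i j. \<bar>\<phi> (?r x)\<bar> \<le> M" if "continuous_on UNIV \<phi>" for \<phi> :: "real \<Rightarrow> real"
  proof -
    have "compact ((\<lambda>x. \<phi> (?r x)) ` ({0..L i} \<times> {0..L j}))"
      by (intro compact_continuous_image compact_Times compact_Icc continuous_on_compose2[OF that cr]) auto
    then obtain M where M: "\<forall>y\<in>(\<lambda>x. \<phi> (?r x)) ` ({0..L i} \<times> {0..L j}). norm y \<le> M"
      using compact_imp_bounded bounded_iff by metis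
    have "\<bar>\<phi> (?r x)\<bar> \<le> M" if "x \<in> rect i j" for x
    proof -
      have "x \<in> {0..L i} \<times> {0..L j}" using that by (simp add: rect_iff mem_Times_iff)
      then have "\<phi> (?r x) \<in> (\<lambda>x. \<phi> (?r x)) ` ({0..L i} \<times> {0..L j})" by (rule imageI)
      from bspec[OF M this] show ?thesis by simp
    qed
    then show ?thesis by blast
  qed
  have H1: "continuous_on (rect i j) (\<lambda>x. f (?r x))" by (rule continuous_on_compose2[OF f_continuous cr]) simp
  have cf': "continuous_on (rect i j) (\<lambda>x. f' (?r x))" by (rule continuous_on_compose2[OF f' cr]) simp
  have cb: "continuous_on (rect i j) (\<lambda>x. f' (?r x) * ?b x)" by (intro continuous_on_mult cf' rc)
  \<comment> \<open>\<open>G_integral\<close> multiplies by the density again, so the product of the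
    cosines enters divided by it.\<close>
  have H2: "continuous_on (rect i j) (\<lambda>x. f' (?r x) * ?b x / ?w x)"
    by (rule continuous_on_divide[OF cb rc(1)]) (use wp in force)
  have F1: "F1 (Psi i j x) = f (?r x)" if "x \<in> rect i j" for x using Psi_facts(4)[OF i j ij that] by simp
  have F2: "F2 (Psi i j x) = f' (?r x) * ?b x / ?w x" if x: "x \<in> rect i j" for x
  proof -
    have "sinK K (?r x) = cS i (fst x) (E j (snd x))"
      unfolding rho_def by (rule argK(2)[OF edge_norm[OF i E_surface[OF j]] S[OF x] quad_pos[OF E_surface[OF i] E_surface[OF j]]])
    then have "F2 (Psi i j x) = f' (?r x) * (cot (chord_angle1 K D (Psi i j x)) * cot (chord_angle2 K D (Psi i j x)) * cS i (fst x) (E j (snd x)))"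
      using Psi_facts(4)[OF i j ij x] by simp
    also have "cot (chord_angle1 K D (Psi i j x)) * cot (chord_angle2 K D (Psi i j x)) * cS i (fst x) (E j (snd x)) = ?b x / ?w x"
      by (rule eq_divide_imp[OF _ Psi_facts(5)[OF i j ij x]]) (use wp[OF x] in simp)
    finally show ?thesis by simp
  qed
  have eq2: "?I x * (f' (?r x) * ?b x / ?w x * ?w x) = ?I x * (f' (?r x) * ?b x)" for x
    using wp[of x] by (cases "x \<in> rect i j") auto
  have int1: "integrable lborel (\<lambda>x. ?I x * (f (?r x) * ?w x))"
  proof -
    obtain M where M: "\<And>x. x \<in> rect i j \<Longrightarrow> \<bar>f (?r x)\<bar> \<le> M" using bound[OF f_continuous] by blast
    show ?thesis
    proof (rule Bochner_Integration.integrable_bound)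
      show "integrable lborel (\<lambda>x. M * W i j x)" by (intro integrable_mult_right W_integrable[OF i j ij])
      show "(\<lambda>x. ?I x * (f (?r x) * ?w x)) \<in> borel_measurable lborel"
        using borel_rect[OF i j ij continuous_on_mult[OF H1 rc(1)]] by simp
      have "norm (?I x * (f (?r x) * ?w x)) \<le> norm (M * W i j x)" for x
      proof (cases "x \<in> rect i j")
        case True
        have "\<bar>f (?r x)\<bar> * \<bar>?w x\<bar> \<le> \<bar>M\<bar> * \<bar>?w x\<bar>"
          using M[OF True] by (intro mult_right_mono) auto
        then show ?thesis using True by (simp add: W_def[OF i j ij] abs_mult)
      qed simp
      then show "AE x in lborel. norm (?I x * (f (?r x) * ?w x)) \<le> norm (M * W i j x)" by simp
    qed
  qed
  have fin: "emeasure lborel (rect i j) < \<infinity>"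
  proof -
    have "bounded (rect i j)" unfolding rect_def by (intro bounded_Times) auto
    then show ?thesis by (rule emeasure_bounded_finite)
  qed
  have int2: "integrable lborel (\<lambda>x. ?I x * (f' (?r x) * ?b x))"
  proof -
    obtain M where M: "\<And>x. x \<in> rect i j \<Longrightarrow> \<bar>f' (?r x)\<bar> \<le> M" using bound[OF f'] by blast
    show ?thesis
    proof (rule Bochner_Integration.integrable_bound)
      show "integrable lborel (\<lambda>x. M * ?I x)"
        using fin open_rect by (intro integrable_mult_right integrable_real_indicator) auto
      show "(\<lambda>x. ?I x * (f' (?r x) * ?b x)) \<in> borel_measurable lborel"
        using borel_rect[OF i j ij cb] by simp
      have "norm (?I x * (f' (?r x) * ?b x)) \<le> norm (M * ?I x)" for x
      proof (cases "x \<in> rect i j")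
        case True
        have "(cB i (fst x) (E j (snd x)))\<^sup>2 \<le> (cS i (fst x) (E j (snd x)))\<^sup>2" by (simp add: cS_sq)
        then have "\<bar>cB i (fst x) (E j (snd x))\<bar> \<le> cS i (fst x) (E j (snd x))"
          using S[OF True] by (metis abs_le_square_iff abs_of_pos)
        then have 1: "\<bar>cB i (fst x) (E j (snd x)) / cS i (fst x) (E j (snd x))\<bar> \<le> 1"
          using S[OF True] by (simp add: abs_divide)
        have 2: "\<bar>cR i j (fst x) (snd x)\<bar> \<le> 1"
          using dir_other_end(3)[OF i j S[OF True]] by (simp add: abs_square_le_1)
        have "\<bar>?b x\<bar> \<le> 1" unfolding abs_mult using mult_mono[OF 1 2] by simp
        then have "\<bar>f' (?r x)\<bar> * \<bar>?b x\<bar> \<le> \<bar>M\<bar> * 1"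
          using M[OF True] by (intro mult_mono) auto
        then show ?thesis using True by (simp add: abs_mult)
      qed simp
      then show "AE x in lborel. norm (?I x * (f' (?r x) * ?b x)) \<le> norm (M * ?I x)" by simp
    qed
  qed
  note g1 = G_integral[OF i j ij H1 F1 int1]
  have int2': "integrable lborel (\<lambda>x. ?I x * (f' (?r x) * ?b x / ?w x * ?w x))" unfolding eq2 by (rule int2)
  note g2 = G_integral[OF i j ij H2 F2 int2', unfolded eq2]
  show "integrable \<mu> (\<lambda>\<gamma>. indicator (G i j) \<gamma> * F1 \<gamma>)" by (rule g1(1))
  show "integrable \<mu> (\<lambda>\<gamma>. indicator (G i j) \<gamma> * F2 \<gamma>)" by (rule g2(1))
  let ?h = "\<lambda>x. ?I x * (f (?r x) * ?w x) - ?I x * (f' (?r x) * ?b x)"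
  have inth: "integrable (lborel \<Otimes>\<^sub>M lborel) ?h"
    unfolding lborel_prod by (rule Bochner_Integration.integrable_diff[OF int1 int2])
  have inner: "(\<integral>t. ?h (s, t) \<partial>lborel) = indicator {0<..<L i} s *\<^sub>R (Z s (P (Suc j mod n)) - Z s (P j))" for s
  proof (cases "0 < s \<and> s < L i")
    case True
    have "(\<integral>t. ?h (s, t) \<partial>lborel) = (\<integral>t. indicator {0<..<L j} t *\<^sub>R (f (rho i s (E j t)) * wt i j s t
      - f' (rho i s (E j t)) * (cB i s (E j t) / cS i s (E j t) * cR i j s t)) \<partial>lborel)"
      using True by (intro Bochner_Integration.integral_cong) (auto simp: indicator_def rect_iff)
    then show ?thesis unfolding Z_def using edge_integral[OF i _ _ j _ f f', of s] True ij by simp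
  next
    case False
    then have "(s, t) \<notin> rect i j" for t by (auto simp: rect_iff)
    then show ?thesis using False by simp
  qed
  have "integrable lborel (\<lambda>s. \<integral>t. ?h (s, t) \<partial>lborel)" by (rule lborel_pair.integrable_fst'[OF inth])
  then show "integrable lborel (\<lambda>s. indicator {0<..<L i} s *\<^sub>R (Z s (P (Suc j mod n)) - Z s (P j)))"
    by (simp only: inner)
  have "(\<integral>\<gamma>. indicator (G i j) \<gamma> * F1 \<gamma> \<partial>\<mu>) - (\<integral>\<gamma>. indicator (G i j) \<gamma> * F2 \<gamma> \<partial>\<mu>) = (\<integral>x. ?h x \<partial>lborel)"
  proof -
    have "(\<integral>\<gamma>. indicator (G i j) \<gamma> * F1 \<gamma> \<partial>\<mu>) = (\<integral>x. ?I x * (f (?r x) * ?w x) \<partial>lborel)" by (rule g1(2))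
    moreover have "(\<integral>\<gamma>. indicator (G i j) \<gamma> * F2 \<gamma> \<partial>\<mu>) = (\<integral>x. ?I x * (f' (?r x) * ?b x) \<partial>lborel)" by (rule g2(2))
    ultimately show ?thesis using Bochner_Integration.integral_diff[OF int1 int2] by (simp only:)
  qed
  also have "\<dots> = (\<integral>x. ?h x \<partial>(lborel \<Otimes>\<^sub>M lborel))" by (simp only: lborel_prod)
  also have "\<dots> = (\<integral>s. \<integral>t. ?h (s, t) \<partial>lborel \<partial>lborel)" by (rule lborel_pair.integral_fst'[OF inth, symmetric])
  finally show "(\<integral>\<gamma>. indicator (G i j) \<gamma> * F1 \<gamma> \<partial>\<mu>) - (\<integral>\<gamma>. indicator (G i j) \<gamma> * F2 \<gamma> \<partial>\<mu>) =
      (\<integral>s. indicator {0<..<L i} s *\<^sub>R (Z s (P (Suc j mod n)) - Z s (P j)) \<partial>lborel)"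
    by (simp only: inner)
qed

lemma meeting_identity:
  "integrable \<mu> (\<lambda>\<gamma>. indicator (geodesics_meeting K D) \<gamma> * F1 \<gamma>)"
  "integrable \<mu> (\<lambda>\<gamma>. indicator (geodesics_meeting K D) \<gamma> * F2 \<gamma>)"
  "(\<integral>\<gamma>. indicator (geodesics_meeting K D) \<gamma> * F1 \<gamma> \<partial>\<mu>) =
    (\<integral>\<gamma>. indicator (geodesics_meeting K D) \<gamma> * F2 \<gamma> \<partial>\<mu>) + (\<Sum>i<n. integral {0..L i} f)"
proof -
  define Z where "Z i s y = - f (rho i s y) * (cB i s y / cS i s y)" for i s y
  have pr: "integrable \<mu> (\<lambda>\<gamma>. indicator (G i j) \<gamma> * F1 \<gamma>)" "integrable \<mu> (\<lambda>\<gamma>. indicator (G i j) \<gamma> * F2 \<gamma>)"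
    "integrable lborel (\<lambda>s. indicator {0<..<L i} s *\<^sub>R (Z i s (P (Suc j mod n)) - Z i s (P j)))"
    "(\<integral>\<gamma>. indicator (G i j) \<gamma> * F1 \<gamma> \<partial>\<mu>) - (\<integral>\<gamma>. indicator (G i j) \<gamma> * F2 \<gamma> \<partial>\<mu>) =
      (\<integral>s. indicator {0<..<L i} s *\<^sub>R (Z i s (P (Suc j mod n)) - Z i s (P j)) \<partial>lborel)"
    if "(i, j) \<in> Pairs" for i j
    using pair_integrals[of i j] that unfolding Z_def Pairs_def by simp_all
  note m1 = meeting_integral[OF vertex_measurable(1) pr(1)] and m2 = meeting_integral[OF vertex_measurable(2) pr(2)]
  show "integrable \<mu> (\<lambda>\<gamma>. indicator (geodesics_meeting K D) \<gamma> * F1 \<gamma>)" by (rule m1(1))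
  show "integrable \<mu> (\<lambda>\<gamma>. indicator (geodesics_meeting K D) \<gamma> * F2 \<gamma>)" by (rule m2(1))
  let ?J = "\<lambda>i j. \<integral>s. indicator {0<..<L i} s *\<^sub>R (Z i s (P (Suc j mod n)) - Z i s (P j)) \<partial>lborel"
  have a1: "2 * (\<integral>\<gamma>. indicator (geodesics_meeting K D) \<gamma> * F1 \<gamma> \<partial>\<mu>) =
      (\<Sum>q\<in>Pairs. \<integral>\<gamma>. indicator (G (fst q) (snd q)) \<gamma> * F1 \<gamma> \<partial>\<mu>)" by (rule m1(2))
  have a2: "2 * (\<integral>\<gamma>. indicator (geodesics_meeting K D) \<gamma> * F2 \<gamma> \<partial>\<mu>) =
      (\<Sum>q\<in>Pairs. \<integral>\<gamma>. indicator (G (fst q) (snd q)) \<gamma> * F2 \<gamma> \<partial>\<mu>)" by (rule m2(2))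
  have a3: "(\<Sum>q\<in>Pairs. (\<integral>\<gamma>. indicator (G (fst q) (snd q)) \<gamma> * F1 \<gamma> \<partial>\<mu>) -
      (\<integral>\<gamma>. indicator (G (fst q) (snd q)) \<gamma> * F2 \<gamma> \<partial>\<mu>)) = (\<Sum>q\<in>Pairs. ?J (fst q) (snd q))"
    by (rule sum.cong[OF refl], rule pr(4)) simp
  have "2 * (\<integral>\<gamma>. indicator (geodesics_meeting K D) \<gamma> * F1 \<gamma> \<partial>\<mu>) - 2 * (\<integral>\<gamma>. indicator (geodesics_meeting K D) \<gamma> * F2 \<gamma> \<partial>\<mu>)
    = (\<Sum>q\<in>Pairs. ?J (fst q) (snd q))"
    using a3 unfolding a1 a2 sum_subtractf .
  also have "Pairs = Sigma {..<n} (\<lambda>i. {..<n} - {i})" by (auto simp: Pairs_def)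
  also have "(\<Sum>q\<in>Sigma {..<n} (\<lambda>i. {..<n} - {i}). ?J (fst q) (snd q)) = (\<Sum>i<n. \<Sum>j\<in>{..<n} - {i}. ?J i j)"
    by (subst sum.Sigma) (auto simp: case_prod_beta)
  also have "\<dots> = (\<Sum>i<n. 2 * integral {0..L i} f)"
  proof (rule sum.cong[OF refl])
    fix i assume "i \<in> {..<n}"
    then have i: "i < n" by simp
    \<comment> \<open>The sum is moved inside the integral, because the boundary terms cancel for
      fixed \<open>s\<close>.\<close>
    have "(\<Sum>j\<in>{..<n} - {i}. ?J i j) =
        (\<integral>s. (\<Sum>j\<in>{..<n} - {i}. indicator {0<..<L i} s *\<^sub>R (Z i s (P (Suc j mod n)) - Z i s (P j))) \<partial>lborel)"
      by (rule Bochner_Integration.integral_sum[symmetric]) (rule pr(3), use i in \<open>auto simp: Pairs_def\<close>)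
    also have "\<dots> = (\<integral>s. indicator {0<..<L i} s *\<^sub>R (f s + f (L i - s)) \<partial>lborel)"
    proof (rule Bochner_Integration.integral_cong[OF refl])
      fix s
      show "(\<Sum>j\<in>{..<n} - {i}. indicator {0<..<L i} s *\<^sub>R (Z i s (P (Suc j mod n)) - Z i s (P j))) =
        indicator {0<..<L i} s *\<^sub>R (f s + f (L i - s))"
        using boundary_terms[OF i, of s f] unfolding scaleR_right.sum[symmetric] Z_def
        by (cases "s \<in> {0<..<L i}") simp_all
    qed
    also have "\<dots> = 2 * integral {0..L i} f"
      by (rule integral_reflect_interval[OF f_continuous]) (use L_pos[OF i] in simp)
    finally show "(\<Sum>j\<in>{..<n} - {i}. ?J i j) = 2 * integral {0..L i} f" .
  qed
  also have "\<dots> = 2 * (\<Sum>i<n. integral {0..L i} f)" by (rule sum_distrib_left[symmetric])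
  finally show "(\<integral>\<gamma>. indicator (geodesics_meeting K D) \<gamma> * F1 \<gamma> \<partial>\<mu>) =
    (\<integral>\<gamma>. indicator (geodesics_meeting K D) \<gamma> * F2 \<gamma> \<partial>\<mu>) + (\<Sum>i<n. integral {0..L i} f)" by simp
qed

end

end

theorem theorem3:
  fixes K :: real and D :: "pt set" and \<mu> :: "pt set measure"
    and n :: nat and P V :: "nat \<Rightarrow> pt" and L :: "nat \<Rightarrow> real"
    and f f' :: "real \<Rightarrow> real"
  assumes "invariant_measure K \<mu>"
    and "convex_compact_domain K D"
    and "geodesic_polygon K n P V L"
    and "bdry K D = (\<Union>i<n. edge K P V L i)"
    and "\<And>x. (f has_real_derivative f' x) (at x)"
    and "continuous_on UNIV f'"
  shows "set_integrable \<mu> (geodesics_meeting K D) (\<lambda>\<gamma>. f (chord_length K D \<gamma>)) \<and>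
    set_integrable \<mu> (geodesics_meeting K D)
      (\<lambda>\<gamma>. f' (chord_length K D \<gamma>) * sinK K (chord_length K D \<gamma>) *
           cot (chord_angle1 K D \<gamma>) * cot (chord_angle2 K D \<gamma>)) \<and>
    (LINT \<gamma>:geodesics_meeting K D|\<mu>. f (chord_length K D \<gamma>)) =
      (LINT \<gamma>:geodesics_meeting K D|\<mu>.
         f' (chord_length K D \<gamma>) * sinK K (chord_length K D \<gamma>) *
         cot (chord_angle1 K D \<gamma>) * cot (chord_angle2 K D \<gamma>))
      + (\<Sum>i<n. integral {0..L i} f)"
proof -
  interpret polygon_measure K D n P V L \<mu>
    by unfold_locales (rule assms)+
  show ?thesis
    unfolding set_integrable_def set_lebesgue_integral_def real_scaleR_def
    using meeting_identity[OF assms(5,6)] by blast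
qed

end
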